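(* Let $\Gamma$ be a finitely generated hyperbolic group and let $\Lambda$ be a finitely generated group. For every $p>q>0$, if there is a $(\varphi,\psi)$-integrable orbit equivalence coupling from $\Gamma$ to $\Lambda$, where $\varphi(t)=\exp(t^p)$ and $\psi(t)=t^{1+1/q}$, then $\Lambda$ is also hyperbolic.
   Context: A geodesic metric space $(X,d)$ is $\delta$-hyperbolic ($\delta\ge 0$) if each side of every geodesic triangle is contained in the $\delta$-neighbourhood of the union of the other two sides; it is hyperbolic if it is $\delta$-hyperbolic for some $\delta$. A finitely generated group is hyperbolic if its Cayley graph with respect to a finite generating set, with edges identified with unit intervals and endowed with the path metric, is hyperbolic. A measure equivalence coupling from a countable group $\Gamma$ to a countable group $\Lambda$ is a tuple $(\Omega,\mu,X_\Gamma,X_\Lambda)$ where $(\Omega,\mu)$ is a nonzero $\sigma$-finite standard measured space endowed with commuting free measure-preserving actions of $\Gamma$ and $\Lambda$ (both denoted $*$), and $X_\Gamma$, $X_\Lambda\subseteq\Omega$ are finite measure fundamental domains for the $\Gamma$-action and the $\Lambda$-action respectively. Here a fundamental domain for the $\Gamma$-action is a measurable subset $X_\Gamma\subseteq\Omega$ such that $\Gamma\times X_\Gamma\to\Omega$, $(\gamma,x)\mapsto\gamma*x$, is a measure-preserving bijection for the product of counting measure and $\mu|_{X_\Gamma}$ (similarly for $\Lambda$). An orbit equivalence coupling is a measure equivalence coupling with $X_\Gamma=X_\Lambda$. The associated cocycles $\alpha:\Gamma\times X_\Lambda\to\Lambda$ and $\beta:\Lambda\times X_\Gamma\to\Gamma$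 are uniquely defined by $\alpha(\gamma,x)*(\gamma*x)\in X_\Lambda$ for $\gamma\in\Gamma$, $x\in X_\Lambda$, and $\beta(\lambda,x)*(\lambda*x)\in X_\Gamma$ for $\lambda\in\Lambda$, $x\in X_\Gamma$. Let $S_\Gamma,S_\Lambda$ be finite generating sets of $\Gamma,\Lambda$ with word lengths $|\cdot|_{S_\Gamma},|\cdot|_{S_\Lambda}$. For non-decreasing $\varphi,\psi:\mathbb{R}_{\ge0}\to\mathbb{R}_{\ge0}$, the coupling is $(\varphi,\psi)$-integrable if there is $c>0$ such that $\int_{X_\Lambda}\varphi(c|\alpha(s,x)|_{S_\Lambda})\,d\mu(x)<+\infty$ for all $s\in S_\Gamma$ and $\int_{X_\Gamma}\psi(c|\beta(t,x)|_{S_\Gamma})\,d\mu(x)<+\infty$ for all $t\in S_\Lambda$. (This does not depend on the choice of finite generating sets.) *)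

theory Defs
  imports
    "HOL-Analysis.Analysis"
    "HOL-Algebra.Generated_Groups"
    "HOL-Algebra.Group_Action"
begin

section \<open>Hyperbolic geodesic spaces\<close>

definition geodesic_segment ::
    "'x set \<Rightarrow> ('x \<Rightarrow> 'x \<Rightarrow> real) \<Rightarrow> 'x \<Rightarrow> 'x \<Rightarrow> 'x set \<Rightarrow> bool" where
  "geodesic_segment X d x y A \<longleftrightarrow>
     (\<exists>c. c ` {0..d x y} = A \<and> A \<subseteq> X \<and> c 0 = x \<and> c (d x y) = y \<and>
          (\<forall>s\<in>{0..d x y}. \<forall>t\<in>{0..d x y}. d (c s) (c t) = \<bar>s - t\<bar>))"

definition geodesic_space :: "'x set \<Rightarrow> ('x \<Rightarrow> 'x \<Rightarrow> real) \<Rightarrow> bool" where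
  "geodesic_space X d \<longleftrightarrow>
     Metric_space X d \<and> (\<forall>x\<in>X. \<forall>y\<in>X. \<exists>A. geodesic_segment X d x y A)"

text \<open>Neighbourhoods are closed, so that the case \<open>\<delta> = 0\<close> is meaningful.\<close>

definition neighbourhood ::
    "'x set \<Rightarrow> ('x \<Rightarrow> 'x \<Rightarrow> real) \<Rightarrow> real \<Rightarrow> 'x set \<Rightarrow> 'x set" where
  "neighbourhood X d \<delta> A = {x \<in> X. \<exists>a\<in>A. d x a \<le> \<delta>}"

definition delta_hyperbolic :: "real \<Rightarrow> 'x set \<Rightarrow> ('x \<Rightarrow> 'x \<Rightarrow> real) \<Rightarrow> bool" where
  "delta_hyperbolic \<delta> X d \<longleftrightarrow>
     (\<forall>x\<in>X. \<forall>y\<in>X. \<forall>z\<in>X. \<forall>A B C.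
        geodesic_segment X d x y A \<and> geodesic_segment X d y z B \<and> geodesic_segment X d z x C \<longrightarrow>
        A \<subseteq> neighbourhood X d \<delta> (B \<union> C) \<and>
        B \<subseteq> neighbourhood X d \<delta> (C \<union> A) \<and>
        C \<subseteq> neighbourhood X d \<delta> (A \<union> B))"

definition hyperbolic_space :: "'x set \<Rightarrow> ('x \<Rightarrow> 'x \<Rightarrow> real) \<Rightarrow> bool" where
  "hyperbolic_space X d \<longleftrightarrow> geodesic_space X d \<and> (\<exists>\<delta>\<ge>0. delta_hyperbolic \<delta> X d)"

section \<open>Geometric realization of a graph\<close>

text \<open>
  A simple graph is given by its vertex set and its set of edges, which are two-element sets
  of vertices.  Points of its realization are barycentric coordinates: \<open>edge_point u v t\<close> is
  the point of the edge \<open>{u, v}\<close> at distance \<open>t\<close> from \<open>u\<close>, and \<open>edge_point v v 0\<close> is the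
  vertex \<open>v\<close>.
\<close>

definition edge_point :: "'v \<Rightarrow> 'v \<Rightarrow> real \<Rightarrow> 'v \<Rightarrow> real" where
  "edge_point u v t = (\<lambda>w. (1 - t) * of_bool (w = u) + t * of_bool (w = v))"

definition graph_realization :: "'v set \<Rightarrow> 'v set set \<Rightarrow> ('v \<Rightarrow> real) set" where
  "graph_realization V E =
     {edge_point v v 0 | v. v \<in> V} \<union>
     {edge_point u v t | u v t. {u, v} \<in> E \<and> 0 \<le> t \<and> t \<le> 1}"

text \<open>\<open>edge_path E x y l\<close>: some piecewise linear path of length \<open>l\<close> joins \<open>x\<close> to \<open>y\<close>.\<close>

inductive edge_path :: "'v set set \<Rightarrow> ('v \<Rightarrow> real) \<Rightarrow> ('v \<Rightarrow> real) \<Rightarrow> real \<Rightarrow> bool"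
  for E :: "'v set set" where
  nil: "edge_path E x x 0"
| step: "\<lbrakk>{u, v} \<in> E; s \<in> {0..1}; t \<in> {0..1}; edge_path E (edge_point u v t) y l\<rbrakk>
         \<Longrightarrow> edge_path E (edge_point u v s) y (\<bar>s - t\<bar> + l)"

text \<open>The value \<open>0\<close> for points not joined by a path is a dummy: Cayley graphs with respect to
  generating sets are connected.\<close>

definition path_metric :: "'v set set \<Rightarrow> ('v \<Rightarrow> real) \<Rightarrow> ('v \<Rightarrow> real) \<Rightarrow> real" where
  "path_metric E x y =
     (if \<exists>l. edge_path E x y l then Inf {l. edge_path E x y l} else 0)"

section \<open>Finitely generated groups\<close>

definition finite_generating_set :: "('a, 'm) monoid_scheme \<Rightarrow> 'a set \<Rightarrow> bool" where
  "finite_generating_set G S \<longleftrightarrow>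
     finite S \<and> S \<subseteq> carrier G \<and> generate G S = carrier G"

definition word_length :: "('a, 'm) monoid_scheme \<Rightarrow> 'a set \<Rightarrow> 'a \<Rightarrow> nat" where
  "word_length G S g =
     (LEAST n. \<exists>ws. length ws = n \<and> set ws \<subseteq> S \<union> m_inv G ` S \<and>
                    foldr (mult G) ws (one G) = g)"

text \<open>Loops are omitted and parallel edges are identified; neither affects hyperbolicity.\<close>

definition cayley_edges :: "('a, 'm) monoid_scheme \<Rightarrow> 'a set \<Rightarrow> 'a set set" where
  "cayley_edges G S =
     {{g, g \<otimes>\<^bsub>G\<^esub> s} | g s. g \<in> carrier G \<and> s \<in> S \<and> g \<otimes>\<^bsub>G\<^esub> s \<noteq> g}"

definition hyperbolic_group :: "('a, 'm) monoid_scheme \<Rightarrow> bool" where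
  "hyperbolic_group G \<longleftrightarrow>
     group G \<and>
     (\<exists>S. finite_generating_set G S \<and>
          hyperbolic_space (graph_realization (carrier G) (cayley_edges G S))
                           (path_metric (cayley_edges G S)))"

section \<open>Measure equivalence couplings\<close>

definition standard_borel :: "'w measure \<Rightarrow> bool" where
  "standard_borel M \<longleftrightarrow>
     (\<exists>T. completely_metrizable_space T \<and> second_countable T \<and>
          topspace T = space M \<and> sets M = sigma_sets (topspace T) {U. openin T U})"

definition measure_preserving :: "'w measure \<Rightarrow> 'v measure \<Rightarrow> ('w \<Rightarrow> 'v) \<Rightarrow> bool" where
  "measure_preserving M N f \<longleftrightarrow> f \<in> measurable M N \<and> distr M N f = N"

definition free_mp_action ::
    "('a, 'm) monoid_scheme \<Rightarrow> 'w measure \<Rightarrow> ('a \<Rightarrow> 'w \<Rightarrow> 'w) \<Rightarrow> bool" where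
  "free_mp_action G M act \<longleftrightarrow>
     group_action G (space M) act \<and>
     (\<forall>g\<in>carrier G. measure_preserving M M (act g)) \<and>
     (\<forall>g\<in>carrier G. \<forall>x\<in>space M. act g x = x \<longrightarrow> g = \<one>\<^bsub>G\<^esub>)"

definition fundamental_domain ::
    "('a, 'm) monoid_scheme \<Rightarrow> 'w measure \<Rightarrow> ('a \<Rightarrow> 'w \<Rightarrow> 'w) \<Rightarrow> 'w set \<Rightarrow> bool" where
  "fundamental_domain G M act X \<longleftrightarrow>
     X \<in> sets M \<and>
     bij_betw (\<lambda>(g, x). act g x) (carrier G \<times> X) (space M) \<and>
     measure_preserving (count_space (carrier G) \<Otimes>\<^sub>M restrict_space M X) M (\<lambda>(g, x). act g x)"

text \<open>
  In the following, \<open>a\<close> and \<open>b\<close> are the actions of \<open>G\<close> and \<open>H\<close>, and \<open>X\<close> and \<open>Y\<close> are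
  fundamental domains for \<open>G\<close> and \<open>H\<close>, respectively.
\<close>

definition measure_equivalence_coupling ::
    "('a, 'm) monoid_scheme \<Rightarrow> ('b, 'n) monoid_scheme \<Rightarrow> 'w measure \<Rightarrow>
     ('a \<Rightarrow> 'w \<Rightarrow> 'w) \<Rightarrow> ('b \<Rightarrow> 'w \<Rightarrow> 'w) \<Rightarrow> 'w set \<Rightarrow> 'w set \<Rightarrow> bool" where
  "measure_equivalence_coupling G H M a b X Y \<longleftrightarrow>
     countable (carrier G) \<and> countable (carrier H) \<and>
     standard_borel M \<and> sigma_finite_measure M \<and> emeasure M (space M) \<noteq> 0 \<and>
     free_mp_action G M a \<and> free_mp_action H M b \<and>
     (\<forall>g\<in>carrier G. \<forall>h\<in>carrier H. \<forall>x\<in>space M. a g (b h x) = b h (a g x)) \<and>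
     fundamental_domain G M a X \<and> emeasure M X < \<infinity> \<and>
     fundamental_domain H M b Y \<and> emeasure M Y < \<infinity>"

definition orbit_equivalence_coupling ::
    "('a, 'm) monoid_scheme \<Rightarrow> ('b, 'n) monoid_scheme \<Rightarrow> 'w measure \<Rightarrow>
     ('a \<Rightarrow> 'w \<Rightarrow> 'w) \<Rightarrow> ('b \<Rightarrow> 'w \<Rightarrow> 'w) \<Rightarrow> 'w set \<Rightarrow> 'w set \<Rightarrow> bool" where
  "orbit_equivalence_coupling G H M a b X Y \<longleftrightarrow>
     measure_equivalence_coupling G H M a b X Y \<and> X = Y"

text \<open>
  The cocycle of the \<open>G\<close>-action \<open>a\<close> with values in \<open>H\<close>, for a fundamental domain \<open>Y\<close> of the
  \<open>H\<close>-action \<open>b\<close>.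
\<close>

definition coupling_cocycle ::
    "('b, 'n) monoid_scheme \<Rightarrow> ('a \<Rightarrow> 'w \<Rightarrow> 'w) \<Rightarrow> ('b \<Rightarrow> 'w \<Rightarrow> 'w) \<Rightarrow> 'w set \<Rightarrow>
     'a \<Rightarrow> 'w \<Rightarrow> 'b" where
  "coupling_cocycle H a b Y g x = (THE h. h \<in> carrier H \<and> b h (a g x) \<in> Y)"

definition integrable_coupling ::
    "(real \<Rightarrow> real) \<Rightarrow> (real \<Rightarrow> real) \<Rightarrow>
     ('a, 'm) monoid_scheme \<Rightarrow> 'a set \<Rightarrow> ('b, 'n) monoid_scheme \<Rightarrow> 'b set \<Rightarrow> 'w measure \<Rightarrow>
     ('a \<Rightarrow> 'w \<Rightarrow> 'w) \<Rightarrow> ('b \<Rightarrow> 'w \<Rightarrow> 'w) \<Rightarrow> 'w set \<Rightarrow> 'w set \<Rightarrow> bool" where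
  "integrable_coupling \<phi> \<psi> G S H T M a b X Y \<longleftrightarrow>
     (\<exists>c>0.
        (\<forall>s\<in>S. (\<integral>\<^sup>+x\<in>Y. ennreal (\<phi> (c * real (word_length H T (coupling_cocycle H a b Y s x)))) \<partial>M)
                 < \<infinity>) \<and>
        (\<forall>t\<in>T. (\<integral>\<^sup>+x\<in>X. ennreal (\<psi> (c * real (word_length G S (coupling_cocycle G b a X t x)))) \<partial>M)
                 < \<infinity>))"

end

theory Submission
  imports Defs "HOL-Real_Asymp.Real_Asymp"
begin

text \<open>
  For \<open>x\<close> in the common fundamental domain the cocycles give mutually inverse bijections
  between \<open>\<Lambda>\<close> and \<open>\<Gamma>\<close>.  Given \<open>N\<close> points of \<open>\<Lambda>\<close>, a union bound provides an \<open>x\<close> such that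
  neighbouring points are mapped at distance at most \<open>R = O(N powr (q / (q + 1)))\<close>, while points
  whose images are \<open>O(R)\<close>-close are themselves at distance \<open>O(R powr (1 + 1 / p))\<close>, which is
  \<open>o(N)\<close> because \<open>p > q\<close>.  Apply this to the points of a geodesic and of a path of length \<open>N\<close> in
  \<open>\<Lambda>\<close> with the same endpoints.  In \<open>\<Gamma>\<close> both image paths pass within \<open>O(log N) + R\<close> of every
  point of a geodesic, so pulling back, the geodesic of \<open>\<Lambda>\<close> lies within \<open>o(N)\<close> of the path.
  A geodesic space in which every geodesic stays within \<open>o(N)\<close> of all paths of length \<open>N\<close> with
  the same endpoints is hyperbolic.
\<close>

section \<open>Detours in geodesic spaces\<close>

text \<open>Integrability bounds averages only, so one \<open>x\<close> can be controlled at
  finitely many places at a time. Hence paths are discretised into \<open>n\<close> jumps of length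
  at most 1, and the map between the groups is chosen anew for each such chain. Counting the events
  of the union bound fixes the scales. Stretching concerns O(N) edges of \<Lambda>, each bad on a
  set of measure O(R powr -(1 + 1 / q)), which gives \<open>R\<close>. The inverse has to be
  controlled on whole balls of radius O(R) in \<Gamma>, about N * exp (O(R)) events of measure O(exp
  (-(c * \<tau>) powr p)), so \<tau> of order R powr (1 / p) suffices. The resulting exponent q / (q
  + 1) * (1 + 1 / p) is below 1 exactly when p > q. The obstacle is that the centres of these balls
  are images under a map that depends on \<open>x\<close>, while the events must be listed before
  \<open>x\<close> is chosen. With a common fundamental domain, moving \<open>x\<close> by an
  element of \<Lambda> or by the corresponding element of \<Gamma> leads to the same point of
  \<open>X\<close>, so the events can be indexed by the element of \<Lambda> and the position
  relative to the centre.\<close>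

definition chain :: "('x \<Rightarrow> 'x \<Rightarrow> real) \<Rightarrow> 'x set \<Rightarrow> nat \<Rightarrow> 'x \<Rightarrow> 'x \<Rightarrow> bool" where
  "chain d W n x y \<longleftrightarrow>
     (\<exists>w. w 0 = x \<and> w n = y \<and> (\<forall>i\<le>n. w i \<in> W) \<and> (\<forall>i<n. d (w i) (w (Suc i)) \<le> 1))"

lemma chain_append:
  assumes "chain d W m x y" "chain d W n y z"
  shows "chain d W (m + n) x z"
proof -
  obtain v where v: "v 0 = x" "v m = y" "\<forall>i\<le>m. v i \<in> W" "\<forall>i<m. d (v i) (v (Suc i)) \<le> 1"
    using assms(1) by (auto simp: chain_def)
  obtain w where w: "w 0 = y" "w n = z" "\<forall>i\<le>n. w i \<in> W" "\<forall>i<n. d (w i) (w (Suc i)) \<le> 1"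
    using assms(2) by (auto simp: chain_def)
  define u where "u = (\<lambda>i. if i \<le> m then v i else w (i - m))"
  have "u 0 = x" "u (m + n) = z" using v w by (auto simp: u_def)
  moreover have "u i \<in> W" if "i \<le> m + n" for i using that v w by (auto simp: u_def)
  moreover have "d (u i) (u (Suc i)) \<le> 1" if "i < m + n" for i
  proof -
    consider "i < m" | "i = m" | "i > m" by linarith
    then show ?thesis
    proof cases
      case 2
      then have "u i = w 0" "u (Suc i) = w (Suc 0)" using v w by (auto simp: u_def)
      then show ?thesis using w that 2 by auto
    next
      case 3
      then have "u i = w (i - m)" "u (Suc i) = w (Suc (i - m))" by (auto simp: u_def Suc_diff_le)
      then show ?thesis using w that 3 by auto
    qed (use v in \<open>auto simp: u_def\<close>)
  qed
  ultimately show ?thesis unfolding chain_def by blast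
qed

lemma chain_subset: "chain d W n x y \<Longrightarrow> W \<subseteq> W' \<Longrightarrow> chain d W' n x y"
  unfolding chain_def by blast

lemma chain_const: "x \<in> W \<Longrightarrow> d x x \<le> 1 \<Longrightarrow> chain d W n x x"
  unfolding chain_def by (intro exI[of _ "\<lambda>_. x"]) auto

lemma chain_in: "chain d W n x y \<Longrightarrow> x \<in> W \<and> y \<in> W"
  unfolding chain_def by blast

context Metric_space
begin

lemma chain_mono:
  assumes "chain d W m x y" "W \<subseteq> M" "m \<le> n"
  shows "chain d W n x y"
proof -
  have "y \<in> W" using chain_in assms by metis
  then have "chain d W (n - m) y y" using assms by (intro chain_const) auto
  then show ?thesis using chain_append[OF assms(1)] assms(3) by fastforce
qed

lemma chain_rev:
  assumes "chain d W n x y" shows "chain d W n y x"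
proof -
  obtain w where w: "w 0 = x" "w n = y" "\<forall>i\<le>n. w i \<in> W" "\<forall>i<n. d (w i) (w (Suc i)) \<le> 1"
    using assms by (auto simp: chain_def)
  have "d (w (n - i)) (w (n - Suc i)) \<le> 1" if "i < n" for i
  proof -
    have "n - i = Suc (n - Suc i)" using that by simp
    then show ?thesis using w(4)[rule_format, of "n - Suc i"] that commute by simp
  qed
  then show ?thesis unfolding chain_def using w by (intro exI[of _ "\<lambda>i. w (n - i)"]) auto
qed

section \<open>Geodesic segments: parametrisations, subsegments and the chains along them\<close>

lemma seg_param:
  assumes "geodesic_segment M d x y A"
  obtains c where "c ` {0..d x y} = A" "A \<subseteq> M" "c 0 = x" "c (d x y) = y"
    "\<And>s t. s \<in> {0..d x y} \<Longrightarrow> t \<in> {0..d x y} \<Longrightarrow> d (c s) (c t) = \<bar>s - t\<bar>"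
  using assms unfolding geodesic_segment_def by blast

lemma seg_ends:
  assumes "geodesic_segment M d x y A"
  shows "x \<in> A" "y \<in> A" "A \<subseteq> M" "x \<in> M" "y \<in> M"
proof -
  obtain c where c: "c ` {0..d x y} = A" "A \<subseteq> M" "c 0 = x" "c (d x y) = y"
    using seg_param[OF assms] by metis
  show "x \<in> A" "y \<in> A" using c nonneg[of x y] by (metis atLeastAtMost_iff image_eqI order_refl)+
  then show "A \<subseteq> M" "x \<in> M" "y \<in> M" using c by auto
qed

lemma seg_dist:
  assumes "geodesic_segment M d x y A" "p \<in> A"
  shows "d x p + d p y = d x y"
proof -
  obtain c where c: "c ` {0..d x y} = A" "A \<subseteq> M" "c 0 = x" "c (d x y) = y"
    "\<And>s t. s \<in> {0..d x y} \<Longrightarrow> t \<in> {0..d x y} \<Longrightarrow> d (c s) (c t) = \<bar>s - t\<bar>"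
    using seg_param[OF assms(1)] by metis
  obtain s where s: "s \<in> {0..d x y}" "p = c s" using c assms(2) by blast
  then show ?thesis using c(5)[of 0 s] c(5)[of s "d x y"] c(3,4) by auto
qed

lemma subsegment:
  assumes c: "\<And>s t. s \<in> {0..D} \<Longrightarrow> t \<in> {0..D} \<Longrightarrow> d (c s) (c t) = \<bar>s - t\<bar>"
    and "c ` {0..D} \<subseteq> M" "0 \<le> s" "s \<le> t" "t \<le> D"
  shows "geodesic_segment M d (c s) (c t) (c ` {s..t})"
proof -
  have D: "d (c s) (c t) = t - s" using assms c[of s t] by auto
  have im: "(\<lambda>r. c (s + r)) ` {0..t - s} = c ` {s..t}"
  proof -
    have "(\<lambda>r. s + r) ` {0..t - s} = {s..t}"
      by (auto simp: image_iff intro!: bexI[of _ "_ - s"])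
    then show ?thesis by (metis image_image)
  qed
  show ?thesis unfolding geodesic_segment_def D
    by (rule exI[of _ "\<lambda>r. c (s + r)"]) (use assms c im in auto)
qed

lemma seg_sym:
  assumes "geodesic_segment M d x y A" shows "geodesic_segment M d y x A"
proof -
  obtain c where c: "c ` {0..d x y} = A" "A \<subseteq> M" "c 0 = x" "c (d x y) = y"
    "\<And>s t. s \<in> {0..d x y} \<Longrightarrow> t \<in> {0..d x y} \<Longrightarrow> d (c s) (c t) = \<bar>s - t\<bar>"
    using seg_param[OF assms] by metis
  have "(\<lambda>r. c (d x y - r)) ` {0..d x y} = A"
  proof -
    have "(\<lambda>r. d x y - r) ` {0..d x y} = {0..d x y}"
      by (auto simp: image_iff intro!: bexI[of _ "d x y - _"])
    then show ?thesis using c(1) by (metis image_image)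
  qed
  then show ?thesis unfolding geodesic_segment_def commute[of y x]
    by (intro exI[of _ "\<lambda>r. c (d x y - r)"]) (use c in auto)
qed

lemma subsegment_between:
  assumes "geodesic_segment M d x y A" "p \<in> A" "q \<in> A"
  obtains A' where "A' \<subseteq> A" "geodesic_segment M d p q A'"
proof -
  obtain c where c: "c ` {0..d x y} = A" "A \<subseteq> M" "c 0 = x" "c (d x y) = y"
    "\<And>s t. s \<in> {0..d x y} \<Longrightarrow> t \<in> {0..d x y} \<Longrightarrow> d (c s) (c t) = \<bar>s - t\<bar>"
    using seg_param[OF assms(1)] by metis
  obtain s t where st: "s \<in> {0..d x y}" "p = c s" "t \<in> {0..d x y}" "q = c t" using c assms by blast
  show ?thesis
  proof (cases "s \<le> t")
    case True
    then show ?thesis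
      by (intro that[of "c ` {s..t}"]) (use subsegment[of "d x y" c s t] c st in auto)
  next
    case False
    then show ?thesis
      by (intro that[of "c ` {t..s}"]) (use seg_sym[OF subsegment[of "d x y" c t s]] c st in auto)
  qed
qed

text \<open>The parameter interval between the two points is cut into \<open>n\<close> equal pieces,
  each of length at most 1. Any integer above the distance may serve as \<open>n\<close>, which lets
  later estimates count in multiples of the fatness.\<close>

lemma chain_seg:
  assumes "geodesic_segment M d x y A" "p \<in> A" "q \<in> A" "d p q \<le> real n"
  shows "chain d A n p q"
proof -
  obtain c where c: "c ` {0..d x y} = A" "A \<subseteq> M" "c 0 = x" "c (d x y) = y"
    "\<And>s t. s \<in> {0..d x y} \<Longrightarrow> t \<in> {0..d x y} \<Longrightarrow> d (c s) (c t) = \<bar>s - t\<bar>"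
    using seg_param[OF assms(1)] by metis
  obtain s t where st: "s \<in> {0..d x y}" "p = c s" "t \<in> {0..d x y}" "q = c t" using c assms by blast
  have d: "\<bar>s - t\<bar> \<le> n" using assms(4) c(5) st by metis
  show ?thesis
  proof (cases "n = 0")
    case True
    then have "s = t" using d by simp
    then show ?thesis using True st assms by (auto simp: chain_def)
  next
    case False
    define g where "g = (\<lambda>i. s + (t - s) * (real i / real n))"
    have g: "g i \<in> {0..d x y}" if "i \<le> n" for i
    proof -
      have "real i / real n \<in> {0..1}" using that False by auto
      then have "(1 - real i / real n) *\<^sub>R s + (real i / real n) *\<^sub>R t \<in> {0..d x y}"
        using st by (intro convexD_alt) auto
      then show ?thesis by (simp add: g_def algebra_simps diff_divide_distrib)
    qed
    have "\<bar>g i - g (Suc i)\<bar> \<le> 1" for i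
    proof -
      have "g i - g (Suc i) = (s - t) / n" using False by (simp add: g_def field_simps)
      then show ?thesis using d False by (simp add: abs_divide)
    qed
    then have "d (c (g i)) (c (g (Suc i))) \<le> 1" if "i < n" for i
      using c(5)[of "g i" "g (Suc i)"] g[of i] g[of "Suc i"] that by auto
    then show ?thesis unfolding chain_def using st g c False
      by (intro exI[of _ "\<lambda>i. c (g i)"]) (auto simp: g_def)
  qed
qed

section \<open>Fat triangles and short detours around their fat points\<close>

definition triangle_of :: "'a \<Rightarrow> 'a \<Rightarrow> 'a \<Rightarrow> 'a set \<Rightarrow> 'a set \<Rightarrow> 'a set \<Rightarrow> bool" where
  "triangle_of x y z A B C \<longleftrightarrow>
     geodesic_segment M d x y A \<and> geodesic_segment M d y z B \<and> geodesic_segment M d z x C"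

text \<open>A short segment joining two sides of a triangle can be replaced by a short detour through
  the corner opposite to the third side: thinness provides a second bridge near the corner.\<close>

lemma corner_shortcut:
  fixes u :: nat
  assumes geo: "geodesic_space M d"
    and tri: "triangle_of x y w A B C"
    and thin: "\<And>x' y' w' A' B' C' z. triangle_of x' y' w' A' B' C' \<Longrightarrow>
        d x' y' + d y' w' + d w' x' \<le> d x y + d y w + d w x \<Longrightarrow> z \<in> A' \<Longrightarrow>
        \<exists>q\<in>B' \<union> C'. d z q < u"
    and z: "z \<in> A" and fat: "\<And>q. q \<in> B \<union> C \<Longrightarrow> d z q \<ge> real u - 1"
    and p: "p \<in> C" "p' \<in> B" "d p p' \<le> 8 * real u" and u: "u \<ge> 1"
  shows "chain d {v\<in>M. d z v \<ge> real u / 2 - 1} (28 * u) p p'"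
proof -
  let ?W = "{v\<in>M. d z v \<ge> real u / 2 - 1}"
  have A: "geodesic_segment M d x y A" and B: "geodesic_segment M d y w B"
    and C: "geodesic_segment M d w x C" using tri by (auto simp: triangle_of_def)
  have M: "x \<in> M" "y \<in> M" "w \<in> M" "p \<in> M" "p' \<in> M" "z \<in> M" "A \<subseteq> M" "B \<subseteq> M" "C \<subseteq> M"
    "w \<in> B" "w \<in> C"
    using seg_ends[OF A] seg_ends[OF B] seg_ends[OF C] p z by auto
  have BW: "B \<subseteq> ?W" "C \<subseteq> ?W" using fat M u by fastforce+
  obtain A' where A': "A' \<subseteq> C" "geodesic_segment M d w p A'"
    using subsegment_between[OF C _ p(1)] M by blast
  obtain C' where C': "C' \<subseteq> B" "geodesic_segment M d p' w C'"
    using subsegment_between[OF B p(2)] M by blast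
  obtain B' where B': "geodesic_segment M d p p' B'"
    using geo M unfolding geodesic_space_def by blast
  have tri': "triangle_of w p p' A' B' C'" using A' B' C' by (auto simp: triangle_of_def)
  \<comment> \<open>Cutting off the corner at \<open>w\<close> does not increase the perimeter,
    which brings the small triangle within the reach of \<open>thin\<close>.\<close>
  have per: "d w p + d p p' + d p' w \<le> d x y + d y w + d w x"
  proof -
    have "d w p + d p x = d w x" using seg_dist[OF C p(1)] .
    moreover have "d y p' + d p' w = d y w" using seg_dist[OF B p(2)] .
    moreover have "d p p' \<le> d p x + d x p'" "d x p' \<le> d x y + d y p'" using triangle M by auto
    ultimately show ?thesis by linarith
  qed
  obtain c where c: "c ` {0..d w p} = A'" "c 0 = w" "c (d w p) = p"
    "\<And>s t. s \<in> {0..d w p} \<Longrightarrow> t \<in> {0..d w p} \<Longrightarrow> d (c s) (c t) = \<bar>s - t\<bar>"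
    using seg_param[OF A'(2)] by metis
  \<comment> \<open>From \<open>p\<close> walk back along \<open>C\<close> by
    \<open>9 * u = 8 * u + u\<close>: at this distance a bridge shorter than \<open>u\<close> cannot
    end on the segment from \<open>p\<close> to \<open>p'\<close>, so it ends on \<open>B\<close>.
    If \<open>w\<close> comes first, it lies on both sides and is a bridge of length 0.\<close>
  have "\<exists>m q. m \<in> C \<and> q \<in> B \<and> d m q \<le> u \<and> d p m \<le> 9 * real u"
  proof (cases "d w p \<le> 9 * real u")
    case True
    then show ?thesis using M commute by (intro exI[of _ w]) auto
  next
    case False
    define m where "m = c (d w p - 9 * u)"
    have m: "m \<in> A'" using False c(1) by (auto simp: m_def)
    have mp: "d m p = 9 * u" using c(4)[of "d w p - 9 * u" "d w p"] c(3) False by (auto simp: m_def)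
    obtain q where q: "q \<in> B' \<union> C'" "d m q < u" using thin[OF tri' per m] by blast
    have mM: "m \<in> M" using m A' M by auto
    have "q \<notin> B'"
    proof
      assume "q \<in> B'"
      then have "d p q + d q p' = d p p'" using seg_dist[OF B'] by blast
      moreover have "q \<in> M" using \<open>q \<in> B'\<close> seg_ends[OF B'] by auto
      then have "d m p \<le> d m q + d q p" using triangle mM M by auto
      ultimately show False using mp q p(3) nonneg[of q p'] commute[of p q] by linarith
    qed
    then have "q \<in> B" using q C' by auto
    then show ?thesis using m A' q mp commute by (intro exI[of _ m] exI[of _ q]) auto
  qed
  then obtain m q where m: "m \<in> C" "q \<in> B" "d m q \<le> u" "d p m \<le> 9 * real u" by blast
  have mM: "m \<in> M" "q \<in> M" using m M by auto
  have c1: "chain d ?W (9 * u) p m"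
    by (rule chain_subset[OF chain_seg[OF C p(1) m(1)] BW(2)]) (use m in auto)
  obtain E where E: "geodesic_segment M d m q E" using geo mM unfolding geodesic_space_def by blast
  \<comment> \<open>Each point of the bridge is within \<open>u / 2\<close> of one of its ends, and
    both ends, lying on \<open>B \<union> C\<close>, are at distance at least \<open>u - 1\<close>
    from \<open>z\<close>.\<close>
  have "E \<subseteq> ?W"
  proof
    fix v assume v: "v \<in> E"
    have vM: "v \<in> M" using v seg_ends[OF E] by auto
    have "d m v + d v q = d m q" using seg_dist[OF E v] .
    moreover have "d z m \<le> d z v + d v m" "d z q \<le> d z v + d v q" using triangle mM vM M by auto
    moreover have "d z m \<ge> real u - 1" "d z q \<ge> real u - 1" using fat m by auto
    ultimately have "d z v \<ge> real u / 2 - 1" using m(3) commute[of m v] by linarith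
    then show "v \<in> ?W" using vM by simp
  qed
  then have c2: "chain d ?W u m q"
    by (rule chain_subset[OF chain_seg[OF E seg_ends(1,2)[OF E] m(3)]])
  \<comment> \<open>The way back along \<open>B\<close> costs
    \<open>u + 9 * u + 8 * u = 18 * u\<close>; with \<open>9 * u\<close> along \<open>C\<close> and
    \<open>u\<close> for the bridge this makes \<open>28 * u\<close>.\<close>
  have "d q p' \<le> d q m + d m p'" "d m p' \<le> d m p + d p p'" using triangle mM M by auto
  then have "d q p' \<le> 18 * real u" using m p commute[of q m] commute[of m p] by linarith
  then have "d q p' \<le> real (18 * u)" by simp
  then have c3: "chain d ?W (18 * u) q p'"
    by (rule chain_subset[OF chain_seg[OF B m(2) p(2)] BW(1)])
  have "chain d ?W (9 * u + u + 18 * u) p p'"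
    by (rule chain_append[OF chain_append[OF c1 c2] c3])
  then show ?thesis by (simp add: algebra_simps)
qed

text \<open>To bypass \<open>z\<close>, leave \<open>A\<close> at distance \<open>3 * u\<close> on
  either side of it, drop to \<open>B \<union> C\<close> over a distance at most \<open>u\<close>,
  and join the two feet. These are at most \<open>u + 6 * u + u = 8 * u\<close> apart. Feet on the
  same side are joined along that side, feet on different sides by \<open>corner_shortcut\<close>.
  The total is \<open>u + 28 * u + u\<close>.\<close>

lemma fat_point_detour:
  fixes u :: nat
  assumes geo: "geodesic_space M d"
    and tri: "triangle_of x y w A B C"
    and thin: "\<And>x' y' w' A' B' C' z. triangle_of x' y' w' A' B' C' \<Longrightarrow>
        d x' y' + d y' w' + d w' x' \<le> d x y + d y w + d w x \<Longrightarrow> z \<in> A' \<Longrightarrow>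
        \<exists>q\<in>B' \<union> C'. d z q < u"
    and z: "z \<in> A" and fat: "\<And>q. q \<in> B \<union> C \<Longrightarrow> d z q \<ge> real u - 1"
    and u: "u \<ge> 1"
  shows "\<exists>p q A'. geodesic_segment M d p q A' \<and> z \<in> A' \<and>
           chain d {v\<in>M. d z v \<ge> real u / 2 - 1} (30 * u) p q"
proof -
  let ?W = "{v\<in>M. d z v \<ge> real u / 2 - 1}"
  have A: "geodesic_segment M d x y A" and B: "geodesic_segment M d y w B"
    and C: "geodesic_segment M d w x C" using tri by (auto simp: triangle_of_def)
  have M: "x \<in> M" "y \<in> M" "w \<in> M" "z \<in> M" "A \<subseteq> M" "B \<subseteq> M" "C \<subseteq> M" "x \<in> C" "y \<in> B"
    using seg_ends[OF A] seg_ends[OF B] seg_ends[OF C] z by auto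
  have BW: "B \<subseteq> ?W" "C \<subseteq> ?W" using fat M u by fastforce+
  obtain c where c: "c ` {0..d x y} = A" "A \<subseteq> M" "c 0 = x" "c (d x y) = y"
    "\<And>s t. s \<in> {0..d x y} \<Longrightarrow> t \<in> {0..d x y} \<Longrightarrow> d (c s) (c t) = \<bar>s - t\<bar>"
    using seg_param[OF A] by metis
  obtain t0 where t0: "t0 \<in> {0..d x y}" "z = c t0" using c z by blast
  \<comment> \<open>A segment shorter than \<open>u\<close> that starts \<open>3 * u\<close> away
    from \<open>z\<close> stays far from \<open>z\<close>. If \<open>A\<close> ends earlier, its
    endpoint is a corner, hence already on \<open>B \<union> C\<close>, and is its own foot.\<close>
  have foot: "\<exists>p. p \<in> B \<union> C \<and> d (c s) p \<le> u \<and> chain d ?W u (c s) p"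
    if s: "s \<in> {0..d x y}" "s = 0 \<or> s = d x y \<or> \<bar>s - t0\<bar> \<ge> 3 * u" for s
  proof (cases "\<bar>s - t0\<bar> \<ge> 3 * u")
    case True
    have csA: "c s \<in> A" using c s by blast
    obtain p where p: "p \<in> B \<union> C" "d (c s) p < u" using thin[OF tri _ csA] by auto
    have pM: "p \<in> M" "c s \<in> M" using p M csA by auto
    obtain E where E: "geodesic_segment M d (c s) p E" using geo pM unfolding geodesic_space_def by blast
    have "E \<subseteq> ?W"
    proof
      fix v assume v: "v \<in> E"
      have vM: "v \<in> M" using v seg_ends[OF E] by auto
      have "d (c s) v + d v p = d (c s) p" using seg_dist[OF E v] .
      moreover have "d z (c s) \<le> d z v + d v (c s)" using triangle vM M pM by auto
      moreover have "d z (c s) \<ge> 3 * u" using c(5)[OF t0(1) s(1)] True t0(2) by simp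
      ultimately have "d z v \<ge> real u / 2 - 1"
        using p(2) commute[of "c s" v] nonneg[of v p] by linarith
      then show "v \<in> ?W" using vM by simp
    qed
    then have "chain d ?W u (c s) p"
      by (rule chain_subset[OF chain_seg[OF E seg_ends(1,2)[OF E]], rotated]) (use p in auto)
    then show ?thesis using p by (intro exI[of _ p]) auto
  next
    case False
    then have "c s \<in> B \<union> C" using s c M by auto
    then show ?thesis using BW M chain_const[of "c s" ?W d u] by (intro exI[of _ "c s"]) auto
  qed
  define s1 where "s1 = max 0 (t0 - 3 * u)"
  define s2 where "s2 = min (d x y) (t0 + 3 * u)"
  have s: "s1 \<in> {0..d x y}" "s2 \<in> {0..d x y}" "s1 \<le> t0" "t0 \<le> s2" "\<bar>s1 - s2\<bar> \<le> 6 * u"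
    "s1 = 0 \<or> s1 = d x y \<or> \<bar>s1 - t0\<bar> \<ge> 3 * u" "s2 = 0 \<or> s2 = d x y \<or> \<bar>s2 - t0\<bar> \<ge> 3 * u"
    using t0(1) by (auto simp: s1_def s2_def)
  obtain p where p: "p \<in> B \<union> C" "d (c s1) p \<le> u" "chain d ?W u (c s1) p"
    using foot[OF s(1) s(6)] by blast
  obtain q where q: "q \<in> B \<union> C" "d (c s2) q \<le> u" "chain d ?W u (c s2) q"
    using foot[OF s(2) s(7)] by blast
  have cM: "c s1 \<in> M" "c s2 \<in> M" "p \<in> M" "q \<in> M" using s c M p q by blast+
  have pq: "d p q \<le> 8 * real u"
  proof -
    have "d p q \<le> d p (c s1) + d (c s1) q" "d (c s1) q \<le> d (c s1) (c s2) + d (c s2) q"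
      using triangle cM by auto
    then show ?thesis using c(5)[OF s(1,2)] s(5) p q commute[of p "c s1"] by linarith
  qed
  have "chain d ?W (28 * u) p q"
  proof -
    have short: "chain d ?W (28 * u) p q" if "p \<in> C" "q \<in> B" "d p q \<le> 8 * real u" for p q
      by (rule corner_shortcut[OF geo tri _ z _ that u], rule thin, assumption+, rule fat)
    have le: "d p q \<le> real (8 * u)" using pq by simp
    consider "p \<in> C" "q \<in> B" | "p \<in> B" "q \<in> C" | "p \<in> B" "q \<in> B" | "p \<in> C" "q \<in> C"
      using p q by blast
    then show ?thesis
    proof cases
      case 1
      then show ?thesis by (intro short pq)
    next
      case 2
      then have "chain d ?W (28 * u) q p" using pq commute[of p q] by (intro short) auto
      then show ?thesis by (rule chain_rev)
    next
      case 3
      then have "chain d ?W (8 * u) p q"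
        by (rule chain_subset[OF chain_seg[OF B _ _ le] BW(1)])
      then show ?thesis by (rule chain_mono) auto
    next
      case 4
      then have "chain d ?W (8 * u) p q"
        by (rule chain_subset[OF chain_seg[OF C _ _ le] BW(2)])
      then show ?thesis by (rule chain_mono) auto
    qed
  qed
  then have "chain d ?W (u + 28 * u + u) (c s1) (c s2)"
    by (rule chain_append[OF chain_append[OF p(3)] chain_rev[OF q(3)]])
  then have "chain d ?W (30 * u) (c s1) (c s2)" by (simp add: algebra_simps)
  moreover have "geodesic_segment M d (c s1) (c s2) (c ` {s1..s2})"
    using s c by (intro subsegment[of "d x y"]) auto
  moreover have "z \<in> c ` {s1..s2}" using t0 s by auto
  ultimately show ?thesis by blast
qed

text \<open>Self-improvement: at the first scale where a triangle is fat, \<open>fat_point_detour\<close>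
  produces a path of length proportional to the fatness avoiding a ball of radius proportional
  to the fatness.\<close>

theorem sublinear_detours_imp_hyperbolic:
  fixes D :: "nat \<Rightarrow> real"
  assumes geo: "geodesic_space M d"
    and detour: "\<And>x y A z W n. geodesic_segment M d x y A \<Longrightarrow> z \<in> A \<Longrightarrow> W \<subseteq> M \<Longrightarrow>
        chain d W n x y \<Longrightarrow> \<exists>w\<in>W. d z w \<le> D n"
    and D: "\<forall>\<^sub>F n in sequentially. D n < real n / 120"
  shows "hyperbolic_space M d"
proof -
  obtain n0 where n0: "\<And>n. n \<ge> n0 \<Longrightarrow> D n < real n / 120"
    using D by (auto simp: eventually_sequentially)
  \<comment> \<open>The detour has \<open>30 * u\<close> steps and avoids the ball of radius
    \<open>u / 2 - 1\<close>. The factor 120 gives \<open>D (30 * u) < u / 4\<close>, and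
    \<open>u / 4 \<le> u / 2 - 1\<close> once \<open>u \<ge> 4\<close>.\<close>
  define U where "U = n0 + 4"
  have thinU: "\<exists>q\<in>B \<union> C. d z q \<le> U" if tri: "triangle_of x y w A B C" and z: "z \<in> A" for x y w A B C z
  proof (rule ccontr)
    assume neg: "\<not> (\<exists>q\<in>B \<union> C. d z q \<le> U)"
    define P where "P = d x y + d y w + d w x"
    \<comment> \<open>Fatness is compared only among triangles of perimeter at most
      \<open>P\<close>. A point of \<open>A\<close> is no farther from a corner than the length of
      \<open>A\<close>, so \<open>K\<close> is bounded and has a greatest element.\<close>
    define K where "K = (\<lambda>k::nat. \<exists>x y w A B C z. triangle_of x y w A B C \<and> d x y + d y w + d w x \<le> P \<and>
      z \<in> A \<and> (\<forall>q\<in>B \<union> C. d z q \<ge> k))"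
    have KU: "K U" unfolding K_def P_def using tri z neg by (meson linear order_refl)
    have bd: "k \<le> nat \<lceil>P\<rceil>" if Kk: "K k" for k
    proof -
      obtain x y w A B C z where t: "triangle_of x y w A B C" "d x y + d y w + d w x \<le> P"
        "z \<in> A" "\<forall>q\<in>B \<union> C. d z q \<ge> k" using Kk unfolding K_def by blast
      have "x \<in> C" using t(1) seg_ends unfolding triangle_of_def by blast
      then have "k \<le> d z x" using t by auto
      moreover have "d x z + d z y = d x y" using t(1,3) seg_dist unfolding triangle_of_def by blast
      ultimately have "k \<le> P" using t(2) nonneg[of z y] nonneg[of y w] nonneg[of w x] commute[of x z] by linarith
      then show ?thesis by linarith
    qed
    define k where "k = Greatest K"
    have k: "K k" unfolding k_def using GreatestI_nat[of K U "nat \<lceil>P\<rceil>"] KU bd by blast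
    have kmax: "\<not> K (Suc k)" unfolding k_def
      using Greatest_le_nat[of K "Suc k" "nat \<lceil>P\<rceil>"] bd unfolding k_def by fastforce
    have kU: "U \<le> k" unfolding k_def using Greatest_le_nat[of K U "nat \<lceil>P\<rceil>"] KU bd by blast
    obtain x y w A B C z where t: "triangle_of x y w A B C" "d x y + d y w + d w x \<le> P"
        "z \<in> A" "\<forall>q\<in>B \<union> C. d z q \<ge> k" using k unfolding K_def by blast
    \<comment> \<open>By maximality of \<open>k\<close> all triangles of this class are thin with
      constant \<open>?u\<close>, while \<open>z\<close> is fat by \<open>k = ?u - 1\<close>: the
      two constants differ only by 1.\<close>
    let ?u = "Suc k"
    have thin: "\<exists>q\<in>B' \<union> C'. d z q < ?u" if "triangle_of x' y' w' A' B' C'"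
        "d x' y' + d y' w' + d w' x' \<le> d x y + d y w + d w x" "z \<in> A'" for x' y' w' A' B' C' z
      using kmax that t(2) unfolding K_def by (smt (verit))
    have "\<exists>p q A'. geodesic_segment M d p q A' \<and> z \<in> A' \<and>
           chain d {v\<in>M. d z v \<ge> real ?u / 2 - 1} (30 * ?u) p q"
      by (rule fat_point_detour[OF geo t(1) _ t(3)], rule thin, assumption+) (use t(4) in auto)
    then obtain p q A' where *: "geodesic_segment M d p q A'" "z \<in> A'"
           "chain d {v\<in>M. d z v \<ge> real ?u / 2 - 1} (30 * ?u) p q" by blast
    obtain v where "d z v \<ge> real ?u / 2 - 1" "d z v \<le> D (30 * ?u)"
      using detour[OF * (1,2) _ * (3)] by auto
    moreover have "D (30 * ?u) < real (30 * ?u) / 120" using kU U_def by (intro n0) auto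
    ultimately show False using kU U_def by simp
  qed
  have "delta_hyperbolic U M d"
    unfolding delta_hyperbolic_def
  proof (intro ballI allI impI)
    fix x y z A B C
    assume "geodesic_segment M d x y A \<and> geodesic_segment M d y z B \<and> geodesic_segment M d z x C"
    then have *: "geodesic_segment M d x y A" "geodesic_segment M d y z B" "geodesic_segment M d z x C"
      by auto
    then have t: "triangle_of x y z A B C" "triangle_of y z x B C A" "triangle_of z x y C A B"
      by (auto simp: triangle_of_def)
    note M = * [THEN seg_ends(3)]
    show "A \<subseteq> neighbourhood M d U (B \<union> C) \<and> B \<subseteq> neighbourhood M d U (C \<union> A) \<and>
          C \<subseteq> neighbourhood M d U (A \<union> B)"
      using thinU[OF t(1)] thinU[OF t(2)] thinU[OF t(3)] M unfolding neighbourhood_def by blast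
  qed
  then show ?thesis unfolding hyperbolic_space_def using geo by (intro conjI exI[of _ "real U"]) auto
qed

text \<open>Bisection: in the triangle formed by the two ends and a middle point of the path, moving
  by \<delta> leads to a geodesic spanned by half of the path. After \<open>k\<close> halvings a
  single jump of length at most \<open>r\<close> is left. The error is thus logarithmic in the
  number of jumps, and the jump size enters only once.\<close>

lemma hyperbolic_geodesic_near_path:
  assumes geo: "geodesic_space M d" and hyp: "delta_hyperbolic \<delta> M d" and "\<delta> \<ge> 0"
    and "n \<le> 2 ^ k" and "\<And>i. i \<le> n \<Longrightarrow> w i \<in> M" and "\<And>i. i < n \<Longrightarrow> d (w i) (w (Suc i)) \<le> r"
    and "r \<ge> 0" and "geodesic_segment M d (w 0) (w n) A" and "z \<in> A"
  shows "\<exists>i\<le>n. d z (w i) \<le> \<delta> * real k + r"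
  using assms(4-)
proof (induction k arbitrary: n w A z)
  case 0
  then have "n = 0 \<or> n = 1" by auto
  then have "d (w 0) (w n) \<le> r" using 0 by auto
  moreover have "d (w 0) z + d z (w n) = d (w 0) (w n)" using seg_dist 0 by blast
  ultimately have "d z (w 0) \<le> r" using commute[of z "w 0"] nonneg[of z "w n"] by linarith
  then show ?case by auto
next
  case (Suc k)
  define m where "m = n div 2"
  have m: "m \<le> n" "m \<le> 2 ^ k" "n - m \<le> 2 ^ k" using Suc.prems(1) by (auto simp: m_def)
  obtain C where C: "geodesic_segment M d (w 0) (w m) C"
    using geo Suc.prems(2) m unfolding geodesic_space_def by blast
  obtain B where B: "geodesic_segment M d (w m) (w n) B"
    using geo Suc.prems(2) m unfolding geodesic_space_def by blast
  have "A \<subseteq> neighbourhood M d \<delta> (B \<union> C)"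
    using hyp[unfolded delta_hyperbolic_def, rule_format, of "w 0" "w n" "w m" A B C]
      Suc.prems(2,5) m seg_sym[OF B] seg_sym[OF C] by auto
  then obtain q where q: "q \<in> B \<union> C" "d z q \<le> \<delta>" "z \<in> M" using Suc.prems(6)
    unfolding neighbourhood_def by blast
  have "\<exists>i\<le>n. d q (w i) \<le> \<delta> * real k + r"
  proof (cases "q \<in> C")
    case True
    have "\<exists>i\<le>m. d q (w i) \<le> \<delta> * real k + r"
      using Suc.prems m C True by (intro Suc.IH[of m w]) auto
    then show ?thesis using m by (meson order_trans)
  next
    case False
    have "\<exists>i\<le>n - m. d q (w (i + m)) \<le> \<delta> * real k + r"
      using Suc.prems m B False q by (intro Suc.IH[of "n - m" "\<lambda>i. w (i + m)" B]) auto
    then show ?thesis using m by (metis Nat.le_diff_conv2)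
  qed
  then obtain i where i: "i \<le> n" "d q (w i) \<le> \<delta> * real k + r" by blast
  have "q \<in> M" using q seg_ends[OF B] seg_ends[OF C] by auto
  then have "d z (w i) \<le> d z q + d q (w i)" using q i Suc.prems(2) by (intro triangle) auto
  then show ?case using i q by (intro exI[of _ i]) (auto simp: algebra_simps)
qed

end

section \<open>Path metrics on graph realizations\<close>

abbreviation vertex_point :: "'v \<Rightarrow> 'v \<Rightarrow> real" where
  "vertex_point v \<equiv> edge_point v v 0"

lemma vertex_point_apply: "vertex_point v w = of_bool (w = v)"
  by (simp add: edge_point_def)

lemma vertex_point_inj [simp]: "vertex_point u = vertex_point v \<longleftrightarrow> u = v"
  by (metis of_bool_eq_iff vertex_point_apply)

lemma edge_point_apply:
  "u \<noteq> v \<Longrightarrow> edge_point u v t u = 1 - t"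
  "u \<noteq> v \<Longrightarrow> edge_point u v t v = t"
  "w \<noteq> u \<Longrightarrow> w \<noteq> v \<Longrightarrow> edge_point u v t w = 0"
  by (auto simp: edge_point_def)

text \<open>As a rewrite rule this loops.\<close>

lemma edge_point_0: "edge_point u v 0 = vertex_point u"
  and edge_point_1: "edge_point u v 1 = vertex_point v"
  by (auto simp: edge_point_def)

lemma edge_point_swap: "edge_point u v t = edge_point v u (1 - t)"
  by (auto simp: edge_point_def)

lemma edge_point_abs_diff:
  "u \<noteq> v \<Longrightarrow> w = u \<or> w = v \<Longrightarrow> \<bar>edge_point u v s w - edge_point u v t w\<bar> = \<bar>s - t\<bar>"
  by (auto simp: edge_point_apply)

text \<open>The support of the coordinate function recovers the edge: if \<open>t\<close> is neither
  0 nor 1, both \<open>u\<close> and \<open>v\<close> lie in the support, which fixes the edge up to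
  orientation. Otherwise the point is a vertex, and it must be an end of the second edge
  too.\<close>

lemma edge_point_eq_cases:
  assumes "edge_point u v t = edge_point u' v' t'" "u \<noteq> v" "u' \<noteq> v'"
  obtains "u' = u" "v' = v" "t' = t" | "u' = v" "v' = u" "t' = 1 - t"
  | w where "w = u \<or> w = v" "w = u' \<or> w = v'" "edge_point u v t = vertex_point w"
proof -
  have eq: "edge_point u v t w = edge_point u' v' t' w" for w using assms(1) by simp
  consider "t = 0" | "t = 1" | "t \<noteq> 0" "t \<noteq> 1" by blast
  then show thesis
  proof cases
    case 1
    then have "u = u' \<or> u = v'"
      using eq[of u] edge_point_apply[OF assms(2)] edge_point_apply(3)[of u u' v' t'] by force
    then show thesis using that(3)[of u] 1 edge_point_0 by metis
  next
    case 2
    then have "v = u' \<or> v = v'"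
      using eq[of v] edge_point_apply[OF assms(2)] edge_point_apply(3)[of v u' v' t'] by force
    then show thesis using that(3)[of v] 2 edge_point_1 by metis
  next
    case 3
    then have "u = u' \<or> u = v'"
      using eq[of u] edge_point_apply[OF assms(2)] edge_point_apply(3)[of u u' v' t'] by force
    moreover have "v = u' \<or> v = v'"
      using 3 eq[of v] edge_point_apply[OF assms(2)] edge_point_apply(3)[of v u' v' t'] by force
    ultimately consider "u' = u" "v' = v" | "u' = v" "v' = u" using assms by blast
    then show thesis
    proof cases
      case 1
      then show thesis using that(1) eq[of v] assms(2) by (simp add: edge_point_apply)
    next
      case 2
      then show thesis using that(2) eq[of u] assms(2) edge_point_apply[of v u] edge_point_apply[of u v]
        by simp
    qed
  qed
qed

lemma edge_path_nonneg: "edge_path E x y l \<Longrightarrow> l \<ge> 0"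
  by (induction rule: edge_path.induct) auto

lemma edge_path_trans:
  "edge_path E x y l \<Longrightarrow> edge_path E y z l' \<Longrightarrow> edge_path E x z (l + l')"
proof (induction rule: edge_path.induct)
  case (step u v s t y l)
  then show ?case using edge_path.step[of u v E s t z "l + l'"] by (simp add: add.assoc)
qed simp

lemma edge_path_edge:
  "{u, v} \<in> E \<Longrightarrow> s \<in> {0..1} \<Longrightarrow> t \<in> {0..1} \<Longrightarrow>
    edge_path E (edge_point u v s) (edge_point u v t) \<bar>s - t\<bar>"
  using edge_path.step[of u v E s t _ 0] edge_path.nil by fastforce

lemma edge_path_sym: "edge_path E x y l \<Longrightarrow> edge_path E y x l"
proof (induction rule: edge_path.induct)
  case (step u v s t y l)
  then show ?case
    using edge_path_trans[OF step.IH edge_path_edge[of u v E t s]]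
    by (simp add: add.commute abs_minus_commute)
qed (rule edge_path.nil)

lemma path_metric_nonneg: "path_metric E x y \<ge> 0"
  unfolding path_metric_def by (auto intro!: cInf_greatest dest: edge_path_nonneg)

lemma path_metric_sym: "path_metric E x y = path_metric E y x"
proof -
  have "edge_path E x y = edge_path E y x" using edge_path_sym by blast
  then show ?thesis by (simp add: path_metric_def)
qed

text \<open>The axioms pin down the combinatorial distance: \<open>dv_step\<close> produces edge
  paths of length \<open>dv\<close>, and \<open>dv_edge\<close> with \<open>dv_triangle\<close>
  rules out shorter ones. In this form they can be checked directly for word length.\<close>

locale graph_distance =
  fixes V :: "'v set" and E :: "'v set set" and dv :: "'v \<Rightarrow> 'v \<Rightarrow> nat"
  assumes edge_in: "{u, v} \<in> E \<Longrightarrow> u \<in> V"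
    and edge_neq: "{u, v} \<in> E \<Longrightarrow> u \<noteq> v"
    and dv_edge: "{u, v} \<in> E \<Longrightarrow> dv u v \<le> 1"
    and dv_eq_0: "u \<in> V \<Longrightarrow> v \<in> V \<Longrightarrow> dv u v = 0 \<longleftrightarrow> u = v"
    and dv_triangle: "u \<in> V \<Longrightarrow> v \<in> V \<Longrightarrow> w \<in> V \<Longrightarrow> dv u w \<le> dv u v + dv v w"
    and dv_step: "u \<in> V \<Longrightarrow> v \<in> V \<Longrightarrow> dv u v = Suc n \<Longrightarrow> \<exists>w. {u, w} \<in> E \<and> dv w v = n"
begin

abbreviation "X \<equiv> graph_realization V E"
abbreviation "D \<equiv> path_metric E"

lemma edge_in': "{u, v} \<in> E \<Longrightarrow> v \<in> V"
  using edge_in[of v u] by (simp add: insert_commute)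

lemma vertex_in_X: "v \<in> V \<Longrightarrow> vertex_point v \<in> X"
  by (auto simp: graph_realization_def)

lemma edge_path_vertices:
  "u \<in> V \<Longrightarrow> v \<in> V \<Longrightarrow> edge_path E (vertex_point u) (vertex_point v) (dv u v)"
proof (induction "dv u v" arbitrary: u)
  case 0
  then show ?case using dv_eq_0 edge_path.nil by (metis of_nat_0)
next
  case (Suc n)
  then obtain w where w: "{u, w} \<in> E" "dv w v = n" using dv_step by metis
  then have "edge_path E (vertex_point w) (vertex_point v) n"
    using Suc.hyps(1)[of w] Suc.prems edge_in'[OF w(1)] by simp
  moreover have "edge_path E (vertex_point u) (vertex_point w) 1"
    using edge_path_edge[OF w(1), of 0 1] unfolding edge_point_1 edge_point_0[of u w] by simp
  ultimately have "edge_path E (vertex_point u) (vertex_point v) (1 + real n)"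
    using edge_path_trans by blast
  then show ?case by (simp flip: Suc.hyps(2))
qed

text \<open>For a point on an edge at \<open>u\<close>, the coordinate \<open>x u\<close> encodes
  the distance \<open>1 - x u\<close> to \<open>u\<close> along that edge. Path lengths can
  therefore be written in terms of coordinates, without reference to the orientation of the
  edge.\<close>

definition on_star :: "('v \<Rightarrow> real) \<Rightarrow> 'v \<Rightarrow> bool" where
  "on_star x u \<longleftrightarrow> u \<in> V \<and>
     (x = vertex_point u \<or> (\<exists>v t. {u, v} \<in> E \<and> t \<in> {0..1} \<and> x = edge_point u v t))"

lemma on_star_edge:
  assumes "{u, v} \<in> E" "t \<in> {0..1}" "w = u \<or> w = v"
  shows "on_star (edge_point u v t) w"
proof (cases "w = u")
  case True
  then show ?thesis using assms edge_in by (auto simp: on_star_def)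
next
  case False
  then have "w = v" using assms by simp
  moreover have "{v, u} \<in> E" using assms by (simp add: insert_commute)
  moreover have "1 - t \<in> {0..1}" using assms by auto
  ultimately show ?thesis using edge_in edge_point_swap[of u v t] unfolding on_star_def by blast
qed

lemma on_star_bounds:
  assumes "on_star x u" shows "u \<in> V" "0 \<le> x u" "x u \<le> 1"
  using assms edge_neq by (auto simp: on_star_def vertex_point_apply edge_point_apply)

lemma on_star_exists:
  assumes "x \<in> X" shows "\<exists>u. on_star x u"
proof -
  consider v where "v \<in> V" "x = vertex_point v"
    | u v t where "{u, v} \<in> E" "t \<in> {0..1}" "x = edge_point u v t"
    using assms unfolding graph_realization_def by auto
  then show ?thesis
  proof cases
    case 1
    then show ?thesis unfolding on_star_def by blast
  next
    case 2
    then show ?thesis using on_star_edge by blast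
  qed
qed

lemma on_star_eq_1: "on_star x u \<Longrightarrow> x u = 1 \<Longrightarrow> x = vertex_point u"
  using edge_neq edge_point_0[of u] by (auto simp: on_star_def edge_point_apply)

lemma edge_path_on_star:
  assumes "on_star x u" shows "edge_path E x (vertex_point u) (1 - x u)"
proof (cases "x = vertex_point u")
  case True
  then show ?thesis using edge_path.nil by (simp add: vertex_point_apply)
next
  case False
  then obtain v t where v: "{u, v} \<in> E" "t \<in> {0..1}" "x = edge_point u v t"
    using assms by (auto simp: on_star_def)
  then show ?thesis
    using edge_path_edge[OF v(1,2), of 0] edge_neq[OF v(1)] unfolding edge_point_0[of u v]
    by (simp add: edge_point_apply)
qed

text \<open>The three shapes to which any path can be shortened: constant, inside one edge, or
  through a vertex near each end and along a shortest vertex path between them. The number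
  \<open>l\<close> is only an upper bound for the length, which makes the predicate stable under
  prepending a step.\<close>

definition normal_path :: "('v \<Rightarrow> real) \<Rightarrow> ('v \<Rightarrow> real) \<Rightarrow> real \<Rightarrow> bool" where
  "normal_path x y l \<longleftrightarrow> x = y \<and> 0 \<le> l \<or>
     (\<exists>u v s t. {u, v} \<in> E \<and> s \<in> {0..1} \<and> t \<in> {0..1} \<and> x = edge_point u v s \<and>
        y = edge_point u v t \<and> \<bar>s - t\<bar> \<le> l) \<or>
     (\<exists>u w. on_star x u \<and> on_star y w \<and> (1 - x u) + dv u w + (1 - y w) \<le> l)"

lemma normal_path_cases:
  assumes "normal_path x y l"
  obtains "x = y" "0 \<le> l"
    | u v s t where "{u, v} \<in> E" "s \<in> {0..1}" "t \<in> {0..1}" "x = edge_point u v s"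
        "y = edge_point u v t" "\<bar>s - t\<bar> \<le> l"
    | u w where "on_star x u" "on_star y w" "(1 - x u) + dv u w + (1 - y w) \<le> l"
  using assms unfolding normal_path_def by blast

lemma normal_path_edgeI:
  "{u, v} \<in> E \<Longrightarrow> s \<in> {0..1} \<Longrightarrow> t \<in> {0..1} \<Longrightarrow> x = edge_point u v s \<Longrightarrow>
     y = edge_point u v t \<Longrightarrow> \<bar>s - t\<bar> \<le> l \<Longrightarrow> normal_path x y l"
  unfolding normal_path_def by blast

lemma normal_path_starI:
  "on_star x u \<Longrightarrow> on_star y w \<Longrightarrow> (1 - x u) + dv u w + (1 - y w) \<le> l \<Longrightarrow> normal_path x y l"
  unfolding normal_path_def by blast

lemma normal_path_step:
  assumes uv: "{u, v} \<in> E" "s \<in> {0..1}" "t \<in> {0..1}"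
    and n: "normal_path (edge_point u v t) y l"
  shows "normal_path (edge_point u v s) y (\<bar>s - t\<bar> + l)"
proof -
  have neq: "u \<noteq> v" using edge_neq uv by auto
  let ?x = "edge_point u v s" and ?x' = "edge_point u v t"
  have move: "1 - ?x w \<le> 1 - ?x' w + \<bar>s - t\<bar>" if "w = u \<or> w = v" for w
    using edge_point_abs_diff[OF neq that, of s t] by linarith
  consider "?x' = y" "0 \<le> l"
    | u' v' s' t' where "{u', v'} \<in> E" "s' \<in> {0..1}" "t' \<in> {0..1}" "?x' = edge_point u' v' s'"
        "y = edge_point u' v' t'" "\<bar>s' - t'\<bar> \<le> l"
    | u' w where "on_star ?x' u'" "on_star y w" "(1 - ?x' u') + dv u' w + (1 - y w) \<le> l"
    using n unfolding normal_path_def by blast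
  then show ?thesis
  proof cases
    case 1
    then show ?thesis using normal_path_edgeI[OF uv] by auto
  next
    case 2
    have neq': "u' \<noteq> v'" using edge_neq 2 by auto
    show ?thesis using 2(4) neq neq'
    proof (cases rule: edge_point_eq_cases)
      case 1
      then show ?thesis using 2 uv by (intro normal_path_edgeI[of u v s t']) auto
    next
      case 22: 2
      have "y = edge_point u v (1 - t')" using 2(5) 22 edge_point_swap by metis
      then show ?thesis using 2 22 uv by (intro normal_path_edgeI[of u v s "1 - t'"]) auto
    next
      case (3 w)
      \<comment> \<open>The two pieces meet in a vertex \<open>w\<close> of both edges, so the path
        is of star type through \<open>w\<close> alone, with \<open>dv w w = 0\<close>.\<close>
      have on: "on_star ?x w" "on_star y w" using on_star_edge uv 2 3 by auto
      have "1 - ?x w \<le> \<bar>s - t\<bar>" using move[OF 3(1)] 3(3) by (simp add: vertex_point_apply)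
      moreover have "1 - y w \<le> \<bar>s' - t'\<bar>"
        using edge_point_abs_diff[OF neq' 3(2), of s' t'] 3(3) 2(4,5) by (simp add: vertex_point_apply)
      ultimately show ?thesis using on 2(6) dv_eq_0[of w w] on_star_bounds(1)[OF on(1)]
        by (intro normal_path_starI[of _ w _ w]) auto
    qed
  next
    case 3
    show ?thesis
    proof (cases "u' = u \<or> u' = v")
      case True
      then show ?thesis using 3 on_star_edge[OF uv(1,2) True] move[OF True]
        by (intro normal_path_starI[of _ u' _ w]) auto
    next
      case False
      \<comment> \<open>A point of the edge from \<open>u\<close> to \<open>v\<close> that lies on
        the star of another vertex \<open>u'\<close> must be the far end \<open>v'\<close> of an
        edge at \<open>u'\<close>, hence one of \<open>u\<close> and \<open>v\<close>. Replacing
        \<open>u'\<close> by \<open>v'\<close> increases \<open>dv\<close> by at most 1, and this is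
        paid for by the term \<open>1 - ?x' u' = 1\<close>.\<close>
      then have z: "?x' u' = 0" by (simp add: edge_point_apply)
      then have "?x' \<noteq> vertex_point u'" by (metis of_bool_eq(2) vertex_point_apply zero_neq_one)
      then obtain v' t' where v': "{u', v'} \<in> E" "?x' = edge_point u' v' t'" 
        using 3(1) unfolding on_star_def by blast
      then have "t' = 1" using z edge_neq by (auto simp: edge_point_apply)
      then have one: "?x' v' = 1" using v' edge_neq by (auto simp: edge_point_apply)
      then have vv: "v' = u \<or> v' = v" using edge_point_apply(3)[of v' u v t] by fastforce
      have V: "u' \<in> V" "v' \<in> V" "w \<in> V" using v' edge_in edge_in' on_star_bounds(1) 3 by auto
      have "dv v' w \<le> dv v' u' + dv u' w" "dv v' u' \<le> 1"
        using dv_triangle V dv_edge v'(1) by (auto simp: insert_commute)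
      then have "real (dv v' w) \<le> 1 + real (dv u' w)" by linarith
      then show ?thesis using 3 z one on_star_edge[OF uv(1,2) vv] move[OF vv]
        by (intro normal_path_starI[of _ v' _ w]) auto
    qed
  qed
qed

lemma edge_path_normal: "edge_path E x y l \<Longrightarrow> normal_path x y l"
  by (induction rule: edge_path.induct) (auto simp: normal_path_def[of x x 0 for x] intro: normal_path_step)

lemma finite_range_X:
  assumes "x \<in> X" shows "finite (range x)"
proof -
  have "finite (range (edge_point u v t))" for u v :: 'v and t
    by (rule finite_subset[of _ "{0, 1 - t, t, 1}"]) (auto simp: edge_point_def of_bool_def split: if_splits)
  then show ?thesis using assms by (auto simp: graph_realization_def)
qed

text \<open>By \<open>edge_path_normal\<close> only finitely many path lengths below a given bound matter,
  so the infimum in \<open>path_metric\<close> is attained.\<close>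

lemma path_metric_attained:
  assumes x: "x \<in> X" and y: "y \<in> X"
  shows "edge_path E x y (D x y)" and "edge_path E x y l \<Longrightarrow> D x y \<le> l"
proof -
  \<comment> \<open>Candidate lengths are indexed by values of the coordinates instead of vertices
    or edges. A point has only finitely many coordinate values, and as \<open>a\<close> and
    \<open>b\<close> are at most 1, a bound on the length bounds \<open>n\<close>; so finitely many
    candidates remain even in an infinite graph.\<close>
  define C where "C = {0} \<union> (\<lambda>(a, b). \<bar>a - b\<bar>) ` (range x \<times> range y) \<union>
    (\<lambda>(a, n, b). (1 - a) + real n + (1 - b)) ` ({a\<in>range x. a \<le> 1} \<times> UNIV \<times> {b\<in>range y. b \<le> 1})"
  have star: "edge_path E x y ((1 - x u) + dv u w + (1 - y w))" if "on_star x u" "on_star y w" for u w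
    using that edge_path_on_star edge_path_sym edge_path_trans edge_path_vertices on_star_bounds(1) by meson
  have red: "\<exists>l'\<in>C. edge_path E x y l' \<and> l' \<le> l" if l: "edge_path E x y l" for l
  proof -
    consider "x = y" "0 \<le> l"
      | u v s t where "{u, v} \<in> E" "s \<in> {0..1}" "t \<in> {0..1}" "x = edge_point u v s"
          "y = edge_point u v t" "\<bar>s - t\<bar> \<le> l"
      | u w where "on_star x u" "on_star y w" "(1 - x u) + dv u w + (1 - y w) \<le> l"
      using edge_path_normal[OF l] unfolding normal_path_def by blast
    then show ?thesis
    proof cases
      case 1
      then show ?thesis using edge_path.nil[of E x] by (auto simp: C_def)
    next
      case 2
      have "\<bar>s - t\<bar> = \<bar>x u - y u\<bar>" using edge_point_abs_diff[of u v u s t] edge_neq 2 by auto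
      then have "\<bar>s - t\<bar> \<in> C" by (auto simp: C_def)
      then show ?thesis using edge_path_edge[OF 2(1,2,3)] 2 by blast
    next
      case 3
      have "(1 - x u) + dv u w + (1 - y w) \<in> C"
        using on_star_bounds 3 unfolding C_def by (intro UnI2 image_eqI[of _ _ "(x u, dv u w, y w)"]) auto
      then show ?thesis using star 3 by blast
    qed
  qed
  obtain u w where "on_star x u" "on_star y w" using on_star_exists x y by meson
  then obtain l0 where l0: "edge_path E x y l0" using star by blast
  define T where "T = {l'\<in>C. edge_path E x y l' \<and> l' \<le> l0}"
  have "T \<subseteq> {0} \<union> (\<lambda>(a, b). \<bar>a - b\<bar>) ` (range x \<times> range y) \<union>
    (\<lambda>(a, n, b). (1 - a) + real n + (1 - b)) ` (range x \<times> {..nat \<lfloor>l0\<rfloor>} \<times> range y)"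
  proof
    fix l assume "l \<in> T"
    then have l: "l \<in> C" "l \<le> l0" by (auto simp: T_def)
    have "l \<in> (\<lambda>(a, n, b). (1 - a) + real n + (1 - b)) ` (range x \<times> {..nat \<lfloor>l0\<rfloor>} \<times> range y)"
      if abn: "l = (1 - a) + real n + (1 - b)" "a \<in> range x" "b \<in> range y" "a \<le> 1" "b \<le> 1" for a b n
    proof -
      have "real n \<le> l0" using l abn by linarith
      then have "n \<in> {..nat \<lfloor>l0\<rfloor>}" by (simp add: le_nat_floor)
      then show ?thesis using abn by (intro image_eqI[of _ _ "(a, n, b)"]) auto
    qed
    then show "l \<in> {0} \<union> (\<lambda>(a, b). \<bar>a - b\<bar>) ` (range x \<times> range y) \<union>
      (\<lambda>(a, n, b). (1 - a) + real n + (1 - b)) ` (range x \<times> {..nat \<lfloor>l0\<rfloor>} \<times> range y)"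
      using l(1) unfolding C_def by fastforce
  qed
  then have fin: "finite T" by (rule finite_subset) (use finite_range_X x y in auto)
  have ne: "T \<noteq> {}" using red[OF l0] by (auto simp: T_def)
  have MinT: "edge_path E x y (Min T)" "Min T \<le> l0" using Min_in[OF fin ne] by (auto simp: T_def)
  have Min_le': "Min T \<le> l" if "edge_path E x y l" for l
  proof (cases "l \<le> l0")
    case True
    obtain l' where "l' \<in> C" "edge_path E x y l'" "l' \<le> l" using red \<open>edge_path E x y l\<close> by blast
    then show ?thesis using Min_le[OF fin, of l'] True by (auto simp: T_def)
  qed (use MinT in auto)
  have "D x y = Min T" unfolding path_metric_def using MinT(1) Min_le'
    by (auto intro!: cInf_eq_minimum)
  then show "edge_path E x y (D x y)" and "edge_path E x y l \<Longrightarrow> D x y \<le> l"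
    using MinT Min_le' by auto
qed

text \<open>The upper bound is the explicit vertex path. For the lower bound take a normal path: at
  each end the cost \<open>1 - x u\<close> of reaching the star vertex is at least its
  \<open>dv\<close> distance from the end, so the triangle inequality for \<open>dv\<close>
  applies.\<close>

lemma path_metric_vertices:
  assumes "u \<in> V" "v \<in> V"
  shows "D (vertex_point u) (vertex_point v) = dv u v"
proof (rule antisym)
  show "D (vertex_point u) (vertex_point v) \<le> dv u v"
    using path_metric_attained(2)[OF _ _ edge_path_vertices] assms vertex_in_X by auto
  have star: "dv u a \<le> 1 - vertex_point u a \<and> dv a u \<le> 1 - vertex_point u a"
    if on: "on_star (vertex_point u) a" and "u \<in> V" for u a
  proof (cases "u = a")
    case True
    then show ?thesis using \<open>u \<in> V\<close> dv_eq_0 by (simp add: vertex_point_apply)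
  next
    case False
    then obtain b t where b: "{a, b} \<in> E" "vertex_point u = edge_point a b t"
      using on by (auto simp: on_star_def)
    then have "u = b" using False edge_point_apply(3)[of u a b t] by (metis of_bool_eq(2) vertex_point_apply zero_neq_one)
    moreover have "vertex_point u a = 0" using False by (simp add: vertex_point_apply)
    ultimately show ?thesis using dv_edge[of a b] dv_edge[of b a] b(1)
      by (simp add: insert_commute)
  qed
  have X: "vertex_point u \<in> X" "vertex_point v \<in> X" using assms vertex_in_X by auto
  let ?l = "D (vertex_point u) (vertex_point v)"
  have "normal_path (vertex_point u) (vertex_point v) ?l"
    using edge_path_normal[OF path_metric_attained(1)[OF X]] .
  then show "dv u v \<le> ?l"
  proof (cases rule: normal_path_cases)
    case 1
    then show ?thesis using assms dv_eq_0[of u v] path_metric_nonneg by simp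
  next
    case (2 a b s t)
    show ?thesis
    proof (cases "u = v")
      case True
      then show ?thesis using assms dv_eq_0[of u v] path_metric_nonneg by simp
    next
      case False
    have ab: "u = a \<or> u = b" "v = a \<or> v = b"
      using 2(4,5) edge_point_apply(3)[of u a b s] edge_point_apply(3)[of v a b t]
      by (metis of_bool_eq(2) vertex_point_apply zero_neq_one)+
    then have "{u, v} \<in> E" using 2(1) False by (auto simp: insert_commute)
    then have "dv u v \<le> 1" using dv_edge by blast
    moreover have "\<bar>s - t\<bar> = 1"
      using edge_point_abs_diff[of a b u s t] edge_neq[OF 2(1)] ab(1) False
      by (simp add: vertex_point_apply flip: 2(4,5))
    ultimately show ?thesis using 2(6) by linarith
    qed
  next
    case (3 a b)
    have V: "a \<in> V" "b \<in> V" using 3 on_star_bounds by auto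
    have "dv u v \<le> dv u a + (dv a b + dv b v)"
      using dv_triangle[of u a v] dv_triangle[of a b v] V assms by linarith
    then have "real (dv u v) \<le> real (dv u a) + real (dv a b) + real (dv b v)" by linarith
    then show ?thesis using star[OF 3(1) assms(1)] star[OF 3(2) assms(2)] 3(3) by linarith
  qed
qed

text \<open>Since the infimum is attained, distance 0 yields a normal path of length 0, and each of
  the three shapes then forces the two points to coincide.\<close>

lemma Metric_space_realization: "Metric_space X D"
proof
  fix x y z assume xyz: "x \<in> X" "y \<in> X" "z \<in> X"
  show "D x z \<le> D x y + D y z"
    using path_metric_attained[of x z] path_metric_attained[of x y] path_metric_attained[of y z]
      edge_path_trans xyz by metis
next
  fix x y assume xy: "x \<in> X" "y \<in> X"
  show "D x y = 0 \<longleftrightarrow> x = y"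
  proof
    assume "x = y"
    then show "D x y = 0"
      using path_metric_attained(2)[OF xy, of 0] edge_path.nil[of E] path_metric_nonneg[of E x y] by auto
  next
    assume "D x y = 0"
    then have "normal_path x y 0" using path_metric_attained(1)[OF xy] edge_path_normal by metis
    then consider "x = y" | u w where "on_star x u" "on_star y w"
        "(1 - x u) + dv u w + (1 - y w) \<le> 0" unfolding normal_path_def by auto
    then show "x = y"
    proof cases
      case 2
      then have *: "x u = 1" "y w = 1" "dv u w = 0" using on_star_bounds[OF 2(1)] on_star_bounds[OF 2(2)] by linarith+
      then have "u = w" using dv_eq_0 on_star_bounds(1) 2 by blast
      then show ?thesis using on_star_eq_1 2 * by metis
    qed
  qed
qed (rule path_metric_nonneg path_metric_sym)+

text \<open>Parametrisation by arc length. Recording an edge path for every pair of parameters,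
  instead of a distance, is what concatenation preserves; distances are compared only later, for
  shortest paths.\<close>

lemma edge_path_parametrized:
  assumes "edge_path E x y l" "x \<in> X"
  shows "\<exists>c. c 0 = x \<and> c l = y \<and> c ` {0..l} \<subseteq> X \<and>
    (\<forall>s t. 0 \<le> s \<longrightarrow> s \<le> t \<longrightarrow> t \<le> l \<longrightarrow> edge_path E (c s) (c t) (t - s))"
  using assms
proof (induction rule: edge_path.induct)
  case (nil x)
  moreover have "edge_path E x x (t - s)" if "0 \<le> s" "s \<le> t" "t \<le> 0" for s t :: real
  proof -
    have "t - s = 0" using that by linarith
    then show ?thesis using edge_path.nil[of E x] by simp
  qed
  ultimately show ?case by (intro exI[of _ "\<lambda>_. x"]) auto
next
  case (step u v s t y l)
  have X: "edge_point u v r \<in> X" if "r \<in> {0..1}" for r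
    using step that by (auto simp: graph_realization_def)
  obtain c where c: "c 0 = edge_point u v t" "c l = y" "c ` {0..l} \<subseteq> X"
    "\<And>s t. 0 \<le> s \<Longrightarrow> s \<le> t \<Longrightarrow> t \<le> l \<Longrightarrow> edge_path E (c s) (c t) (t - s)"
    using step.IH X[OF step.hyps(3)] by blast
  have l: "l \<ge> 0" using edge_path_nonneg step by blast
  define m where "m = \<bar>s - t\<bar>"
  \<comment> \<open>Motion from \<open>s\<close> to \<open>t\<close> at unit speed; for
    \<open>s = t\<close> the sign vanishes and the interval has length 0.\<close>
  define g where "g = (\<lambda>r. s + sgn (t - s) * r)"
  have g: "g r \<in> {0..1}" if "0 \<le> r" "r \<le> m" for r
    using that step.hyps(2,3) by (auto simp: g_def m_def sgn_if split: if_splits)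
  have gm: "g m = t" "g 0 = s" by (auto simp: g_def m_def sgn_if)
  have gd: "\<bar>g r - g r'\<bar> = r' - r" if "0 \<le> r" "r \<le> r'" "r' \<le> m" for r r'
    using that by (auto simp: g_def m_def sgn_if split: if_splits)
  define e where "e = (\<lambda>r. if r \<le> m then edge_point u v (g r) else c (r - m))"
  have seg: "edge_path E (edge_point u v (g r)) (edge_point u v (g r')) (r' - r)"
    if "0 \<le> r" "r \<le> r'" "r' \<le> m" for r r'
    using edge_path_edge[OF step.hyps(1) g[of r] g[of r']] gd[OF that] that by simp
  have "edge_path E (e r) (e r') (r' - r)" if r: "0 \<le> r" "r \<le> r'" "r' \<le> m + l" for r r'
  proof -
    consider "r' \<le> m" | "r \<le> m" "m < r'" | "m < r" by linarith
    then show ?thesis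
    proof cases
      case 1
      then show ?thesis using seg r by (simp add: e_def)
    next
      case 2
      have "edge_path E (edge_point u v (g r)) (c 0) (m - r)" using seg[of r m] 2 r gm c by simp
      moreover have "edge_path E (c 0) (c (r' - m)) (r' - m - 0)" using c(4)[of 0 "r' - m"] 2 r by simp
      ultimately have "edge_path E (edge_point u v (g r)) (c (r' - m)) ((m - r) + (r' - m - 0))"
        by (rule edge_path_trans)
      then show ?thesis using 2 by (simp add: e_def)
    next
      case 3
      then show ?thesis using c(4)[of "r - m" "r' - m"] r by (simp add: e_def)
    qed
  qed
  moreover have "e r \<in> X" if "r \<in> {0..m + l}" for r
    using that X g c(3) by (auto simp: e_def)
  moreover have "e 0 = edge_point u v s" using gm by (simp add: e_def m_def)
  moreover have "e (m + l) = y" using gm c l by (auto simp: e_def)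
  ultimately show ?case unfolding m_def[symmetric] by (intro exI[of _ e]) auto
qed

text \<open>A shortest path parametrised by arc length is geodesic, because a shortcut between two
  of its points would shorten the whole path.\<close>

lemma geodesic_space_realization: "geodesic_space X D"
proof -
  interpret Metric_space X D by (rule Metric_space_realization)
  have "\<exists>A. geodesic_segment X D x y A" if xy: "x \<in> X" "y \<in> X" for x y
  proof -
    obtain c where c: "c 0 = x" "c (D x y) = y" "c ` {0..D x y} \<subseteq> X"
      "\<And>s t. 0 \<le> s \<Longrightarrow> s \<le> t \<Longrightarrow> t \<le> D x y \<Longrightarrow> edge_path E (c s) (c t) (t - s)"
      using edge_path_parametrized[OF path_metric_attained(1)[OF xy] xy(1)] by blast
    have le: "D (c s) (c t) \<le> t - s" if "0 \<le> s" "s \<le> t" "t \<le> D x y" for s t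
      using path_metric_attained(2)[OF _ _ c(4)[OF that]] c(3) that by (simp add: image_subset_iff)
    have eq: "D (c s) (c t) = t - s" if st: "0 \<le> s" "s \<le> t" "t \<le> D x y" for s t
    proof -
      have X: "c s \<in> X" "c t \<in> X" using c(3) st by auto
      have "D x y \<le> D x (c s) + D (c s) y" "D (c s) y \<le> D (c s) (c t) + D (c t) y"
        using triangle X xy by auto
      then show ?thesis using le[of 0 s] le[of t "D x y"] le[OF st] st c by simp
    qed
    have "D (c s) (c t) = \<bar>s - t\<bar>" if "s \<in> {0..D x y}" "t \<in> {0..D x y}" for s t
    proof (cases "s \<le> t")
      case True then show ?thesis using eq[of s t] that by auto
    next
      case False then show ?thesis using eq[of t s] that commute[of "c s" "c t"] by auto
    qed
    then show ?thesis using c unfolding geodesic_segment_def by blast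
  qed
  then show ?thesis using Metric_space_realization unfolding geodesic_space_def by blast
qed

lemma near_vertex:
  assumes "x \<in> X" shows "\<exists>v\<in>V. D x (vertex_point v) \<le> 1"
proof -
  obtain u where u: "on_star x u" using on_star_exists assms by blast
  then have "D x (vertex_point u) \<le> 1 - x u"
    using path_metric_attained(2)[OF assms _ edge_path_on_star[OF u]] vertex_in_X on_star_bounds by auto
  then show ?thesis using on_star_bounds[OF u] by (intro bexI[of _ u]) auto
qed

end

section \<open>Word metrics\<close>

locale finitely_generated_group = group G for G (structure) +
  fixes S :: "'a set"
  assumes generating: "finite_generating_set G S"
begin

abbreviation "wl \<equiv> word_length G S"
abbreviation "letters \<equiv> S \<union> m_inv G ` S"
abbreviation "eval_word ws \<equiv> foldr (\<otimes>) ws \<one>"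

lemma S_carrier: "S \<subseteq> carrier G" and finite_S: "finite S"
  using generating by (auto simp: finite_generating_set_def)

lemma letters_carrier: "letters \<subseteq> carrier G"
  using S_carrier by auto

lemma inv_letter: "s \<in> letters \<Longrightarrow> inv s \<in> letters"
  using S_carrier by auto

lemma eval_word_closed: "set ws \<subseteq> letters \<Longrightarrow> eval_word ws \<in> carrier G"
  using letters_carrier by (induction ws) auto

lemma eval_word_append:
  "set vs \<subseteq> letters \<Longrightarrow> set ws \<subseteq> letters \<Longrightarrow>
    eval_word (vs @ ws) = eval_word vs \<otimes> eval_word ws"
proof (induction vs)
  case (Cons s vs)
  then have "s \<in> carrier G" using letters_carrier by auto
  then show ?case using Cons eval_word_closed[of vs] eval_word_closed[of ws] by (simp add: m_assoc)
qed (use eval_word_closed[of ws] in auto)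

lemma word_exists:
  assumes "g \<in> carrier G" shows "\<exists>ws. set ws \<subseteq> letters \<and> eval_word ws = g"
proof -
  have "g \<in> generate G S" using assms generating by (simp add: finite_generating_set_def)
  then show ?thesis
  proof (induction rule: generate.induct)
    case one
    then show ?case by (intro exI[of _ "[]"]) auto
  next
    case (incl h)
    then show ?case using S_carrier by (intro exI[of _ "[h]"]) auto
  next
    case (inv h)
    then show ?case using S_carrier by (intro exI[of _ "[inv h]"]) auto
  next
    case (eng g h)
    then obtain vs ws where "set vs \<subseteq> letters" "eval_word vs = g" "set ws \<subseteq> letters" "eval_word ws = h"
      by blast
    then show ?case using eval_word_append[of vs ws] by (intro exI[of _ "vs @ ws"]) auto
  qed
qed

lemma shortest_word:
  assumes "g \<in> carrier G"
  obtains ws where "length ws = wl g" "set ws \<subseteq> letters" "eval_word ws = g"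
proof -
  have "\<exists>n ws. length ws = n \<and> set ws \<subseteq> letters \<and> eval_word ws = g" using word_exists[OF assms] by blast
  from LeastI_ex[OF this] show thesis using that unfolding word_length_def by blast
qed

lemma word_length_le: "set ws \<subseteq> letters \<Longrightarrow> wl (eval_word ws) \<le> length ws"
  unfolding word_length_def by (rule Least_le) auto

lemma word_length_one [simp]: "wl \<one> = 0"
  using word_length_le[of "[]"] by simp

lemma word_length_letter: "s \<in> letters \<Longrightarrow> wl s \<le> 1"
  using word_length_le[of "[s]"] letters_carrier by auto

lemma word_length_mult:
  assumes "g \<in> carrier G" "h \<in> carrier G" shows "wl (g \<otimes> h) \<le> wl g + wl h"
proof -
  obtain vs where vs: "length vs = wl g" "set vs \<subseteq> letters" "eval_word vs = g"
    using shortest_word assms by metis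
  obtain ws where ws: "length ws = wl h" "set ws \<subseteq> letters" "eval_word ws = h"
    using shortest_word assms by metis
  show ?thesis using word_length_le[of "vs @ ws"] eval_word_append[OF vs(2) ws(2)] vs ws by auto
qed

lemma word_length_eq_0: "g \<in> carrier G \<Longrightarrow> wl g = 0 \<Longrightarrow> g = \<one>"
  by (metis foldr_Nil id_apply length_0_conv shortest_word)

lemma word_length_SucE:
  assumes "g \<in> carrier G" "wl g = Suc n"
  obtains s h where "s \<in> letters" "h \<in> carrier G" "g = s \<otimes> h" "wl h = n"
proof -
  obtain ws where ws: "length ws = wl g" "set ws \<subseteq> letters" "eval_word ws = g"
    using shortest_word assms by metis
  then obtain s vs where vs: "ws = s # vs" using assms by (cases ws) auto
  then have s: "s \<in> letters" "set vs \<subseteq> letters" using ws by auto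
  then have h: "eval_word vs \<in> carrier G" "s \<in> carrier G"
    using eval_word_closed letters_carrier by auto
  have g: "g = s \<otimes> eval_word vs" using ws vs by simp
  have "wl (eval_word vs) \<le> n" using word_length_le[OF s(2)] ws vs assms by simp
  moreover have "wl g \<le> 1 + wl (eval_word vs)"
    using word_length_mult[OF h(2,1)] word_length_letter[OF s(1)] g by simp
  ultimately show thesis using that s h g assms by force
qed

lemma word_length_inv_le: "g \<in> carrier G \<Longrightarrow> wl (inv g) \<le> wl g"
proof (induction "wl g" arbitrary: g)
  case 0
  then show ?case using word_length_eq_0 by fastforce
next
  case (Suc n)
  obtain s h where sh: "s \<in> letters" "h \<in> carrier G" "g = s \<otimes> h" "wl h = n"
    by (rule word_length_SucE[OF Suc.prems Suc.hyps(2)[symmetric]])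
  have s: "s \<in> carrier G" using sh letters_carrier by auto
  have "inv g = inv h \<otimes> inv s" using inv_mult_group s sh by simp
  then have "wl (inv g) \<le> wl (inv h) + wl (inv s)" using word_length_mult s sh by simp
  moreover have "wl (inv h) \<le> n" using Suc.hyps(1)[of h] sh by simp
  moreover have "wl (inv s) \<le> 1" using word_length_letter inv_letter sh by blast
  ultimately show ?case using Suc.hyps(2) by linarith
qed

lemma word_length_inv: "g \<in> carrier G \<Longrightarrow> wl (inv g) = wl g"
  using word_length_inv_le[of g] word_length_inv_le[of "inv g"] by simp

lemma word_length_SucE':
  assumes "g \<in> carrier G" "wl g = Suc n"
  obtains s h where "s \<in> letters" "h \<in> carrier G" "g = h \<otimes> s" "wl h = n"
proof -
  obtain s h where sh: "s \<in> letters" "h \<in> carrier G" "inv g = s \<otimes> h" "wl h = n"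
    by (rule word_length_SucE[of "inv g" n]) (use assms word_length_inv in auto)
  have s: "s \<in> carrier G" using sh letters_carrier by auto
  have "g = inv (s \<otimes> h)" using sh(3) assms by (metis inv_inv)
  then have "g = inv h \<otimes> inv s" using inv_mult_group s sh by simp
  then show thesis using inv_letter[OF sh(1)] word_length_inv[OF sh(2)] sh
    by (intro that[of "inv s" "inv h"]) auto
qed

text \<open>Elements of the ball are spelled with exactly \<open>n\<close> symbols, the unit padding
  shorter words. This exponential growth bound is what exponential integrability has to
  beat.\<close>

lemma word_ball:
  "finite {g \<in> carrier G. wl g \<le> n} \<and> card {g \<in> carrier G. wl g \<le> n} \<le> (2 * card S + 1) ^ n"
proof (induction n)
  case 0
  have "{g \<in> carrier G. wl g \<le> 0} = {\<one>}" using word_length_eq_0 by auto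
  then show ?case by simp
next
  case (Suc n)
  let ?B = "{g \<in> carrier G. wl g \<le> n}"
  let ?P = "insert \<one> letters \<times> ?B"
  have sub: "{g \<in> carrier G. wl g \<le> Suc n} \<subseteq> (\<lambda>(s, h). s \<otimes> h) ` ?P"
  proof
    fix g assume g: "g \<in> {g \<in> carrier G. wl g \<le> Suc n}"
    show "g \<in> (\<lambda>(s, h). s \<otimes> h) ` ?P"
    proof (cases "wl g \<le> n")
      case True
      then show ?thesis using g by (intro image_eqI[of _ _ "(\<one>, g)"]) auto
    next
      case False
      then have *: "g \<in> carrier G" "wl g = Suc n" using g by auto
      obtain s h where "s \<in> letters" "h \<in> carrier G" "g = s \<otimes> h" "wl h = n"
        by (rule word_length_SucE[OF *])
      then show ?thesis by (intro image_eqI[of _ _ "(s, h)"]) auto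
    qed
  qed
  have fin: "finite ?P" using finite_S Suc by blast
  have "card letters \<le> card S + card S"
    by (rule order_trans[OF card_Un_le]) (use finite_S card_image_le in auto)
  then have "card (insert \<one> letters) \<le> 2 * card S + 1"
    using card_insert_le_m1[of "2 * card S + 1" letters \<one>] by simp
  then have "card ?P \<le> (2 * card S + 1) * (2 * card S + 1) ^ n"
    using Suc by (simp only: card_cartesian_product) (intro mult_mono, auto)
  moreover have "card {g \<in> carrier G. wl g \<le> Suc n} \<le> card ?P"
    using surj_card_le[OF fin sub] .
  ultimately show ?case using finite_subset[OF sub] fin by auto
qed

section \<open>Cayley graphs and change of generating set\<close>

lemma cayley_edge_iff:
  "{u, v} \<in> cayley_edges G S \<longleftrightarrow>
    u \<in> carrier G \<and> v \<in> carrier G \<and> u \<noteq> v \<and> inv u \<otimes> v \<in> letters"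
proof
  assume "{u, v} \<in> cayley_edges G S"
  then obtain g s where gs: "{u, v} = {g, g \<otimes> s}" "g \<in> carrier G" "s \<in> S" "g \<otimes> s \<noteq> g"
    unfolding cayley_edges_def by blast
  have s: "s \<in> carrier G" using gs S_carrier by auto
  consider "u = g" "v = g \<otimes> s" | "u = g \<otimes> s" "v = g" using gs(1) by (auto simp: doubleton_eq_iff)
  then show "u \<in> carrier G \<and> v \<in> carrier G \<and> u \<noteq> v \<and> inv u \<otimes> v \<in> letters"
  proof cases
    case 1
    then show ?thesis using gs s inv_solve_left by (auto simp: m_assoc[symmetric])
  next
    case 2
    then have "inv u \<otimes> v = inv s" using gs s by (simp add: inv_mult_group m_assoc)
    then show ?thesis using 2 gs s by auto
  qed
next
  assume uv: "u \<in> carrier G \<and> v \<in> carrier G \<and> u \<noteq> v \<and> inv u \<otimes> v \<in> letters"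
  then have v: "v = u \<otimes> (inv u \<otimes> v)" by (simp add: m_assoc[symmetric])
  have edge: "{g, g \<otimes> s} \<in> cayley_edges G S" if "g \<in> carrier G" "s \<in> S" "g \<otimes> s \<noteq> g" for g s
    using that unfolding cayley_edges_def by blast
  consider "inv u \<otimes> v \<in> S" | s where "s \<in> S" "inv u \<otimes> v = inv s" using uv by blast
  then show "{u, v} \<in> cayley_edges G S"
  proof cases
    case 1
    then show ?thesis using edge[of u "inv u \<otimes> v"] uv v by auto
  next
    case 2
    have s: "s \<in> carrier G" using 2 S_carrier by auto
    have "v = u \<otimes> inv s" using v 2 by simp
    then have "u = v \<otimes> s" using uv s by (simp add: m_assoc)
    then show ?thesis using edge[of v s] uv 2 by (simp add: insert_commute)
  qed
qed

sublocale cayley: graph_distance "carrier G" "cayley_edges G S" "\<lambda>g h. wl (inv g \<otimes> h)"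
proof
  fix u v assume "{u, v} \<in> cayley_edges G S"
  then show "u \<in> carrier G" "u \<noteq> v" "wl (inv u \<otimes> v) \<le> 1"
    using cayley_edge_iff word_length_letter by auto
next
  fix u v assume uv: "u \<in> carrier G" "v \<in> carrier G"
  have "inv u \<otimes> v = \<one> \<longleftrightarrow> u = v" using uv by (metis inv_equality inv_inv inv_closed l_inv)
  then show "wl (inv u \<otimes> v) = 0 \<longleftrightarrow> u = v"
    using word_length_eq_0[of "inv u \<otimes> v"] uv by auto
next
  fix u v w assume uvw: "u \<in> carrier G" "v \<in> carrier G" "w \<in> carrier G"
  have "inv u \<otimes> w = (inv u \<otimes> v) \<otimes> (inv v \<otimes> w)"
  proof -
    have "v \<otimes> (inv v \<otimes> w) = w" using uvw by (simp add: m_assoc[symmetric])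
    then show ?thesis using uvw by (simp add: m_assoc)
  qed
  then show "wl (inv u \<otimes> w) \<le> wl (inv u \<otimes> v) + wl (inv v \<otimes> w)"
    using word_length_mult uvw by simp
next
  fix u v n assume uv: "u \<in> carrier G" "v \<in> carrier G" "wl (inv u \<otimes> v) = Suc n"
  obtain s h where sh: "s \<in> letters" "h \<in> carrier G" "inv u \<otimes> v = s \<otimes> h" "wl h = n"
    by (rule word_length_SucE[OF _ uv(3)]) (use uv in auto)
  have s: "s \<in> carrier G" using sh letters_carrier by auto
  \<comment> \<open>Cayley edges exclude loops, so the first letter must really move
    \<open>u\<close>; a trivial letter would give \<open>h\<close> length
    \<open>Suc n\<close>.\<close>
  have "s \<noteq> \<one>"
  proof
    assume "s = \<one>"
    then show False using sh(2-4) uv(3) by simp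
  qed
  then have "u \<otimes> s \<noteq> u" using uv s l_cancel_one[of u s] by auto
  moreover have "inv u \<otimes> (u \<otimes> s) = s" using uv s by (simp add: m_assoc[symmetric])
  ultimately have "{u, u \<otimes> s} \<in> cayley_edges G S" using cayley_edge_iff uv s sh by auto
  moreover have "inv (u \<otimes> s) \<otimes> v = inv s \<otimes> (inv u \<otimes> v)"
    using uv s by (simp add: inv_mult_group m_assoc)
  then have "inv (u \<otimes> s) \<otimes> v = h" using sh s by (simp add: m_assoc[symmetric])
  ultimately show "\<exists>w. {u, w} \<in> cayley_edges G S \<and> wl (inv w \<otimes> v) = n" using sh by metis
qed

lemma word_length_comparison:
  assumes "finite_generating_set G S'"
  shows "\<exists>L. \<forall>g\<in>carrier G. wl g \<le> L * word_length G S' g"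
proof -
  interpret S': finitely_generated_group G S' using assms by unfold_locales
  \<comment> \<open>The sum dominates each generator and, unlike a maximum, also makes sense for
    empty \<open>S'\<close>.\<close>
  define L where "L = (\<Sum>s\<in>S'. wl s)"
  have L: "wl s \<le> L" if "s \<in> S'.letters" for s
  proof -
    have *: "wl s \<le> L" if "s \<in> S'" for s
      unfolding L_def using that S'.finite_S by (intro member_le_sum) auto
    show ?thesis using that * S'.S_carrier word_length_inv by auto
  qed
  have "wl g \<le> L * S'.wl g" if "g \<in> carrier G" for g
    using that
  proof (induction "S'.wl g" arbitrary: g)
    case 0
    then show ?case using S'.word_length_eq_0 by force
  next
    case (Suc n)
    obtain s h where sh: "s \<in> S'.letters" "h \<in> carrier G" "g = s \<otimes> h" "S'.wl h = n"
      by (rule S'.word_length_SucE[OF Suc.prems Suc.hyps(2)[symmetric]])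
    have "wl g \<le> wl s + wl h" using word_length_mult sh S'.letters_carrier by blast
    moreover have "wl h \<le> L * n" using Suc.hyps(1)[of h] sh by simp
    ultimately show ?case using L[OF sh(1)] by (simp flip: Suc.hyps(2))
  qed
  then show ?thesis by blast
qed

text \<open>Telescoping along a shortest word. A letter from \<open>S\<close> is a controlled step
  forwards; an inverse letter is a controlled step traversed backwards, whose starting point is the
  later vertex. For this reason \<open>step\<close> covers the whole ball of radius
  \<open>n\<close>, boundary included, and \<rho> has to be symmetric.\<close>

lemma bound_along_word:
  fixes \<rho> :: "'a \<Rightarrow> 'a \<Rightarrow> real"
  assumes \<rho>: "\<And>x. x \<in> carrier G \<Longrightarrow> \<rho> x x = 0"
    "\<And>x y. x \<in> carrier G \<Longrightarrow> y \<in> carrier G \<Longrightarrow> \<rho> x y = \<rho> y x"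
    "\<And>x y z. x \<in> carrier G \<Longrightarrow> y \<in> carrier G \<Longrightarrow> z \<in> carrier G \<Longrightarrow> \<rho> x z \<le> \<rho> x y + \<rho> y z"
    and l: "l \<in> carrier G"
    and step: "\<And>u s. u \<in> carrier G \<Longrightarrow> wl u \<le> n \<Longrightarrow> s \<in> S \<Longrightarrow> \<rho> (l \<otimes> u) (l \<otimes> u \<otimes> s) \<le> r"
    and w: "w \<in> carrier G" "wl w \<le> n"
  shows "\<rho> l (l \<otimes> w) \<le> real (wl w) * r"
  using w
proof (induction "wl w" arbitrary: w)
  case 0
  then show ?case using word_length_eq_0[of w] l \<rho>(1) by simp
next
  case (Suc m)
  obtain s h where sh: "s \<in> letters" "h \<in> carrier G" "w = h \<otimes> s" "wl h = m"
    by (rule word_length_SucE'[OF Suc.prems(1) Suc.hyps(2)[symmetric]])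
  have c: "s \<in> carrier G" "l \<otimes> h \<in> carrier G" "l \<otimes> w \<in> carrier G"
    using sh letters_carrier l Suc.prems by auto
  have lw: "l \<otimes> w = l \<otimes> h \<otimes> s" using sh c l by (simp add: m_assoc)
  have "\<rho> (l \<otimes> h) (l \<otimes> w) \<le> r"
  proof (cases "s \<in> S")
    case True
    then show ?thesis using step[of h s] sh Suc lw by simp
  next
    case False
    then obtain t where t: "t \<in> S" "s = inv t" using sh by auto
    have tc: "t \<in> carrier G" using t S_carrier by auto
    have "l \<otimes> w \<otimes> t = l \<otimes> h" using lw t tc l sh by (simp add: m_assoc)
    then show ?thesis using step[of w t] Suc.prems t \<rho>(2)[OF c(2,3)] by simp
  qed
  moreover have "\<rho> l (l \<otimes> h) \<le> real m * r" using Suc.hyps(1)[of h] Suc.hyps(2) Suc.prems sh by simp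
  moreover have "\<rho> l (l \<otimes> w) \<le> \<rho> l (l \<otimes> h) + \<rho> (l \<otimes> h) (l \<otimes> w)" using \<rho>(3) c l by blast
  ultimately show ?case by (simp add: algebra_simps flip: Suc.hyps(2))
qed

end

section \<open>Cocycles of orbit equivalence couplings\<close>

lemma (in finitely_generated_group) word_distance_sym:
  assumes "g \<in> carrier G" "h \<in> carrier G"
  shows "wl (inv g \<otimes> h) = wl (inv h \<otimes> g)"
proof -
  have "inv (inv g \<otimes> h) = inv h \<otimes> g" using assms by (simp add: inv_mult_group)
  then show ?thesis using word_length_inv[of "inv g \<otimes> h"] assms by simp
qed

text \<open>One set \<open>X\<close> is a fundamental domain for both actions, which makes the
  assumptions symmetric in the two groups. Everything proved for one cocycle holds for the other
  through \<open>swap\<close>.\<close>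

locale orbit_coupling = G: group G + H: group H
  for G :: "('a, 'm) monoid_scheme" and H :: "('b, 'n) monoid_scheme" +
  fixes M :: "'w measure" and a :: "'a \<Rightarrow> 'w \<Rightarrow> 'w" and b :: "'b \<Rightarrow> 'w \<Rightarrow> 'w" and X :: "'w set"
  assumes countable_G: "countable (carrier G)" and countable_H: "countable (carrier H)"
    and action_G: "free_mp_action G M a" and action_H: "free_mp_action H M b"
    and commuting: "\<And>g h x. g \<in> carrier G \<Longrightarrow> h \<in> carrier H \<Longrightarrow> x \<in> space M \<Longrightarrow>
      a g (b h x) = b h (a g x)"
    and domain_G: "fundamental_domain G M a X" and domain_H: "fundamental_domain H M b X"
    and finite_X: "emeasure M X < \<infinity>" and nonzero: "emeasure M (space M) \<noteq> 0"
begin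

lemma swap: "orbit_coupling H G M b a X"
  using countable_G countable_H action_G action_H domain_G domain_H finite_X nonzero commuting
  by unfold_locales auto

sublocale a: group_action G "space M" a
  using action_G by (simp add: free_mp_action_def)

sublocale b: group_action H "space M" b
  using action_H by (simp add: free_mp_action_def)

lemma X_sets: "X \<in> sets M" and X_space: "X \<subseteq> space M"
  using domain_G sets.sets_into_space by (auto simp: fundamental_domain_def)

lemma a_space [simp]: "g \<in> carrier G \<Longrightarrow> x \<in> space M \<Longrightarrow> a g x \<in> space M"
  using a.element_image by blast

lemma b_space [simp]: "h \<in> carrier H \<Longrightarrow> x \<in> space M \<Longrightarrow> b h x \<in> space M"
  using b.element_image by blast

lemma a_inv [simp]: "g \<in> carrier G \<Longrightarrow> x \<in> space M \<Longrightarrow> a (inv\<^bsub>G\<^esub> g) (a g x) = x"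
  using a.orbit_sym_aux by blast

lemma b_inv [simp]: "h \<in> carrier H \<Longrightarrow> x \<in> space M \<Longrightarrow> b (inv\<^bsub>H\<^esub> h) (b h x) = x"
  using b.orbit_sym_aux by blast

lemma domain_unique:
  assumes "\<omega> \<in> space M" shows "\<exists>!h. h \<in> carrier H \<and> b h \<omega> \<in> X"
proof -
  have bij: "bij_betw (\<lambda>(h, x). b h x) (carrier H \<times> X) (space M)"
    using domain_H by (simp add: fundamental_domain_def)
  have "\<omega> \<in> (\<lambda>(h, x). b h x) ` (carrier H \<times> X)" using bij assms by (simp add: bij_betw_def)
  then obtain h x where hx: "h \<in> carrier H" "x \<in> X" "\<omega> = b h x" by auto
  then have "inv\<^bsub>H\<^esub> h \<in> carrier H \<and> b (inv\<^bsub>H\<^esub> h) \<omega> \<in> X" using X_space by auto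
  moreover have "h1 = h2" if h: "h1 \<in> carrier H" "b h1 \<omega> \<in> X" "h2 \<in> carrier H" "b h2 \<omega> \<in> X" for h1 h2
  proof -
    have "b (inv\<^bsub>H\<^esub> h1) (b h1 \<omega>) = b (inv\<^bsub>H\<^esub> h2) (b h2 \<omega>)" using h assms by simp
    then have "(inv\<^bsub>H\<^esub> h1, b h1 \<omega>) = (inv\<^bsub>H\<^esub> h2, b h2 \<omega>)"
      using bij_betw_imp_inj_on[OF bij, THEN inj_onD, of "(inv\<^bsub>H\<^esub> h1, b h1 \<omega>)" "(inv\<^bsub>H\<^esub> h2, b h2 \<omega>)"] h
      by simp
    then show ?thesis using h by (metis H.inv_inv prod.inject)
  qed
  ultimately show ?thesis by blast
qed

abbreviation "\<alpha> \<equiv> coupling_cocycle H a b X"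

text \<open>The action of \<open>G\<close> on the orbit space of \<open>H\<close>, transported to
  the fundamental domain \<open>X\<close>: the point \<open>a g x\<close> is brought back to
  \<open>X\<close> inside its \<open>H\<close>-orbit.\<close>

definition act :: "'a \<Rightarrow> 'w \<Rightarrow> 'w" where
  "act g x = b (\<alpha> g x) (a g x)"

lemma cocycle:
  assumes "g \<in> carrier G" "x \<in> X"
  shows cocycle_closed: "\<alpha> g x \<in> carrier H" and act_closed: "act g x \<in> X"
proof -
  have "a g x \<in> space M" using assms X_space by auto
  from theI'[OF domain_unique[OF this]]
  show "\<alpha> g x \<in> carrier H" "act g x \<in> X" unfolding act_def coupling_cocycle_def by auto
qed

lemma cocycle_eqI:
  assumes "g \<in> carrier G" "x \<in> X" "h \<in> carrier H" "b h (a g x) \<in> X"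
  shows "\<alpha> g x = h"
proof -
  have "a g x \<in> space M" using assms X_space by auto
  then show ?thesis using domain_unique assms unfolding coupling_cocycle_def by blast
qed

text \<open>The cocycle identity. As the actions commute, the product of the two correcting elements
  carries the translated point into \<open>X\<close>, and such an element is unique.\<close>

lemma cocycle_mult:
  assumes "g \<in> carrier G" "g' \<in> carrier G" "x \<in> X"
  shows "\<alpha> (g \<otimes>\<^bsub>G\<^esub> g') x = \<alpha> g (act g' x) \<otimes>\<^bsub>H\<^esub> \<alpha> g' x"
    and "act (g \<otimes>\<^bsub>G\<^esub> g') x = act g (act g' x)"
proof -
  let ?h' = "\<alpha> g' x" and ?h = "\<alpha> g (act g' x)"
  have h: "?h' \<in> carrier H" "?h \<in> carrier H" and X: "act g' x \<in> X" "act g (act g' x) \<in> X"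
    using cocycle assms by auto
  have x: "x \<in> space M" using assms X_space by auto
  have "b (?h \<otimes>\<^bsub>H\<^esub> ?h') (a (g \<otimes>\<^bsub>G\<^esub> g') x) = b ?h (b ?h' (a g (a g' x)))"
    using h assms x a.composition_rule b.composition_rule by simp
  also have "\<dots> = b ?h (a g (b ?h' (a g' x)))" using commuting[of g ?h' "a g' x"] h assms x by simp
  also have "\<dots> = act g (act g' x)" by (simp add: act_def)
  finally have *: "b (?h \<otimes>\<^bsub>H\<^esub> ?h') (a (g \<otimes>\<^bsub>G\<^esub> g') x) = act g (act g' x)" .
  show **: "\<alpha> (g \<otimes>\<^bsub>G\<^esub> g') x = ?h \<otimes>\<^bsub>H\<^esub> ?h'"
    using cocycle_eqI[of "g \<otimes>\<^bsub>G\<^esub> g'" x "?h \<otimes>\<^bsub>H\<^esub> ?h'"] * X h assms by simp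
  show "act (g \<otimes>\<^bsub>G\<^esub> g') x = act g (act g' x)" using * ** by (simp add: act_def)
qed

text \<open>Inverting makes the cocycle a map between left-invariant Cayley graphs.\<close>

lemma cocycle_increment:
  assumes "g \<in> carrier G" "s \<in> carrier G" "x \<in> X"
  shows "\<alpha> (inv\<^bsub>G\<^esub> g) x \<otimes>\<^bsub>H\<^esub> inv\<^bsub>H\<^esub> (\<alpha> (inv\<^bsub>G\<^esub> (g \<otimes>\<^bsub>G\<^esub> s)) x) = \<alpha> s (act (inv\<^bsub>G\<^esub> (g \<otimes>\<^bsub>G\<^esub> s)) x)"
proof -
  let ?g = "inv\<^bsub>G\<^esub> (g \<otimes>\<^bsub>G\<^esub> s)"
  have g: "?g \<in> carrier G" using assms by simp
  have "s \<otimes>\<^bsub>G\<^esub> ?g = inv\<^bsub>G\<^esub> g" using assms by (simp add: G.inv_mult_group G.m_assoc[symmetric])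
  then have eq: "\<alpha> (inv\<^bsub>G\<^esub> g) x = \<alpha> s (act ?g x) \<otimes>\<^bsub>H\<^esub> \<alpha> ?g x"
    using cocycle_mult(1)[OF assms(2) g assms(3)] by simp
  have "\<alpha> s (act ?g x) \<in> carrier H" "\<alpha> ?g x \<in> carrier H" using cocycle g assms by auto
  then show ?thesis unfolding eq by (simp add: H.m_assoc)
qed

text \<open>This is where having the same fundamental domain matters. After commuting the actions,
  membership of \<open>b (\<alpha> g x) (a g x)\<close> in \<open>X\<close> is also the defining
  relation of the other cocycle at \<open>x\<close>. The cocycles at a fixed \<open>x\<close> are
  therefore mutually inverse, and both induced actions reach the same point.\<close>

lemma cocycle_swap:
  assumes "g \<in> carrier G" "x \<in> X"
  shows "coupling_cocycle G b a X (\<alpha> g x) x = g"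
    and "orbit_coupling.act G b a X (\<alpha> g x) x = act g x"
proof -
  interpret s: orbit_coupling H G M b a X by (rule swap)
  have h: "\<alpha> g x \<in> carrier H" "act g x \<in> X" using cocycle assms by auto
  have eq: "a g (b (\<alpha> g x) x) = act g x"
    using commuting assms h X_space by (auto simp: act_def)
  show *: "coupling_cocycle G b a X (\<alpha> g x) x = g"
    using s.cocycle_eqI[of "\<alpha> g x" x g] assms h eq by simp
  show "s.act (\<alpha> g x) x = act g x" unfolding s.act_def * eq ..
qed

section \<open>Measure-theoretic control of the cocycles and of the induced action\<close>

lemma translate_measurable:
  assumes "g \<in> carrier G" "h \<in> carrier H"
  shows "(\<lambda>x. b h (a g x)) \<in> measurable M M"
  by (rule measurable_compose[of "a g" M M "b h" M])
    (use assms action_G action_H in \<open>auto simp: free_mp_action_def measure_preserving_def\<close>)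

lemma emeasure_translate:
  assumes "g \<in> carrier G" "h \<in> carrier H" "A \<in> sets M"
  shows "emeasure M {x\<in>space M. b h (a g x) \<in> A} = emeasure M A"
proof -
  have a: "a g \<in> measurable M M" "distr M M (a g) = M"
    and b: "b h \<in> measurable M M" "distr M M (b h) = M"
    using assms action_G action_H unfolding free_mp_action_def measure_preserving_def by auto
  let ?B = "b h -` A \<inter> space M"
  have B: "?B \<in> sets M" using measurable_sets[OF b(1)] assms(3) by blast
  have "{x\<in>space M. b h (a g x) \<in> A} = a g -` ?B \<inter> space M" using assms by auto
  then have "emeasure M {x\<in>space M. b h (a g x) \<in> A} = emeasure (distr M M (a g)) ?B"
    using emeasure_distr[OF a(1) B] by simp
  also have "\<dots> = emeasure (distr M M (b h)) A" using emeasure_distr[OF b(1) assms(3)] a(2) by simp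
  finally show ?thesis using b(2) by simp
qed

text \<open>The cocycle takes countably many values, and for a fixed value \<open>h\<close> the
  induced map is the measurable translate by \<open>g\<close> and \<open>h\<close>.\<close>

lemma level_set_measurable:
  assumes g: "g \<in> carrier G" and A: "A \<in> sets M" "A \<subseteq> X"
  shows "{x\<in>X. Q (\<alpha> g x) \<and> act g x \<in> A} \<in> sets M"
proof -
  define F where "F = (\<lambda>h. X \<inter> ((\<lambda>x. b h (a g x)) -` A \<inter> space M))"
  have "{x\<in>X. Q (\<alpha> g x) \<and> act g x \<in> A} = (\<Union>h\<in>{h\<in>carrier H. Q h}. F h)"
    using cocycle[OF g] cocycle_eqI[OF g] A X_space by (auto simp: act_def F_def)
  moreover have "countable {h\<in>carrier H. Q h}" using countable_H by (auto intro: countable_subset)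
  moreover have "F h \<in> sets M" if "h \<in> carrier H" for h
    using measurable_sets[OF translate_measurable[OF g that] A(1)] X_sets by (auto simp: F_def)
  ultimately show ?thesis by (simp only:) (intro sets.countable_UN', auto)
qed

text \<open>Split the preimage into pieces \<open>U h\<close> by the value \<open>h\<close> of the
  cocycle. On each piece the induced map is one measure-preserving translate, with image
  \<open>V h\<close> inside \<open>A\<close>; these images are disjoint because the element
  returning a point to \<open>X\<close> is unique.\<close>

lemma emeasure_act_preimage_le:
  assumes g: "g \<in> carrier G" and A: "A \<in> sets M" "A \<subseteq> X"
  shows "{x\<in>X. act g x \<in> A} \<in> sets M" "emeasure M {x\<in>X. act g x \<in> A} \<le> emeasure M A"
proof -
  show "{x\<in>X. act g x \<in> A} \<in> sets M" using level_set_measurable[OF g A, of "\<lambda>_. True"] by simp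
  define U where "U = (\<lambda>h. X \<inter> ((\<lambda>x. b h (a g x)) -` A \<inter> space M))"
  define V where "V = (\<lambda>h. A \<inter> ((\<lambda>y. b (inv\<^bsub>H\<^esub> h) (a (inv\<^bsub>G\<^esub> g) y)) -` X \<inter> space M))"
  have eq: "{x\<in>X. act g x \<in> A} = (\<Union>h\<in>carrier H. U h)"
    using cocycle[OF g] cocycle_eqI[OF g] A X_space by (auto simp: act_def U_def)
  have U: "U h \<in> sets M" and V: "V h \<in> sets M" if "h \<in> carrier H" for h
    using measurable_sets[OF translate_measurable[OF g that] A(1)] X_sets A
      measurable_sets[OF translate_measurable[of "inv\<^bsub>G\<^esub> g" "inv\<^bsub>H\<^esub> h"] X_sets] g that
    by (auto simp: U_def V_def)
  have UV: "emeasure M (U h) = emeasure M (V h)" if h: "h \<in> carrier H" for h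
  proof -
    have "b (inv\<^bsub>H\<^esub> h) (a (inv\<^bsub>G\<^esub> g) (b h (a g x))) = x" if "x \<in> space M" for x
      using commuting[of "inv\<^bsub>G\<^esub> g" h "a g x"] g h that by simp
    then have "{x\<in>space M. b h (a g x) \<in> V h} = U h"
      using X_space sets.sets_into_space[OF A(1)] g h by (auto simp: U_def V_def)
    then show ?thesis using emeasure_translate[OF g h V[OF h]] by simp
  qed
  have dU: "disjoint_family_on U (carrier H)"
  proof -
    have "\<alpha> g x = h" if "x \<in> U h" "h \<in> carrier H" for x h
      using cocycle_eqI[OF g] A that by (auto simp: U_def)
    then show ?thesis unfolding disjoint_family_on_def by blast
  qed
  have dV: "disjoint_family_on V (carrier H)"
    unfolding disjoint_family_on_def
  proof (intro ballI impI)
    fix h h' assume hh: "h \<in> carrier H" "h' \<in> carrier H" "h \<noteq> h'"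
    show "V h \<inter> V h' = {}"
    proof (rule ccontr)
      assume "V h \<inter> V h' \<noteq> {}"
      then obtain y where y: "y \<in> space M" "b (inv\<^bsub>H\<^esub> h) (a (inv\<^bsub>G\<^esub> g) y) \<in> X"
        "b (inv\<^bsub>H\<^esub> h') (a (inv\<^bsub>G\<^esub> g) y) \<in> X" by (auto simp: V_def)
      then have "inv\<^bsub>H\<^esub> h = inv\<^bsub>H\<^esub> h'" using domain_unique[of "a (inv\<^bsub>G\<^esub> g) y"] g hh by auto
      then show False using hh by (metis H.inv_inv)
    qed
  qed
  have "emeasure M {x\<in>X. act g x \<in> A} = (\<integral>\<^sup>+h. emeasure M (U h) \<partial>count_space (carrier H))"
    unfolding eq using U dU countable_H by (intro emeasure_UN_countable) auto
  also have "\<dots> = (\<integral>\<^sup>+h. emeasure M (V h) \<partial>count_space (carrier H))"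
    using UV by (intro nn_integral_cong) auto
  also have "\<dots> = emeasure M (\<Union>h\<in>carrier H. V h)"
    using V dV countable_H by (intro emeasure_UN_countable[symmetric]) auto
  also have "\<dots> \<le> emeasure M A" using A by (intro emeasure_mono) (auto simp: V_def)
  finally show "emeasure M {x\<in>X. act g x \<in> A} \<le> emeasure M A" .
qed

lemma X_positive: "emeasure M X \<noteq> 0"
proof
  assume "emeasure M X = 0"
  \<comment> \<open>The unit of \<open>H\<close> only puts the set into the form used in
    \<open>emeasure_translate\<close>. Countably many translates of \<open>X\<close> cover the
    space, so a null set \<open>X\<close> would make the whole space null.\<close>
  have null: "{x\<in>space M. b \<one>\<^bsub>H\<^esub> (a g x) \<in> X} \<in> null_sets M" if "g \<in> carrier G" for g
    using emeasure_translate[OF that, of "\<one>\<^bsub>H\<^esub>" X] X_sets \<open>emeasure M X = 0\<close>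
      measurable_sets[OF translate_measurable[OF that], of "\<one>\<^bsub>H\<^esub>" X]
    by (intro null_setsI) (auto simp: vimage_def Int_def conj_commute)
  have "\<exists>g\<in>carrier G. a g x \<in> X" if "x \<in> space M" for x
    using orbit_coupling.domain_unique[OF swap that] by blast
  moreover have "b \<one>\<^bsub>H\<^esub> y = y" if "y \<in> space M" for y
    using b.id_eq_one that by (metis restrict_apply')
  ultimately have "space M = (\<Union>g\<in>carrier G. {x\<in>space M. b \<one>\<^bsub>H\<^esub> (a g x) \<in> X})" by fastforce
  also have "\<dots> \<in> null_sets M" using null countable_G by (intro null_sets_UN') auto
  finally show False using nonzero by (simp add: null_setsD1)
qed

text \<open>Markov's inequality on the fundamental domain. Monotonicity of \<phi> is asked for only
  at the lengths exceeding \<open>r\<close>.\<close>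

lemma cocycle_tail_bound:
  fixes \<phi> :: "real \<Rightarrow> real" and len :: "'b \<Rightarrow> real"
  assumes g: "g \<in> carrier G"
    and mono: "\<And>h. h \<in> carrier H \<Longrightarrow> len h > r \<Longrightarrow> \<phi> (c * r) \<le> \<phi> (c * len h)"
    and pos: "\<phi> (c * r) > 0" and "I \<ge> 0"
    and int: "(\<integral>\<^sup>+x\<in>X. ennreal (\<phi> (c * len (\<alpha> g x))) \<partial>M) \<le> ennreal I"
  shows "{x\<in>X. len (\<alpha> g x) > r} \<in> sets M"
    "emeasure M {x\<in>X. len (\<alpha> g x) > r} \<le> ennreal (I / \<phi> (c * r))"
proof -
  let ?B = "{x\<in>X. len (\<alpha> g x) > r}"
  have "?B = {x\<in>X. len (\<alpha> g x) > r \<and> act g x \<in> X}" using act_closed g by auto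
  then show B: "?B \<in> sets M" using level_set_measurable[OF g X_sets order_refl, of "\<lambda>h. len h > r"] by simp
  have "ennreal (\<phi> (c * r)) * emeasure M ?B = (\<integral>\<^sup>+x. ennreal (\<phi> (c * r)) * indicator ?B x \<partial>M)"
    using B by (rule nn_integral_cmult_indicator[symmetric])
  also have "\<dots> \<le> (\<integral>\<^sup>+x\<in>X. ennreal (\<phi> (c * len (\<alpha> g x))) \<partial>M)"
    using mono cocycle_closed[OF g] by (intro nn_integral_mono) (auto simp: indicator_def intro!: ennreal_leI)
  finally have *: "ennreal (\<phi> (c * r)) * emeasure M ?B \<le> ennreal I" using int by (rule order_trans)
  have "emeasure M ?B = ennreal (1 / \<phi> (c * r)) * (ennreal (\<phi> (c * r)) * emeasure M ?B)"
    using pos by (simp add: mult.assoc[symmetric] ennreal_mult[symmetric])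
  also have "\<dots> \<le> ennreal (1 / \<phi> (c * r)) * ennreal I" using * by (rule mult_left_mono) simp
  also have "\<dots> = ennreal (I / \<phi> (c * r))" using pos \<open>I \<ge> 0\<close> by (simp add: ennreal_mult[symmetric])
  finally show "emeasure M ?B \<le> ennreal (I / \<phi> (c * r))" .
qed

text \<open>The union bound: sets of total measure below that of \<open>X\<close> cannot cover
  \<open>X\<close>.\<close>

lemma avoid_bad_sets:
  assumes "finite J" "\<And>j. j \<in> J \<Longrightarrow> B j \<in> sets M" "\<And>j. j \<in> J \<Longrightarrow> emeasure M (B j) \<le> ennreal (e j)"
    and "\<And>j. j \<in> J \<Longrightarrow> e j \<ge> 0" and "sum e J < measure M X"
  shows "\<exists>x\<in>X. \<forall>j\<in>J. x \<notin> B j"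
proof (rule ccontr)
  assume "\<not> ?thesis"
  then have "X \<subseteq> (\<Union>j\<in>J. B j)" by blast
  then have "emeasure M X \<le> emeasure M (\<Union>j\<in>J. B j)" using assms by (intro emeasure_mono) auto
  also have "\<dots> \<le> (\<Sum>j\<in>J. emeasure M (B j))" using assms by (intro emeasure_subadditive_finite) auto
  also have "\<dots> \<le> (\<Sum>j\<in>J. ennreal (e j))" using assms by (intro sum_mono) auto
  also have "\<dots> = ennreal (sum e J)" using assms by (intro sum_ennreal) auto
  finally have "emeasure M X \<le> ennreal (sum e J)" .
  moreover have "emeasure M X = ennreal (measure M X)"
    using finite_X by (intro emeasure_eq_ennreal_measure) auto
  ultimately show False using assms(5) sum_nonneg[of J e] assms(4) by (simp add: ennreal_le_iff)
qed

end

text \<open>The map is \<open>l \<mapsto> inv (\<beta> (inv l) x)\<close>, where \<beta> is the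
  cocycle with values in \<open>G\<close> and \<open>x\<close> avoids all events in which one step
  of the map or of its inverse is too long. Steps are then added up along words by
  \<open>bound_along_word\<close>.\<close>

lemma orbit_coupling_good_map:
  fixes G :: "('a, 'm) monoid_scheme" and H :: "('b, 'n) monoid_scheme"
    and r \<tau> e\<^sub>1 e\<^sub>2 :: real and k \<rho> :: nat
  assumes "orbit_coupling G H M a b X"
    and "finitely_generated_group G S" and "finitely_generated_group H T"
    and P: "finite P" "P \<subseteq> carrier H"
    and e: "e\<^sub>1 \<ge> 0" "e\<^sub>2 \<ge> 0"
    and tail\<^sub>1: "\<forall>t\<in>T. {y\<in>X. r < word_length G S (coupling_cocycle G b a X t y)} \<in> sets M \<and>
      emeasure M {y\<in>X. r < word_length G S (coupling_cocycle G b a X t y)} \<le> ennreal e\<^sub>1"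
    and tail\<^sub>2: "\<forall>s\<in>S. {y\<in>X. \<tau> < word_length H T (coupling_cocycle H a b X s y)} \<in> sets M \<and>
      emeasure M {y\<in>X. \<tau> < word_length H T (coupling_cocycle H a b X s y)} \<le> ennreal e\<^sub>2"
    and r: "r \<ge> 0" "\<tau> \<ge> 0"
    and small: "real (card P * (2 * card T + 1) ^ k * card T) * e\<^sub>1 +
      real (card P * (2 * card S + 1) ^ \<rho> * card S) * e\<^sub>2 < measure M X"
  shows "\<exists>f. f \<in> carrier H \<rightarrow> carrier G \<and>
    (\<forall>l\<in>P. \<forall>w\<in>carrier H. word_length H T w \<le> k \<longrightarrow>
       word_length G S (inv\<^bsub>G\<^esub> (f l) \<otimes>\<^bsub>G\<^esub> f (l \<otimes>\<^bsub>H\<^esub> w)) \<le> real k * r) \<and>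
    (\<forall>l\<in>P. \<forall>l'\<in>carrier H. word_length G S (inv\<^bsub>G\<^esub> (f l) \<otimes>\<^bsub>G\<^esub> f l') \<le> \<rho> \<longrightarrow>
       word_length H T (inv\<^bsub>H\<^esub> l \<otimes>\<^bsub>H\<^esub> l') \<le> real \<rho> * \<tau>)"
proof -
  interpret c: orbit_coupling G H M a b X by fact
  interpret d: orbit_coupling H G M b a X by (rule c.swap)
  interpret G: finitely_generated_group G S by fact
  interpret H: finitely_generated_group H T by fact
  let ?\<alpha> = "coupling_cocycle H a b X" and ?\<beta> = "coupling_cocycle G b a X"
  define BH where "BH = {u \<in> carrier H. H.wl u \<le> k}"
  define BG where "BG = {u \<in> carrier G. G.wl u \<le> \<rho>}"
  have BH: "finite BH" "card BH \<le> (2 * card T + 1) ^ k" using H.word_ball by (auto simp: BH_def)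
  have BG: "finite BG" "card BG \<le> (2 * card S + 1) ^ \<rho>" using G.word_ball by (auto simp: BG_def)
  define Y where "Y = (\<lambda>t. {y\<in>X. r < G.wl (?\<beta> t y)})"
  define Z where "Z = (\<lambda>s. {y\<in>X. \<tau> < H.wl (?\<alpha> s y)})"
  define B1 where "B1 = (\<lambda>(l, u, t). {x\<in>X. d.act (inv\<^bsub>H\<^esub> (l \<otimes>\<^bsub>H\<^esub> u \<otimes>\<^bsub>H\<^esub> t)) x \<in> Y t})"
  \<comment> \<open>The bad event for the inverse map at \<open>f l\<close> times \<open>u\<close>,
    described without \<open>f l\<close>, which depends on \<open>x\<close>. Moving \<open>x\<close>
    by \<open>inv l\<close> through \<open>H\<close> gives the same point as moving it by the
    inverse of \<open>f l\<close> through \<open>G\<close>, and from there only \<open>u\<close> and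
    \<open>s\<close> matter. Two applications of \<open>emeasure_act_preimage_le\<close> bound its
    measure.\<close>
  define B2 where "B2 = (\<lambda>(l, u, s). {x\<in>X. d.act (inv\<^bsub>H\<^esub> l) x \<in>
    {y\<in>X. c.act (inv\<^bsub>G\<^esub> (u \<otimes>\<^bsub>G\<^esub> s)) y \<in> Z s}})"
  define J where "J = (P \<times> BH \<times> T) <+> (P \<times> BG \<times> S)"
  define B where "B = case_sum B1 B2"
  define ee where "ee = case_sum (\<lambda>_::'b \<times> 'b \<times> 'b. e\<^sub>1) (\<lambda>_::'b \<times> 'a \<times> 'a. e\<^sub>2)"
  have Tc: "T \<subseteq> carrier H" and Sc: "S \<subseteq> carrier G" using H.S_carrier G.S_carrier by auto
  have b1: "B1 j \<in> sets M \<and> emeasure M (B1 j) \<le> ennreal e\<^sub>1" if "j \<in> P \<times> BH \<times> T" for j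
  proof -
    obtain l u t where j: "j = (l, u, t)" "l \<in> P" "u \<in> BH" "t \<in> T" using \<open>j \<in> _\<close> by auto
    have g: "inv\<^bsub>H\<^esub> (l \<otimes>\<^bsub>H\<^esub> u \<otimes>\<^bsub>H\<^esub> t) \<in> carrier H" using j P Tc by (auto simp: BH_def)
    have Y: "Y t \<in> sets M" "Y t \<subseteq> X" "emeasure M (Y t) \<le> ennreal e\<^sub>1" using tail\<^sub>1 j by (auto simp: Y_def)
    show ?thesis using d.emeasure_act_preimage_le[OF g Y(1,2)] Y(3) unfolding j B1_def by auto
  qed
  have b2: "B2 j \<in> sets M \<and> emeasure M (B2 j) \<le> ennreal e\<^sub>2" if "j \<in> P \<times> BG \<times> S" for j
  proof -
    obtain l u s where j: "j = (l, u, s)" "l \<in> P" "u \<in> BG" "s \<in> S" using \<open>j \<in> _\<close> by auto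
    have g: "inv\<^bsub>G\<^esub> (u \<otimes>\<^bsub>G\<^esub> s) \<in> carrier G" "inv\<^bsub>H\<^esub> l \<in> carrier H" using j P Sc by (auto simp: BG_def)
    have Z: "Z s \<in> sets M" "Z s \<subseteq> X" "emeasure M (Z s) \<le> ennreal e\<^sub>2" using tail\<^sub>2 j by (auto simp: Z_def)
    note z = c.emeasure_act_preimage_le[OF g(1) Z(1,2)]
    have sub: "{y\<in>X. c.act (inv\<^bsub>G\<^esub> (u \<otimes>\<^bsub>G\<^esub> s)) y \<in> Z s} \<subseteq> X" by auto
    show ?thesis using d.emeasure_act_preimage_le[OF g(2) z(1) sub] z(2) Z(3)
      unfolding j B2_def by (auto intro: order_trans)
  qed
  have finJ: "finite (P \<times> BH \<times> T)" "finite (P \<times> BG \<times> S)"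
    using P BH BG H.finite_S G.finite_S by auto
  have "sum ee J = (\<Sum>j\<in>P \<times> BH \<times> T. e\<^sub>1) + (\<Sum>j\<in>P \<times> BG \<times> S. e\<^sub>2)"
    unfolding J_def using finJ by (subst sum.Plus) (auto simp: ee_def)
  also have "\<dots> = real (card P * card BH * card T) * e\<^sub>1 + real (card P * card BG * card S) * e\<^sub>2"
    by (simp add: card_cartesian_product)
  also have "\<dots> \<le> real (card P * (2 * card T + 1) ^ k * card T) * e\<^sub>1 +
      real (card P * (2 * card S + 1) ^ \<rho> * card S) * e\<^sub>2"
    using BH BG e by (intro add_mono mult_right_mono) (simp_all add: mult_le_mono del: of_nat_mult)
  finally have "sum ee J < measure M X" using small by linarith
  then obtain x where x: "x \<in> X" "\<forall>j\<in>J. x \<notin> B j"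
    using c.avoid_bad_sets[of J B ee] b1 b2 finJ e unfolding J_def B_def ee_def by fastforce
  \<comment> \<open>By \<open>cocycle_increment\<close> the step of \<open>f\<close> from
    \<open>g\<close> to \<open>g\<close> times a generator is the value of the cocycle on that
    generator, at a translate of \<open>x\<close>. The map \<open>k'\<close> is built in the same
    way from the other cocycle and inverts \<open>f\<close>.\<close>
  define f where "f = (\<lambda>l. inv\<^bsub>G\<^esub> (?\<beta> (inv\<^bsub>H\<^esub> l) x))"
  define k' where "k' = (\<lambda>g. inv\<^bsub>H\<^esub> (?\<alpha> (inv\<^bsub>G\<^esub> g) x))"
  have f: "f l \<in> carrier G" if "l \<in> carrier H" for l using that d.cocycle_closed x by (simp add: f_def)
  have k': "k' g \<in> carrier H" if "g \<in> carrier G" for g using that c.cocycle_closed x by (simp add: k'_def)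
  have f_step: "G.wl (inv\<^bsub>G\<^esub> (f (l \<otimes>\<^bsub>H\<^esub> u)) \<otimes>\<^bsub>G\<^esub> f (l \<otimes>\<^bsub>H\<^esub> u \<otimes>\<^bsub>H\<^esub> t)) \<le> r"
    if "l \<in> P" "u \<in> BH" "t \<in> T" for l u t
  proof -
    have lc: "l \<otimes>\<^bsub>H\<^esub> u \<in> carrier H" "t \<in> carrier H" using that P Tc by (auto simp: BH_def)
    then have "inv\<^bsub>G\<^esub> (f (l \<otimes>\<^bsub>H\<^esub> u)) \<otimes>\<^bsub>G\<^esub> f (l \<otimes>\<^bsub>H\<^esub> u \<otimes>\<^bsub>H\<^esub> t) =
        ?\<beta> t (d.act (inv\<^bsub>H\<^esub> (l \<otimes>\<^bsub>H\<^esub> u \<otimes>\<^bsub>H\<^esub> t)) x)"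
      using d.cocycle_increment[OF lc x(1)] d.cocycle_closed x(1) by (simp add: f_def)
    moreover have "x \<notin> B1 (l, u, t)" using x(2) that by (force simp: J_def B_def)
    then have "d.act (inv\<^bsub>H\<^esub> (l \<otimes>\<^bsub>H\<^esub> u \<otimes>\<^bsub>H\<^esub> t)) x \<notin> Y t" using x(1) by (simp add: B1_def)
    then have "\<not> r < G.wl (?\<beta> t (d.act (inv\<^bsub>H\<^esub> (l \<otimes>\<^bsub>H\<^esub> u \<otimes>\<^bsub>H\<^esub> t)) x))"
      using d.act_closed[of "inv\<^bsub>H\<^esub> (l \<otimes>\<^bsub>H\<^esub> u \<otimes>\<^bsub>H\<^esub> t)" x] lc x(1) by (simp add: Y_def)
    ultimately show ?thesis by simp
  qed
  have f1: "G.wl (inv\<^bsub>G\<^esub> (f l) \<otimes>\<^bsub>G\<^esub> f (l \<otimes>\<^bsub>H\<^esub> w)) \<le> real k * r"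
    if l: "l \<in> P" and w: "w \<in> carrier H" "H.wl w \<le> k" for l w
  proof -
    have lc: "l \<in> carrier H" using l P by auto
    have "G.wl (inv\<^bsub>G\<^esub> (f l) \<otimes>\<^bsub>G\<^esub> f (l \<otimes>\<^bsub>H\<^esub> w)) \<le> real (H.wl w) * r"
    proof (rule H.bound_along_word[of "\<lambda>x y. real (G.wl (inv\<^bsub>G\<^esub> (f x) \<otimes>\<^bsub>G\<^esub> f y))" l k r, OF _ _ _ lc _ w])
      fix y z v assume "y \<in> carrier H" "z \<in> carrier H" "v \<in> carrier H"
      then show "real (G.wl (inv\<^bsub>G\<^esub> (f y) \<otimes>\<^bsub>G\<^esub> f v))
           \<le> real (G.wl (inv\<^bsub>G\<^esub> (f y) \<otimes>\<^bsub>G\<^esub> f z)) + real (G.wl (inv\<^bsub>G\<^esub> (f z) \<otimes>\<^bsub>G\<^esub> f v))"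
        using G.cayley.dv_triangle[of "f y" "f z" "f v"] f by simp
    next
      fix u s assume "u \<in> carrier H" "H.wl u \<le> k" "s \<in> T"
      then show "real (G.wl (inv\<^bsub>G\<^esub> (f (l \<otimes>\<^bsub>H\<^esub> u)) \<otimes>\<^bsub>G\<^esub> f (l \<otimes>\<^bsub>H\<^esub> u \<otimes>\<^bsub>H\<^esub> s))) \<le> r"
        using f_step[OF l, of u s] by (simp add: BH_def)
    qed (use f G.word_distance_sym in auto)
    also have "\<dots> \<le> real k * r" using w r by (intro mult_right_mono) auto
    finally show ?thesis .
  qed
  have f2: "H.wl (inv\<^bsub>H\<^esub> l \<otimes>\<^bsub>H\<^esub> l') \<le> real \<rho> * \<tau>"
    if l: "l \<in> P" and l': "l' \<in> carrier H" and w: "G.wl (inv\<^bsub>G\<^esub> (f l) \<otimes>\<^bsub>G\<^esub> f l') \<le> \<rho>" for l l'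
  proof -
    have lc: "l \<in> carrier H" using l P by auto
    have k'f: "k' (f m) = m" if "m \<in> carrier H" for m
      using d.cocycle_swap(1)[of "inv\<^bsub>H\<^esub> m" x] d.cocycle_closed[of "inv\<^bsub>H\<^esub> m" x] that x(1)
      by (simp add: k'_def f_def)
    let ?w = "inv\<^bsub>G\<^esub> (f l) \<otimes>\<^bsub>G\<^esub> f l'"
    have wc: "?w \<in> carrier G" and fw: "f l \<otimes>\<^bsub>G\<^esub> ?w = f l'"
      using f lc l' by (simp_all add: c.G.m_assoc[symmetric])
    have step: "H.wl (inv\<^bsub>H\<^esub> (k' (f l \<otimes>\<^bsub>G\<^esub> u)) \<otimes>\<^bsub>H\<^esub> k' (f l \<otimes>\<^bsub>G\<^esub> u \<otimes>\<^bsub>G\<^esub> s)) \<le> \<tau>"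
      if "u \<in> BG" "s \<in> S" for u s
    proof -
      have uc: "u \<in> carrier G" "s \<in> carrier G" "f l \<in> carrier G" using that Sc f lc by (auto simp: BG_def)
      let ?g = "inv\<^bsub>G\<^esub> (f l \<otimes>\<^bsub>G\<^esub> u \<otimes>\<^bsub>G\<^esub> s)"
      have incr: "inv\<^bsub>H\<^esub> (k' (f l \<otimes>\<^bsub>G\<^esub> u)) \<otimes>\<^bsub>H\<^esub> k' (f l \<otimes>\<^bsub>G\<^esub> u \<otimes>\<^bsub>G\<^esub> s) = ?\<alpha> s (c.act ?g x)"
        using c.cocycle_increment[of "f l \<otimes>\<^bsub>G\<^esub> u" s x] c.cocycle_closed x(1) uc by (simp add: k'_def)
      have "?g = inv\<^bsub>G\<^esub> (u \<otimes>\<^bsub>G\<^esub> s) \<otimes>\<^bsub>G\<^esub> inv\<^bsub>G\<^esub> (f l)"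
        using uc by (simp add: c.G.m_assoc c.G.inv_mult_group)
      then have "c.act ?g x = c.act (inv\<^bsub>G\<^esub> (u \<otimes>\<^bsub>G\<^esub> s)) (c.act (inv\<^bsub>G\<^esub> (f l)) x)"
        using c.cocycle_mult(2)[of "inv\<^bsub>G\<^esub> (u \<otimes>\<^bsub>G\<^esub> s)" "inv\<^bsub>G\<^esub> (f l)" x] uc x(1) by simp
      also have "c.act (inv\<^bsub>G\<^esub> (f l)) x = d.act (inv\<^bsub>H\<^esub> l) x"
        using d.cocycle_swap(2)[of "inv\<^bsub>H\<^esub> l" x] d.cocycle_closed[of "inv\<^bsub>H\<^esub> l" x] lc x(1) by (simp add: f_def)
      finally have act: "c.act ?g x = c.act (inv\<^bsub>G\<^esub> (u \<otimes>\<^bsub>G\<^esub> s)) (d.act (inv\<^bsub>H\<^esub> l) x)" .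
      have "x \<notin> B2 (l, u, s)" using x(2) l that by (force simp: J_def B_def)
      moreover have "d.act (inv\<^bsub>H\<^esub> l) x \<in> X" using d.act_closed lc x(1) by simp
      moreover from this have "c.act (inv\<^bsub>G\<^esub> (u \<otimes>\<^bsub>G\<^esub> s)) (d.act (inv\<^bsub>H\<^esub> l) x) \<in> X"
        using c.act_closed uc by simp
      ultimately have "\<not> \<tau> < H.wl (?\<alpha> s (c.act (inv\<^bsub>G\<^esub> (u \<otimes>\<^bsub>G\<^esub> s)) (d.act (inv\<^bsub>H\<^esub> l) x)))"
        using x(1) by (simp add: B2_def Z_def)
      then show ?thesis unfolding incr act by simp
    qed
    have "H.wl (inv\<^bsub>H\<^esub> (k' (f l)) \<otimes>\<^bsub>H\<^esub> k' (f l \<otimes>\<^bsub>G\<^esub> ?w)) \<le> real (G.wl ?w) * \<tau>"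
    proof (rule G.bound_along_word[of "\<lambda>x y. real (H.wl (inv\<^bsub>H\<^esub> (k' x) \<otimes>\<^bsub>H\<^esub> k' y))" "f l" \<rho> \<tau>, OF _ _ _ f[OF lc] _ wc w])
      fix y z v assume "y \<in> carrier G" "z \<in> carrier G" "v \<in> carrier G"
      then show "real (H.wl (inv\<^bsub>H\<^esub> (k' y) \<otimes>\<^bsub>H\<^esub> k' v))
           \<le> real (H.wl (inv\<^bsub>H\<^esub> (k' y) \<otimes>\<^bsub>H\<^esub> k' z)) + real (H.wl (inv\<^bsub>H\<^esub> (k' z) \<otimes>\<^bsub>H\<^esub> k' v))"
        using H.cayley.dv_triangle[of "k' y" "k' z" "k' v"] k' by simp
    next
      fix u s assume "u \<in> carrier G" "G.wl u \<le> \<rho>" "s \<in> S"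
      then show "real (H.wl (inv\<^bsub>H\<^esub> (k' (f l \<otimes>\<^bsub>G\<^esub> u)) \<otimes>\<^bsub>H\<^esub> k' (f l \<otimes>\<^bsub>G\<^esub> u \<otimes>\<^bsub>G\<^esub> s))) \<le> \<tau>"
        using step[of u s] by (simp add: BG_def)
    qed (use k' H.word_distance_sym in auto)
    also have "\<dots> \<le> real \<rho> * \<tau>" using w r by (intro mult_right_mono) auto
    finally show ?thesis using fw k'f lc l' by simp
  qed
  show ?thesis using f f1 f2 by (intro exI[of _ f]) auto
qed

lemma finite_family_bound:
  fixes F :: "'c \<Rightarrow> ennreal"
  assumes "finite J" "\<forall>j\<in>J. F j < \<infinity>"
  shows "\<exists>I::real. I \<ge> 0 \<and> (\<forall>j\<in>J. F j \<le> ennreal I)"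
proof -
  define I where "I = (\<Sum>j\<in>J. enn2real (F j))"
  have "F j \<le> ennreal I" if "j \<in> J" for j
  proof -
    have "F j = ennreal (enn2real (F j))" using assms(2) that by simp
    also have "\<dots> \<le> ennreal I" unfolding I_def
      by (intro ennreal_leI member_le_sum) (use assms that in auto)
    finally show ?thesis .
  qed
  moreover have "I \<ge> 0" by (simp add: I_def sum_nonneg)
  ultimately show ?thesis by blast
qed

text \<open>Here \<open>n * A\<close> counts events and \<open>I / Q\<close> is Markov's bound for
  each. Two families of bad sets receive a third of the measure \<open>m\<close> each, which leaves
  a positive rest. The summand 1 keeps \<open>Q\<close> positive when
  \<open>A * I = 0\<close>.\<close>

lemma union_bound_share:
  fixes A I m n Q :: real
  assumes "A \<ge> 0" "I \<ge> 0" "m > 0" "n > 0" "Q \<ge> (3 * A * I / m + 1) * n"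
  shows "n * A * (I / Q) \<le> m / 3"
proof -
  have pos: "3 * A * I / m + 1 > 0" using assms by (simp add: add_nonneg_pos)
  have Q: "Q > 0" using pos assms by (meson less_le_trans mult_pos_pos)
  have "3 * (n * A * I) \<le> n * (3 * A * I + m)" using assms by (simp add: algebra_simps)
  also have "\<dots> = m * ((3 * A * I / m + 1) * n)" using assms by (simp add: field_simps)
  also have "\<dots> \<le> m * Q" using assms by (intro mult_left_mono) auto
  finally show ?thesis using Q by (simp add: field_simps)
qed

text \<open>Lipschitz scale: by Markov's inequality, \<open>N\<close> edges of \<open>H\<close> are stretched by at most
  \<open>N powr (q / (q + 1))\<close>. Since balls of \<open>G\<close> grow at most exponentially, exponential
  integrability controls the inverse map on balls of that same radius \<open>R\<close>, at the price of a
  factor \<open>R powr (1 / p)\<close>.\<close>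

lemma good_maps_exist:
  fixes G :: "('a, 'm) monoid_scheme" and H :: "('b, 'n) monoid_scheme"
    and p q :: real and k :: nat
  assumes coupling: "orbit_coupling G H M a b X"
    and fgG: "finitely_generated_group G S" and fgH: "finitely_generated_group H T"
    and pq: "p > 0" "q > 0"
    and int: "integrable_coupling (\<lambda>t. exp (t powr p)) (\<lambda>t. t powr (1 + 1 / q)) G S H T M a b X X"
  shows "\<exists>C\<^sub>1\<ge>0. \<forall>C\<^sub>2\<ge>0. \<exists>C\<^sub>3\<ge>0. \<forall>N::nat. \<forall>P. 1 \<le> N \<longrightarrow> finite P \<longrightarrow> P \<subseteq> carrier H \<longrightarrow> card P \<le> N \<longrightarrow>
    (\<exists>f. f \<in> carrier H \<rightarrow> carrier G \<and>
      (\<forall>l\<in>P. \<forall>w\<in>carrier H. word_length H T w \<le> k \<longrightarrow>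
        word_length G S (inv\<^bsub>G\<^esub> (f l) \<otimes>\<^bsub>G\<^esub> f (l \<otimes>\<^bsub>H\<^esub> w)) \<le> C\<^sub>1 * N powr (q / (q + 1))) \<and>
      (\<forall>l\<in>P. \<forall>l'\<in>carrier H.
        word_length G S (inv\<^bsub>G\<^esub> (f l) \<otimes>\<^bsub>G\<^esub> f l') \<le> C\<^sub>2 * N powr (q / (q + 1)) \<longrightarrow>
        word_length H T (inv\<^bsub>H\<^esub> l \<otimes>\<^bsub>H\<^esub> l') \<le> C\<^sub>3 * N powr (q / (q + 1) * (1 + 1 / p))))"
proof -
  interpret c: orbit_coupling G H M a b X by fact
  interpret d: orbit_coupling H G M b a X by (rule c.swap)
  interpret G: finitely_generated_group G S by fact
  interpret H: finitely_generated_group H T by fact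
  let ?\<alpha> = "coupling_cocycle H a b X" and ?\<beta> = "coupling_cocycle G b a X"
  from int[unfolded integrable_coupling_def] obtain c where c: "c > 0"
    "\<forall>s\<in>S. (\<integral>\<^sup>+x\<in>X. ennreal (exp ((c * real (H.wl (?\<alpha> s x))) powr p)) \<partial>M) < \<infinity>"
    "\<forall>t\<in>T. (\<integral>\<^sup>+x\<in>X. ennreal ((c * real (G.wl (?\<beta> t x))) powr (1 + 1 / q)) \<partial>M) < \<infinity>"
    by (elim exE conjE) (rule that)
  from finite_family_bound[OF G.finite_S c(2)] obtain I\<^sub>2 where I\<^sub>2: "I\<^sub>2 \<ge> 0"
    "\<forall>s\<in>S. (\<integral>\<^sup>+x\<in>X. ennreal (exp ((c * real (H.wl (?\<alpha> s x))) powr p)) \<partial>M) \<le> ennreal I\<^sub>2"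
    by (elim exE conjE) (rule that)
  from finite_family_bound[OF H.finite_S c(3)] obtain I\<^sub>1 where I\<^sub>1: "I\<^sub>1 \<ge> 0"
    "\<forall>t\<in>T. (\<integral>\<^sup>+x\<in>X. ennreal ((c * real (G.wl (?\<beta> t x))) powr (1 + 1 / q)) \<partial>M) \<le> ennreal I\<^sub>1"
    by (elim exE conjE) (rule that)
  define m where "m = measure M X"
  have m: "m > 0"
    using c.X_positive c.finite_X by (simp add: m_def measure_def enn2real_positive_iff zero_less_iff_neq_zero)
  define \<theta> where "\<theta> = q / (q + 1)"
  have \<theta>: "\<theta> > 0" "\<theta> * (1 + 1 / q) = 1" 
  proof -
    have "1 + 1 / q = (q + 1) / q" using pq by (simp add: add_divide_distrib)
    then show "\<theta> > 0" "\<theta> * (1 + 1 / q) = 1" using pq by (simp_all add: \<theta>_def)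
  qed
  define A\<^sub>1 where "A\<^sub>1 = real ((2 * card T + 1) ^ k * card T)"
  \<comment> \<open>The constant required by \<open>union_bound_share\<close>. As
    \<open>\<theta> * (1 + 1 / q) = 1\<close>, the radius \<open>r = K * n powr \<theta>\<close>
    satisfies \<open>(c * r) powr (1 + 1 / q) = L * n\<close>.\<close>
  define L where "L = 3 * A\<^sub>1 * I\<^sub>1 / m + 1"
  have L: "L > 0" using I\<^sub>1 m by (simp add: L_def A\<^sub>1_def add_nonneg_pos)
  define K where "K = L powr \<theta> / c"
  have K: "K > 0" using L c by (simp add: K_def)
  define B where "B = real (2 * card S + 1)"
  define L' where "L' = 3 * real (card S) * I\<^sub>2 / m + 1"
  have L': "L' \<ge> 1" using I\<^sub>2 m by (simp add: L'_def)
  \<comment> \<open>The stretching constant \<open>k * K\<close> is fixed before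
    \<open>C\<^sub>2\<close>, because the application computes the radius on which the inverse is
    controlled from the stretching.\<close>
  have "\<exists>C\<^sub>3\<ge>0. \<forall>N::nat. \<forall>P. 1 \<le> N \<longrightarrow> finite P \<longrightarrow> P \<subseteq> carrier H \<longrightarrow> card P \<le> N \<longrightarrow>
    (\<exists>f. f \<in> carrier H \<rightarrow> carrier G \<and>
      (\<forall>l\<in>P. \<forall>w\<in>carrier H. word_length H T w \<le> k \<longrightarrow>
        word_length G S (inv\<^bsub>G\<^esub> (f l) \<otimes>\<^bsub>G\<^esub> f (l \<otimes>\<^bsub>H\<^esub> w)) \<le> real k * K * N powr \<theta>) \<and>
      (\<forall>l\<in>P. \<forall>l'\<in>carrier H.
        word_length G S (inv\<^bsub>G\<^esub> (f l) \<otimes>\<^bsub>G\<^esub> f l') \<le> C\<^sub>2 * N powr \<theta> \<longrightarrow>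
        word_length H T (inv\<^bsub>H\<^esub> l \<otimes>\<^bsub>H\<^esub> l') \<le> C\<^sub>3 * N powr (\<theta> * (1 + 1 / p))))"
    if C\<^sub>2: "C\<^sub>2 \<ge> 0" for C\<^sub>2 :: real
  proof -
    \<comment> \<open>The union bound for the inverse needs \<open>exp ((c * \<tau>) powr p)\<close>
      to be at least \<open>L' * (n * B ^ \<rho>)\<close>. Its logarithm is at most
      \<open>C\<^sub>4 * n powr \<theta>\<close>: the three summands account for \<open>L'\<close>,
      for \<open>n\<close> through \<open>ln n \<le> n powr \<theta> / \<theta>\<close>, and for the
      ball of radius \<rho>.\<close>
    define C\<^sub>4 where "C\<^sub>4 = ln L' + 1 / \<theta> + C\<^sub>2 * ln B"
    have lnB: "ln B \<ge> 0" by (simp add: B_def)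
    have C\<^sub>4: "C\<^sub>4 > 0" using L' \<theta> C\<^sub>2 lnB unfolding C\<^sub>4_def
      by (smt (verit) divide_pos_pos ln_ge_zero mult_nonneg_nonneg)
    define C\<^sub>3 where "C\<^sub>3 = C\<^sub>2 * (C\<^sub>4 powr (1 / p) / c)"
    have "\<exists>f. f \<in> carrier H \<rightarrow> carrier G \<and>
      (\<forall>l\<in>P. \<forall>w\<in>carrier H. word_length H T w \<le> k \<longrightarrow>
        word_length G S (inv\<^bsub>G\<^esub> (f l) \<otimes>\<^bsub>G\<^esub> f (l \<otimes>\<^bsub>H\<^esub> w)) \<le> real k * K * N powr \<theta>) \<and>
      (\<forall>l\<in>P. \<forall>l'\<in>carrier H.
        word_length G S (inv\<^bsub>G\<^esub> (f l) \<otimes>\<^bsub>G\<^esub> f l') \<le> C\<^sub>2 * N powr \<theta> \<longrightarrow>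
        word_length H T (inv\<^bsub>H\<^esub> l \<otimes>\<^bsub>H\<^esub> l') \<le> C\<^sub>3 * N powr (\<theta> * (1 + 1 / p)))"
      if N: "1 \<le> N" and P: "finite P" "P \<subseteq> carrier H" "card P \<le> N" for N :: nat and P
    proof -
      define n where "n = real N"
      have n: "n \<ge> 1" using N by (simp add: n_def)
      have n\<theta>: "n powr \<theta> \<ge> 1" using n \<theta> by (simp add: ge_one_powr_ge_zero)
      define r where "r = K * n powr \<theta>"
      define \<rho> where "\<rho> = nat \<lfloor>C\<^sub>2 * n powr \<theta>\<rfloor>"
      define \<tau> where "\<tau> = (C\<^sub>4 * n powr \<theta>) powr (1 / p) / c"
      have r: "r > 0" using K n by (simp add: r_def)
      have \<tau>: "\<tau> \<ge> 0" using c by (simp add: \<tau>_def)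
      have \<rho>: "real \<rho> \<le> C\<^sub>2 * n powr \<theta>" using C\<^sub>2 by (simp add: \<rho>_def)
      have cr: "(c * r) powr (1 + 1 / q) = L * n"
      proof -
        have "c * r = (L * n) powr \<theta>" using c L n by (simp add: r_def K_def powr_mult)
        then show ?thesis using \<theta> L n by (simp add: powr_powr)
      qed
      have c\<tau>: "(c * \<tau>) powr p = C\<^sub>4 * n powr \<theta>"
        using c pq C\<^sub>4 by (simp add: \<tau>_def powr_powr)
      define e\<^sub>1 where "e\<^sub>1 = I\<^sub>1 / (c * r) powr (1 + 1 / q)"
      define e\<^sub>2 where "e\<^sub>2 = I\<^sub>2 / exp ((c * \<tau>) powr p)"
      have e: "e\<^sub>1 \<ge> 0" "e\<^sub>2 \<ge> 0" using I\<^sub>1 I\<^sub>2 by (simp_all add: e\<^sub>1_def e\<^sub>2_def)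
      have t1: "\<forall>t\<in>T. {y\<in>X. r < G.wl (?\<beta> t y)} \<in> sets M \<and> emeasure M {y\<in>X. r < G.wl (?\<beta> t y)} \<le> ennreal e\<^sub>1"
      proof
        fix t assume that: "t \<in> T"
        have tc: "t \<in> carrier H" using that H.S_carrier by auto
        have mono: "(c * r) powr (1 + 1 / q) \<le> (c * real (G.wl h)) powr (1 + 1 / q)"
          if "r < real (G.wl h)" for h
          using that r c pq by (intro powr_mono2) auto
        have pos: "(c * r) powr (1 + 1 / q) > 0" using r c by simp
        show "{y\<in>X. r < G.wl (?\<beta> t y)} \<in> sets M \<and> emeasure M {y\<in>X. r < G.wl (?\<beta> t y)} \<le> ennreal e\<^sub>1" unfolding e\<^sub>1_def
          using d.cocycle_tail_bound[where len = "\<lambda>g. real (G.wl g)" and \<phi> = "\<lambda>t. t powr (1 + 1 / q)",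
              OF tc mono pos I\<^sub>1(1) bspec[OF I\<^sub>1(2) that]] by blast
      qed
      have t2: "\<forall>s\<in>S. {y\<in>X. \<tau> < H.wl (?\<alpha> s y)} \<in> sets M \<and> emeasure M {y\<in>X. \<tau> < H.wl (?\<alpha> s y)} \<le> ennreal e\<^sub>2"
      proof
        fix s assume that: "s \<in> S"
        have sc: "s \<in> carrier G" using that G.S_carrier by auto
        have mono: "exp ((c * \<tau>) powr p) \<le> exp ((c * real (H.wl h)) powr p)"
          if "\<tau> < real (H.wl h)" for h
          using that \<tau> c pq by (simp, intro powr_mono2) auto
        have pos: "exp ((c * \<tau>) powr p) > 0" by simp
        show "{y\<in>X. \<tau> < H.wl (?\<alpha> s y)} \<in> sets M \<and> emeasure M {y\<in>X. \<tau> < H.wl (?\<alpha> s y)} \<le> ennreal e\<^sub>2" unfolding e\<^sub>2_def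
          using c.cocycle_tail_bound[where len = "\<lambda>g. real (H.wl g)" and \<phi> = "\<lambda>t. exp (t powr p)",
              OF sc mono pos I\<^sub>2(1) bspec[OF I\<^sub>2(2) that]] by blast
      qed
      have share1: "n * A\<^sub>1 * e\<^sub>1 \<le> m / 3"
        unfolding e\<^sub>1_def by (rule union_bound_share) (use I\<^sub>1 m n cr in \<open>auto simp: A\<^sub>1_def L_def\<close>)
      have share2: "(n * B ^ \<rho>) * card S * e\<^sub>2 \<le> m / 3"
      proof -
        have "ln n \<le> n powr \<theta> / \<theta>" using ln_powr_bound n \<theta> by blast
        moreover have "ln L' \<le> ln L' * n powr \<theta>" using L' n\<theta> by (simp add: mult_le_cancel_left1)
        moreover have "real \<rho> * ln B \<le> C\<^sub>2 * n powr \<theta> * ln B" using \<rho> lnB by (rule mult_right_mono)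
        ultimately have "ln L' + (ln n + real \<rho> * ln B) \<le> C\<^sub>4 * n powr \<theta>"
          by (simp add: C\<^sub>4_def algebra_simps)
        then have "exp (ln L' + (ln n + real \<rho> * ln B)) \<le> exp ((c * \<tau>) powr p)" by (simp add: c\<tau>)
        moreover have "exp (ln L' + (ln n + real \<rho> * ln B)) = L' * (n * B ^ \<rho>)"
          using L' n by (simp add: exp_add B_def exp_of_nat_mult)
        ultimately have "L' * (n * B ^ \<rho>) \<le> exp ((c * \<tau>) powr p)" by simp
        then show ?thesis unfolding e\<^sub>2_def
          by (intro union_bound_share) (use I\<^sub>2 m n in \<open>auto simp: B_def L'_def\<close>)
      qed
      have small: "real (card P * (2 * card T + 1) ^ k * card T) * e\<^sub>1 +
          real (card P * (2 * card S + 1) ^ \<rho> * card S) * e\<^sub>2 < measure M X"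
      proof -
        have "real (card P * (2 * card T + 1) ^ k * card T) * e\<^sub>1 = real (card P) * A\<^sub>1 * e\<^sub>1"
          by (simp add: A\<^sub>1_def mult.assoc)
        also have "\<dots> \<le> n * A\<^sub>1 * e\<^sub>1"
          using P e by (intro mult_right_mono) (auto simp: n_def A\<^sub>1_def)
        finally have 1: "real (card P * (2 * card T + 1) ^ k * card T) * e\<^sub>1 \<le> m / 3" using share1 by linarith
        have "real (card P * (2 * card S + 1) ^ \<rho> * card S) * e\<^sub>2 = real (card P) * B ^ \<rho> * card S * e\<^sub>2"
          by (simp add: B_def)
        also have "\<dots> \<le> n * B ^ \<rho> * card S * e\<^sub>2"
          using P e by (intro mult_right_mono) (auto simp: n_def B_def)
        finally show ?thesis using 1 share2 m m_def by linarith
      qed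
      from orbit_coupling_good_map[OF coupling fgG fgH P(1,2) e t1 t2 less_imp_le[OF r] \<tau> small]
      obtain f where f: "f \<in> carrier H \<rightarrow> carrier G"
        "\<forall>l\<in>P. \<forall>w\<in>carrier H. H.wl w \<le> k \<longrightarrow>
           G.wl (inv\<^bsub>G\<^esub> (f l) \<otimes>\<^bsub>G\<^esub> f (l \<otimes>\<^bsub>H\<^esub> w)) \<le> real k * r"
        "\<forall>l\<in>P. \<forall>l'\<in>carrier H. G.wl (inv\<^bsub>G\<^esub> (f l) \<otimes>\<^bsub>G\<^esub> f l') \<le> \<rho> \<longrightarrow>
           H.wl (inv\<^bsub>H\<^esub> l \<otimes>\<^bsub>H\<^esub> l') \<le> real \<rho> * \<tau>"
        by (elim exE conjE) (rule that)
      have "H.wl (inv\<^bsub>H\<^esub> l \<otimes>\<^bsub>H\<^esub> l') \<le> C\<^sub>3 * n powr (\<theta> * (1 + 1 / p))"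
        if l: "l \<in> P" "l' \<in> carrier H" "G.wl (inv\<^bsub>G\<^esub> (f l) \<otimes>\<^bsub>G\<^esub> f l') \<le> C\<^sub>2 * n powr \<theta>" for l l'
      proof -
        have "G.wl (inv\<^bsub>G\<^esub> (f l) \<otimes>\<^bsub>G\<^esub> f l') \<le> \<rho>" using l(3) unfolding \<rho>_def by (rule le_nat_floor)
        then have "H.wl (inv\<^bsub>H\<^esub> l \<otimes>\<^bsub>H\<^esub> l') \<le> real \<rho> * \<tau>" using f(3) l by blast
        also have "\<dots> \<le> (C\<^sub>2 * n powr \<theta>) * \<tau>" using \<rho> \<tau> by (rule mult_right_mono)
        also have "\<tau> = C\<^sub>4 powr (1 / p) / c * n powr (\<theta> / p)"
          using C\<^sub>4 by (simp add: \<tau>_def powr_mult powr_powr)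
        also have "(C\<^sub>2 * n powr \<theta>) * (C\<^sub>4 powr (1 / p) / c * n powr (\<theta> / p)) = C\<^sub>3 * (n powr \<theta> * n powr (\<theta> / p))"
          by (simp add: C\<^sub>3_def)
        also have "n powr \<theta> * n powr (\<theta> / p) = n powr (\<theta> * (1 + 1 / p))"
          by (simp add: powr_add[symmetric] algebra_simps)
        finally show ?thesis .
      qed
      then show ?thesis using f unfolding n_def r_def by (intro exI[of _ f]) (auto simp: mult.assoc)
    qed
    moreover have "C\<^sub>3 \<ge> 0" using C\<^sub>2 c by (simp add: C\<^sub>3_def)
    ultimately show ?thesis by blast
  qed
  moreover have "real k * K \<ge> 0" using K by simp
  ultimately show ?thesis unfolding \<theta>_def by blast
qed

section \<open>Transfer of hyperbolicity\<close>

lemma discrete_crossing: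
  fixes T :: "nat \<Rightarrow> real"
  assumes "T 0 \<le> t" "t \<le> T m" "\<And>j. j < m \<Longrightarrow> \<bar>T j - T (Suc j)\<bar> \<le> E" "E \<ge> 0"
  shows "\<exists>j\<le>m. \<bar>T j - t\<bar> \<le> E"
proof -
  define j where "j = (LEAST j. t \<le> T j)"
  have j: "t \<le> T j" "j \<le> m" unfolding j_def using assms(2) by (auto intro: LeastI Least_le)
  show ?thesis
  proof (cases j)
    case 0
    then show ?thesis using j assms(1,4) by (intro exI[of _ 0]) auto
  next
    case (Suc i)
    have "\<not> t \<le> T i" using Suc not_less_Least[of i "\<lambda>j. t \<le> T j"] unfolding j_def by auto
    moreover have "\<bar>T i - T j\<bar> \<le> E" using assms(3)[of i] j Suc by auto
    ultimately show ?thesis using j by (intro exI[of _ j]) auto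
  qed
qed

text \<open>Moving along a geodesic between the images of the endpoints, one stays close to the images
  of both paths; as close image points have close preimages, the traced positions on the
  geodesic segment cannot jump, so they come near every one of its points.\<close>

lemma geodesic_near_path_via_map:
  assumes "Metric_space X d" and Y: "geodesic_space Y e" "delta_hyperbolic \<delta> Y e" "\<delta> \<ge> 0"
    and seg: "c 0 = x" "c (d x y) = y" "c ` {0..d x y} \<subseteq> X"
      "\<And>s t. s \<in> {0..d x y} \<Longrightarrow> t \<in> {0..d x y} \<Longrightarrow> d (c s) (c t) = \<bar>s - t\<bar>"
    and path: "w 0 = x" "w n = y" "\<And>i. i \<le> n \<Longrightarrow> w i \<in> X" "\<And>i. i < n \<Longrightarrow> d (w i) (w (Suc i)) \<le> 1"
    and Q: "Q = (\<lambda>i. c (min (real i) (d x y))) ` {..n} \<union> w ` {..n}"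
    and F: "\<And>u. u \<in> Q \<Longrightarrow> F u \<in> Y"
      "\<And>u v. u \<in> Q \<Longrightarrow> v \<in> Q \<Longrightarrow> d u v \<le> 1 \<Longrightarrow> e (F u) (F v) \<le> r"
      "\<And>u v. u \<in> Q \<Longrightarrow> v \<in> Q \<Longrightarrow> e (F u) (F v) \<le> 2 * R + 1 \<Longrightarrow> d u v \<le> E"
    and R: "n \<le> 2 ^ k" "r \<ge> 0" "\<delta> * real k + r \<le> R"
    and t: "t \<in> {0..d x y}"
  shows "\<exists>i\<le>n. d (c t) (w i) \<le> 2 * E"
proof -
  interpret X: Metric_space X d by fact
  interpret Y: Metric_space Y e using Y by (simp add: geodesic_space_def)
  define D where "D = d x y"
  have D: "D \<ge> 0" by (simp add: D_def)
  \<comment> \<open>Sampling at integers and stopping at \<open>D\<close> gives steps of length at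
    most 1 and reaches \<open>y\<close> by index \<open>n\<close>, as \<open>D \<le> n\<close>. Both
    paths thus have \<open>n\<close> steps and the same bisection depth \<open>k\<close>.\<close>
  define v where "v = (\<lambda>i. c (min (real i) D))"
  have vd: "d (v i) (v j) = \<bar>min (real i) D - min (real j) D\<bar>" for i j
    unfolding v_def by (rule seg(4)) (use D in \<open>auto simp: D_def\<close>)
  have "d (w 0) (w i) \<le> real i" if "i \<le> n" for i
    using that
  proof (induction i)
    case 0
    then show ?case using path by auto
  next
    case (Suc i)
    then have "d (w 0) (w (Suc i)) \<le> d (w 0) (w i) + d (w i) (w (Suc i))"
      using path by (intro X.triangle) auto
    then show ?case using Suc path(4)[of i] by auto
  qed
  then have Dn: "D \<le> n" using path unfolding D_def by blast
  have v0: "v 0 = x" and vn: "v n = y" using seg D Dn by (auto simp: v_def D_def min_def)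
  have vQ: "v i \<in> Q" and wQ: "w i \<in> Q" if "i \<le> n" for i
    using that by (auto simp: Q v_def D_def)
  have vX: "v i \<in> X" for i using seg(3) D by (auto simp: v_def D_def)
  have xQ: "x \<in> Q" "y \<in> Q" using vQ[of 0] vQ[of n] v0 vn by auto
  have R0: "R \<ge> 0" using R Y(3) by (smt (verit) mult_nonneg_nonneg of_nat_0_le_iff)
  have "e (F x) (F x) = 0" using F(1) xQ by simp
  then have "d x x \<le> E" using F(3)[OF xQ(1) xQ(1)] R0 by simp
  then have E0: "E \<ge> 0" using X.nonneg order_trans by blast
  obtain B where B: "geodesic_segment Y e (F x) (F y) B"
    using Y(1) F(1) xQ unfolding geodesic_space_def by blast
  define D' where "D' = e (F x) (F y)"
  obtain g where g: "g ` {0..D'} = B" "B \<subseteq> Y" "g 0 = F x" "g D' = F y"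
    "\<And>s t. s \<in> {0..D'} \<Longrightarrow> t \<in> {0..D'} \<Longrightarrow> e (g s) (g t) = \<bar>s - t\<bar>"
    using Y.seg_param[OF B] unfolding D'_def by metis
  have D': "D' \<ge> 0" by (simp add: D'_def)
  \<comment> \<open>\<open>Suc\<close> keeps \<open>m\<close> positive even for
    \<open>D' = 0\<close>, so that the prescribed values \<open>I 0 = 0\<close> and
    \<open>I m = n\<close> do not clash.\<close>
  define m where "m = Suc (nat \<lceil>D'\<rceil>)"
  define h where "h = (\<lambda>j. g (min (real j) D'))"
  have hB: "h j \<in> B" for j using g(1) D' by (auto simp: h_def)
  have hY: "h j \<in> Y" for j using hB g(2) by auto
  have "D' \<le> m" unfolding m_def by linarith
  then have h0: "h 0 = F x" and hm: "h m = F y" using g D' by (auto simp: h_def min_def)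
  have hd: "e (h j) (h (Suc j)) \<le> 1" for j
    using g(5)[of "min (real j) D'" "min (real (Suc j)) D'"] D' by (auto simp: h_def)
  have nearv: "\<exists>i\<le>n. e (h j) (F (v i)) \<le> R" for j
  proof -
    have "\<exists>i\<le>n. e (h j) (F (v i)) \<le> \<delta> * real k + r"
    proof (rule Y.hyperbolic_geodesic_near_path[OF Y R(1)])
      show "e (F (v i)) (F (v (Suc i))) \<le> r" if "i < n" for i
        using that vd[of i "Suc i"] by (intro F(2) vQ) auto
    qed (use F(1) vQ R B hB v0 vn in auto)
    then show ?thesis using R(3) by fastforce
  qed
  have nearw: "\<exists>i\<le>n. e (h j) (F (w i)) \<le> R" for j
  proof -
    have "\<exists>i\<le>n. e (h j) (F (w i)) \<le> \<delta> * real k + r"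
    proof (rule Y.hyperbolic_geodesic_near_path[OF Y R(1)])
      show "e (F (w i)) (F (w (Suc i))) \<le> r" if "i < n" for i
        using that path(4) by (intro F(2) wQ) auto
    qed (use F(1) wQ R B hB path in auto)
    then show ?thesis using R(3) by fastforce
  qed
  \<comment> \<open>The ends may be prescribed because \<open>h 0\<close> and \<open>h m\<close> are
    exactly the images of \<open>x\<close> and \<open>y\<close>. The traced positions then run from
    0 to \<open>D\<close>, as \<open>discrete_crossing\<close> requires.\<close>
  have "\<exists>I. (\<forall>j. I j \<le> n \<and> e (h j) (F (v (I j))) \<le> R) \<and> I 0 = 0 \<and> I m = n"
  proof -
    obtain I where I: "\<And>j. I j \<le> n \<and> e (h j) (F (v (I j))) \<le> R" using nearv by metis
    define I' where "I' = (\<lambda>j. if j = 0 then 0 else if j = m then n else I j)"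
    have "I' j \<le> n \<and> e (h j) (F (v (I' j))) \<le> R" for j
      using I[of j] h0 hm v0 vn R0 F(1) xQ by (auto simp: I'_def)
    then show ?thesis by (intro exI[of _ I']) (auto simp: I'_def m_def)
  qed
  then obtain I where I: "\<And>j. I j \<le> n" "\<And>j. e (h j) (F (v (I j))) \<le> R" "I 0 = 0" "I m = n" by blast
  have FY: "F (v (I j)) \<in> Y" for j using F(1) vQ I by blast
  \<comment> \<open>The images are within \<open>R\<close> of consecutive points \<open>h j\<close>,
    which are at most 1 apart; this is the origin of \<open>2 * R + 1\<close>.\<close>
  have step: "d (v (I j)) (v (I (Suc j))) \<le> E" for j
  proof -
    have "e (F (v (I j))) (F (v (I (Suc j)))) \<le> e (F (v (I j))) (h j) + e (h j) (F (v (I (Suc j))))"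
      "e (h j) (F (v (I (Suc j)))) \<le> e (h j) (h (Suc j)) + e (h (Suc j)) (F (v (I (Suc j))))"
      using Y.triangle FY hY by auto
    then have "e (F (v (I j))) (F (v (I (Suc j)))) \<le> 2 * R + 1"
      using I(2)[of j] I(2)[of "Suc j"] hd[of j] Y.commute[of "h j" "F (v (I j))"] by linarith
    then show ?thesis using F(3) vQ I(1) by blast
  qed
  have "\<exists>j\<le>m. \<bar>min (real (I j)) D - t\<bar> \<le> E"
    by (rule discrete_crossing) (use I(3,4) Dn D t E0 step vd in \<open>auto simp: D_def\<close>)
  then obtain j where j: "\<bar>min (real (I j)) D - t\<bar> \<le> E" by blast
  obtain i where i: "i \<le> n" "e (h j) (F (w i)) \<le> R" using nearw by blast
  have "e (F (v (I j))) (F (w i)) \<le> e (F (v (I j))) (h j) + e (h j) (F (w i))"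
    using FY hY F(1)[OF wQ[OF i(1)]] by (intro Y.triangle) auto
  then have "e (F (v (I j))) (F (w i)) \<le> 2 * R + 1"
    using I(2)[of j] i Y.commute[of "h j" "F (v (I j))"] by linarith
  then have vw: "d (v (I j)) (w i) \<le> E" using F(3) vQ wQ I(1) i by blast
  have "d (c t) (v (I j)) = \<bar>t - min (real (I j)) D\<bar>"
    unfolding v_def by (rule seg(4)) (use t D in \<open>auto simp: D_def\<close>)
  moreover have "d (c t) (w i) \<le> d (c t) (v (I j)) + d (v (I j)) (w i)"
    using seg(3) t vX path(3)[OF i(1)] by (intro X.triangle) auto
  ultimately show ?thesis using j vw i by (intro exI[of _ i]) auto
qed

text \<open>Hyperbolicity of \<open>G\<close> comes with a generating set \<open>S'\<close> and
  integrability with \<open>S\<close>, so word lengths are converted by factors \<open>L\<close> and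
  \<open>L'\<close>. Points of the realization of \<open>H\<close> are rounded to vertices, at an
  additive cost of 2 per distance.\<close>

lemma orbit_coupling_detour_bound:
  fixes G :: "('a, 'm) monoid_scheme" and H :: "('b, 'n) monoid_scheme" and T :: "'b set" and p q :: real
  defines "\<theta> \<equiv> q / (q + 1)"
  defines "XH \<equiv> graph_realization (carrier H) (cayley_edges H T)"
    and "dH \<equiv> path_metric (cayley_edges H T)"
  assumes coupling: "orbit_coupling G H M a b X"
    and fgG: "finitely_generated_group G S" and fgH: "finitely_generated_group H T"
    and fgG': "finitely_generated_group G S'"
    and hyp: "hyperbolic_space (graph_realization (carrier G) (cayley_edges G S')) (path_metric (cayley_edges G S'))"
    and pq: "p > 0" "q > 0"
    and int: "integrable_coupling (\<lambda>t. exp (t powr p)) (\<lambda>t. t powr (1 + 1 / q)) G S H T M a b X X"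
  shows "\<exists>C. \<forall>x y A z W n. geodesic_segment XH dH x y A \<longrightarrow> z \<in> A \<longrightarrow> W \<subseteq> XH \<longrightarrow> chain dH W n x y \<longrightarrow>
    (\<exists>w\<in>W. dH z w \<le> C * (2 * real n + 2) powr (\<theta> * (1 + 1 / p)))"
proof -
  interpret c: orbit_coupling G H M a b X by fact
  interpret G: finitely_generated_group G S by fact
  interpret G': finitely_generated_group G S' by fact
  interpret H: finitely_generated_group H T by fact
  let ?XG = "graph_realization (carrier G) (cayley_edges G S')"
  let ?dG = "path_metric (cayley_edges G S')"
  interpret X: Metric_space XH dH unfolding XH_def dH_def by (rule H.cayley.Metric_space_realization)
  obtain \<delta> where Y: "geodesic_space ?XG ?dG" "delta_hyperbolic \<delta> ?XG ?dG" "\<delta> \<ge> 0"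
    using hyp unfolding hyperbolic_space_def by blast
  obtain L where L: "\<And>g. g \<in> carrier G \<Longrightarrow> G'.wl g \<le> L * G.wl g"
    using G'.word_length_comparison[OF G.generating] by blast
  obtain L' where L': "\<And>g. g \<in> carrier G \<Longrightarrow> G.wl g \<le> L' * G'.wl g"
    using G.word_length_comparison[OF G'.generating] by blast
  have \<theta>: "\<theta> > 0" using pq by (simp add: \<theta>_def)
  define \<theta>' where "\<theta>' = \<theta> * (1 + 1 / p)"
  have \<theta>': "\<theta>' > 0" using \<theta> pq by (simp add: \<theta>'_def add_pos_pos)
  \<comment> \<open>Radius 3: points at distance at most 1 are rounded to vertices at distance at
    most \<open>1 + 2\<close>.\<close>
  obtain C\<^sub>1 where C\<^sub>1: "C\<^sub>1 \<ge> 0" and good: "\<forall>C\<^sub>2\<ge>0. \<exists>C\<^sub>3\<ge>0. \<forall>N::nat. \<forall>P. 1 \<le> N \<longrightarrow> finite P \<longrightarrow> P \<subseteq> carrier H \<longrightarrow> card P \<le> N \<longrightarrow>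
    (\<exists>f. f \<in> carrier H \<rightarrow> carrier G \<and>
      (\<forall>l\<in>P. \<forall>w\<in>carrier H. H.wl w \<le> 3 \<longrightarrow>
        G.wl (inv\<^bsub>G\<^esub> (f l) \<otimes>\<^bsub>G\<^esub> f (l \<otimes>\<^bsub>H\<^esub> w)) \<le> C\<^sub>1 * N powr \<theta>) \<and>
      (\<forall>l\<in>P. \<forall>l'\<in>carrier H.
        G.wl (inv\<^bsub>G\<^esub> (f l) \<otimes>\<^bsub>G\<^esub> f l') \<le> C\<^sub>2 * N powr \<theta> \<longrightarrow>
        H.wl (inv\<^bsub>H\<^esub> l \<otimes>\<^bsub>H\<^esub> l') \<le> C\<^sub>3 * N powr \<theta>'))"
    using good_maps_exist[OF coupling fgG fgH pq int, of 3, folded \<theta>_def, folded \<theta>'_def] by (elim exE conjE) (rule that)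
  \<comment> \<open>The bisection depth \<open>k\<close>, at most \<open>ln N / ln 2 + 1\<close>, is
    bounded by \<open>\<kappa> * N powr \<theta>\<close>, again by
    \<open>ln N \<le> N powr \<theta> / \<theta>\<close>. So \<open>\<rho> * N powr \<theta>\<close>
    absorbs both the logarithmic error and the jump size.\<close>
  define \<kappa> where "\<kappa> = 1 / (\<theta> * ln 2) + 1"
  define \<rho> where "\<rho> = \<delta> * \<kappa> + L * C\<^sub>1"
  have \<rho>: "\<rho> \<ge> 0" using Y(3) \<theta> C\<^sub>1 by (simp add: \<rho>_def \<kappa>_def)
  then have nonneg: "L' * (2 * \<rho> + 1) \<ge> 0" by simp
  from good[THEN spec, THEN mp, OF nonneg] obtain C\<^sub>3 where C\<^sub>3: "C\<^sub>3 \<ge> 0" and good': "\<forall>N::nat. \<forall>P. 1 \<le> N \<longrightarrow> finite P \<longrightarrow> P \<subseteq> carrier H \<longrightarrow> card P \<le> N \<longrightarrow>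
    (\<exists>f. f \<in> carrier H \<rightarrow> carrier G \<and>
      (\<forall>l\<in>P. \<forall>w\<in>carrier H. H.wl w \<le> 3 \<longrightarrow>
        G.wl (inv\<^bsub>G\<^esub> (f l) \<otimes>\<^bsub>G\<^esub> f (l \<otimes>\<^bsub>H\<^esub> w)) \<le> C\<^sub>1 * N powr \<theta>) \<and>
      (\<forall>l\<in>P. \<forall>l'\<in>carrier H.
        G.wl (inv\<^bsub>G\<^esub> (f l) \<otimes>\<^bsub>G\<^esub> f l') \<le> L' * (2 * \<rho> + 1) * N powr \<theta> \<longrightarrow>
        H.wl (inv\<^bsub>H\<^esub> l \<otimes>\<^bsub>H\<^esub> l') \<le> C\<^sub>3 * N powr \<theta>'))"
    by (elim exE conjE) (rule that)
  define vt where "vt = (\<lambda>x. SOME v. v \<in> carrier H \<and> dH x (vertex_point v) \<le> 1)"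
  have vt: "vt x \<in> carrier H" "dH x (vertex_point (vt x)) \<le> 1" if "x \<in> XH" for x
    using someI_ex[of "\<lambda>v. v \<in> carrier H \<and> dH x (vertex_point v) \<le> 1"] H.cayley.near_vertex[of x] that
    unfolding vt_def XH_def dH_def by blast+
  have vtX: "vertex_point v \<in> XH" if "v \<in> carrier H" for v
    using H.cayley.vertex_in_X that by (simp add: XH_def)
  have dv: "dH (vertex_point u) (vertex_point v) = H.wl (inv\<^bsub>H\<^esub> u \<otimes>\<^bsub>H\<^esub> v)"
    if "u \<in> carrier H" "v \<in> carrier H" for u v
    using H.cayley.path_metric_vertices that by (simp add: dH_def)
  have close: "\<bar>dH u v - H.wl (inv\<^bsub>H\<^esub> (vt u) \<otimes>\<^bsub>H\<^esub> vt v)\<bar> \<le> 2" if uv: "u \<in> XH" "v \<in> XH" for u v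
  proof -
    let ?u = "vertex_point (vt u)" and ?v = "vertex_point (vt v)"
    have V: "?u \<in> XH" "?v \<in> XH" using vt vtX uv by auto
    have "dH u v \<le> dH u ?u + dH ?u v" "dH ?u v \<le> dH ?u ?v + dH ?v v"
      "dH ?u ?v \<le> dH ?u u + dH u ?v" "dH u ?v \<le> dH u v + dH v ?v"
      using X.triangle V uv by auto
    then show ?thesis
      using dv[OF vt(1)[OF uv(1)] vt(1)[OF uv(2)]] vt(2)[OF uv(1)] vt(2)[OF uv(2)]
        X.commute[of u ?u] X.commute[of v ?v] by linarith
  qed
  have main: "\<exists>w\<in>W. dH z w \<le> 2 * (C\<^sub>3 + 2) * (2 * real n + 2) powr \<theta>'"
    if A: "geodesic_segment XH dH x y A" "z \<in> A" and W: "W \<subseteq> XH" "chain dH W n x y" for x y A z W n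
  proof -
    obtain c where c: "c ` {0..dH x y} = A" "A \<subseteq> XH" "c 0 = x" "c (dH x y) = y"
      "\<And>s t. s \<in> {0..dH x y} \<Longrightarrow> t \<in> {0..dH x y} \<Longrightarrow> dH (c s) (c t) = \<bar>s - t\<bar>"
      using X.seg_param[OF A(1)] by metis
    obtain t where t: "t \<in> {0..dH x y}" "z = c t" using c(1) A(2) by blast
    obtain w where w: "w 0 = x" "w n = y" "\<forall>i\<le>n. w i \<in> W" "\<forall>i<n. dH (w i) (w (Suc i)) \<le> 1"
      using W(2) unfolding chain_def by blast
    define Q where "Q = (\<lambda>i. c (min (real i) (dH x y))) ` {..n} \<union> w ` {..n}"
    have QX: "Q \<subseteq> XH" using c(1,2) w(3) W(1) by (auto simp: Q_def)
    have finQ: "finite Q" by (simp add: Q_def)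
    have cardQ: "card Q \<le> 2 * n + 2"
    proof -
      have "card Q \<le> card {..n} + card {..n}"
        unfolding Q_def by (intro order_trans[OF card_Un_le] add_mono card_image_le) auto
      then show ?thesis by simp
    qed
    \<comment> \<open>At most \<open>n + 1\<close> sample points on the geodesic and
      \<open>n + 1\<close> on the chain.\<close>
    define N where "N = 2 * n + 2"
    have "card (vt ` Q) \<le> N" using card_image_le[OF finQ, of vt] cardQ by (simp add: N_def)
    moreover have "vt ` Q \<subseteq> carrier H" using vt QX by auto
    ultimately have "\<exists>f. f \<in> carrier H \<rightarrow> carrier G \<and>
      (\<forall>l\<in>vt ` Q. \<forall>w\<in>carrier H. H.wl w \<le> 3 \<longrightarrow>
        G.wl (inv\<^bsub>G\<^esub> (f l) \<otimes>\<^bsub>G\<^esub> f (l \<otimes>\<^bsub>H\<^esub> w)) \<le> C\<^sub>1 * N powr \<theta>) \<and>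
      (\<forall>l\<in>vt ` Q. \<forall>l'\<in>carrier H.
        G.wl (inv\<^bsub>G\<^esub> (f l) \<otimes>\<^bsub>G\<^esub> f l') \<le> L' * (2 * \<rho> + 1) * N powr \<theta> \<longrightarrow>
        H.wl (inv\<^bsub>H\<^esub> l \<otimes>\<^bsub>H\<^esub> l') \<le> C\<^sub>3 * N powr \<theta>')"
      using finQ by (intro good'[rule_format]) (auto simp: N_def)
    then obtain f where f: "f \<in> carrier H \<rightarrow> carrier G"
      and f1: "\<forall>l\<in>vt ` Q. \<forall>w\<in>carrier H. H.wl w \<le> 3 \<longrightarrow>
        G.wl (inv\<^bsub>G\<^esub> (f l) \<otimes>\<^bsub>G\<^esub> f (l \<otimes>\<^bsub>H\<^esub> w)) \<le> C\<^sub>1 * N powr \<theta>"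
      and f2: "\<forall>l\<in>vt ` Q. \<forall>l'\<in>carrier H.
        G.wl (inv\<^bsub>G\<^esub> (f l) \<otimes>\<^bsub>G\<^esub> f l') \<le> L' * (2 * \<rho> + 1) * N powr \<theta> \<longrightarrow>
        H.wl (inv\<^bsub>H\<^esub> l \<otimes>\<^bsub>H\<^esub> l') \<le> C\<^sub>3 * N powr \<theta>'"
      by (elim exE conjE) (rule that)
    have N1: "N powr \<theta> \<ge> 1" "N powr \<theta>' \<ge> 1"
      using \<theta> \<theta>' by (simp_all add: N_def ge_one_powr_ge_zero)
    define F where "F = (\<lambda>u. vertex_point (f (vt u)))"
    have fc: "f (vt u) \<in> carrier G" if "u \<in> Q" for u using that f vt QX by auto
    have eF: "?dG (F u) (F v) = G'.wl (inv\<^bsub>G\<^esub> (f (vt u)) \<otimes>\<^bsub>G\<^esub> f (vt v))" if "u \<in> Q" "v \<in> Q" for u v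
      unfolding F_def using G'.cayley.path_metric_vertices fc that by simp
    define r where "r = L * C\<^sub>1 * N powr \<theta>"
    define R where "R = \<rho> * N powr \<theta>"
    define k where "k = nat \<lceil>log 2 N\<rceil>"
    have k: "n \<le> 2 ^ k"
    proof -
      have "log 2 N \<le> k" by (simp add: k_def real_nat_ceiling_ge)
      then have "real N \<le> 2 powr k" by (subst (asm) log_le_iff) (auto simp: N_def)
      then have "real N \<le> real (2 ^ k)" by (simp add: powr_realpow)
      then show ?thesis unfolding of_nat_le_iff by (simp add: N_def)
    qed
    have k\<kappa>: "real k \<le> \<kappa> * N powr \<theta>"
    proof -
      have "log 2 N \<ge> 0" by (simp add: N_def)
      then have "real k \<le> ln N / ln 2 + 1" unfolding k_def log_def[symmetric] by linarith
      moreover have "ln N \<le> N powr \<theta> / \<theta>" using ln_powr_bound[of "real N" \<theta>] \<theta> by (simp add: N_def)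
      then have "ln N / ln 2 \<le> N powr \<theta> / \<theta> / ln 2" by (intro divide_right_mono) auto
      ultimately show ?thesis using N1 by (simp add: \<kappa>_def algebra_simps)
    qed
    have "\<exists>i\<le>n. dH (c t) (w i) \<le> 2 * (C\<^sub>3 * N powr \<theta>' + 2)"
    proof (rule geodesic_near_path_via_map[where F = F and Q = Q and r = r and R = R and k = k and x = x and y = y,
          OF X.Metric_space_axioms Y])
      fix u assume "u \<in> Q"
      then show "F u \<in> ?XG" unfolding F_def using fc G'.cayley.vertex_in_X by blast
    next
      fix u v assume uv: "u \<in> Q" "v \<in> Q" "dH u v \<le> 1"
      then have U: "u \<in> XH" "v \<in> XH" "vt u \<in> carrier H" "vt v \<in> carrier H" using QX vt by auto
      let ?w = "inv\<^bsub>H\<^esub> (vt u) \<otimes>\<^bsub>H\<^esub> vt v"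
      have "H.wl ?w \<le> 3" using close[OF U(1,2)] uv(3) by linarith
      moreover have "vt u \<otimes>\<^bsub>H\<^esub> ?w = vt v" using U by (simp add: c.H.m_assoc[symmetric])
      ultimately have "G.wl (inv\<^bsub>G\<^esub> (f (vt u)) \<otimes>\<^bsub>G\<^esub> f (vt v)) \<le> C\<^sub>1 * N powr \<theta>"
        using f1[rule_format, of "vt u" ?w] U uv by simp
      then have "real L * real (G.wl (inv\<^bsub>G\<^esub> (f (vt u)) \<otimes>\<^bsub>G\<^esub> f (vt v))) \<le> L * (C\<^sub>1 * N powr \<theta>)"
        by (intro mult_left_mono) auto
      moreover have "G'.wl (inv\<^bsub>G\<^esub> (f (vt u)) \<otimes>\<^bsub>G\<^esub> f (vt v)) \<le> L * G.wl (inv\<^bsub>G\<^esub> (f (vt u)) \<otimes>\<^bsub>G\<^esub> f (vt v))"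
        using L fc uv by simp
      then have "real (G'.wl (inv\<^bsub>G\<^esub> (f (vt u)) \<otimes>\<^bsub>G\<^esub> f (vt v))) \<le>
          real L * real (G.wl (inv\<^bsub>G\<^esub> (f (vt u)) \<otimes>\<^bsub>G\<^esub> f (vt v)))"
        by (simp flip: of_nat_mult)
      ultimately show "?dG (F u) (F v) \<le> r"
        unfolding eF[OF uv(1,2)] r_def by (simp add: mult.assoc)
    next
      fix u v assume uv: "u \<in> Q" "v \<in> Q" "?dG (F u) (F v) \<le> 2 * R + 1"
      then have U: "u \<in> XH" "v \<in> XH" "vt u \<in> carrier H" "vt v \<in> carrier H" using QX vt by auto
      have "2 * R + 1 \<le> (2 * \<rho> + 1) * N powr \<theta>" using N1 by (simp add: R_def algebra_simps)
      then have "real (G'.wl (inv\<^bsub>G\<^esub> (f (vt u)) \<otimes>\<^bsub>G\<^esub> f (vt v))) \<le> (2 * \<rho> + 1) * N powr \<theta>"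
        using uv eF by simp
      then have "L' * real (G'.wl (inv\<^bsub>G\<^esub> (f (vt u)) \<otimes>\<^bsub>G\<^esub> f (vt v))) \<le> L' * ((2 * \<rho> + 1) * N powr \<theta>)"
        by (intro mult_left_mono) auto
      moreover have "G.wl (inv\<^bsub>G\<^esub> (f (vt u)) \<otimes>\<^bsub>G\<^esub> f (vt v)) \<le> L' * G'.wl (inv\<^bsub>G\<^esub> (f (vt u)) \<otimes>\<^bsub>G\<^esub> f (vt v))"
        using L' fc uv by simp
      then have "real (G.wl (inv\<^bsub>G\<^esub> (f (vt u)) \<otimes>\<^bsub>G\<^esub> f (vt v))) \<le>
          L' * real (G'.wl (inv\<^bsub>G\<^esub> (f (vt u)) \<otimes>\<^bsub>G\<^esub> f (vt v)))"
        by (simp flip: of_nat_mult)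
      ultimately have "G.wl (inv\<^bsub>G\<^esub> (f (vt u)) \<otimes>\<^bsub>G\<^esub> f (vt v)) \<le> L' * (2 * \<rho> + 1) * N powr \<theta>"
        by (simp add: mult.assoc)
      then have "H.wl (inv\<^bsub>H\<^esub> (vt u) \<otimes>\<^bsub>H\<^esub> vt v) \<le> C\<^sub>3 * N powr \<theta>'"
        using f2 uv U by blast
      then show "dH u v \<le> C\<^sub>3 * N powr \<theta>' + 2" using close[OF U(1,2)] by linarith
    next
      have "\<delta> * real k \<le> \<delta> * (\<kappa> * N powr \<theta>)" using k\<kappa> Y(3) by (rule mult_left_mono)
      then show "\<delta> * real k + r \<le> R" by (simp add: r_def R_def \<rho>_def algebra_simps)
    next
      show "c ` {0..dH x y} \<subseteq> XH" using c(1,2) by simp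
      show "dH (c s) (c t) = \<bar>s - t\<bar>" if "s \<in> {0..dH x y}" "t \<in> {0..dH x y}" for s t
        using c(5) that by blast
    qed (use c(3,4) w W(1) C\<^sub>1 k t(1) in \<open>auto simp: r_def Q_def\<close>)
    then obtain i where i: "i \<le> n" "dH z (w i) \<le> 2 * (C\<^sub>3 * N powr \<theta>' + 2)" using t by blast
    have "2 * (C\<^sub>3 * N powr \<theta>' + 2) \<le> 2 * (C\<^sub>3 + 2) * N powr \<theta>'" using N1 by (simp add: algebra_simps)
    then show ?thesis using i w(3) by (intro bexI[of _ "w i"]) (auto simp: N_def add.commute)
  qed
  then show ?thesis unfolding \<theta>'_def by blast
qed

theorem corollary6:
  fixes \<Gamma> :: "('a, 'm) monoid_scheme" and \<Lambda> :: "('b, 'n) monoid_scheme"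
    and S\<^sub>\<Gamma> :: "'a set" and S\<^sub>\<Lambda> :: "'b set"
    and M :: "'w measure"
    and a :: "'a \<Rightarrow> 'w \<Rightarrow> 'w" and b :: "'b \<Rightarrow> 'w \<Rightarrow> 'w"
    and X\<^sub>\<Gamma> X\<^sub>\<Lambda> :: "'w set"
    and p q :: real
  assumes "group \<Gamma>" and "finite_generating_set \<Gamma> S\<^sub>\<Gamma>" and "hyperbolic_group \<Gamma>"
    and "group \<Lambda>" and "finite_generating_set \<Lambda> S\<^sub>\<Lambda>"
    and "p > q" and "q > 0"
    and "orbit_equivalence_coupling \<Gamma> \<Lambda> M a b X\<^sub>\<Gamma> X\<^sub>\<Lambda>"
    and "integrable_coupling (\<lambda>t. exp (t powr p)) (\<lambda>t. t powr (1 + 1 / q))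
           \<Gamma> S\<^sub>\<Gamma> \<Lambda> S\<^sub>\<Lambda> M a b X\<^sub>\<Gamma> X\<^sub>\<Lambda>"
  shows "hyperbolic_group \<Lambda>"
proof -
  have X: "X\<^sub>\<Gamma> = X\<^sub>\<Lambda>" and me: "measure_equivalence_coupling \<Gamma> \<Lambda> M a b X\<^sub>\<Lambda> X\<^sub>\<Lambda>"
    using assms(8) by (auto simp: orbit_equivalence_coupling_def)
  have coupling: "orbit_coupling \<Gamma> \<Lambda> M a b X\<^sub>\<Lambda>"
    using assms(1,4) me
    by (simp add: orbit_coupling_def orbit_coupling_axioms_def measure_equivalence_coupling_def)
  have fg\<Gamma>: "finitely_generated_group \<Gamma> S\<^sub>\<Gamma>" and fg\<Lambda>: "finitely_generated_group \<Lambda> S\<^sub>\<Lambda>"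
    using assms by (simp_all add: finitely_generated_group_def finitely_generated_group_axioms_def)
  obtain S where S: "finite_generating_set \<Gamma> S" and hyp: "hyperbolic_space
      (graph_realization (carrier \<Gamma>) (cayley_edges \<Gamma> S)) (path_metric (cayley_edges \<Gamma> S))"
    using assms(3) unfolding hyperbolic_group_def by blast
  have fgS: "finitely_generated_group \<Gamma> S"
    using assms S by (simp add: finitely_generated_group_def finitely_generated_group_axioms_def)
  interpret H: finitely_generated_group \<Lambda> S\<^sub>\<Lambda> by fact
  let ?X = "graph_realization (carrier \<Lambda>) (cayley_edges \<Lambda> S\<^sub>\<Lambda>)"
  let ?d = "path_metric (cayley_edges \<Lambda> S\<^sub>\<Lambda>)"
  interpret X: Metric_space ?X ?d by (rule H.cayley.Metric_space_realization)
  define \<theta> where "\<theta> = q / (q + 1) * (1 + 1 / p)"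
  have p: "p > 0" using assms by linarith
  have \<theta>: "0 < \<theta>" "\<theta> < 1"
  proof -
    \<comment> \<open>The product \<open>q / (q + 1) * (1 + 1 / q)\<close> equals 1, so
      \<open>p > q\<close> puts the exponent strictly below 1.\<close>
    have "1 + 1 / p < 1 + 1 / q" using assms p by (simp add: field_simps)
    then have "\<theta> < q / (q + 1) * (1 + 1 / q)" unfolding \<theta>_def using assms by (intro mult_strict_left_mono) auto
    also have "1 + 1 / q = (q + 1) / q" using assms by (simp add: add_divide_distrib)
    finally show "\<theta> < 1" using assms by simp
    show "0 < \<theta>" using assms p by (simp add: \<theta>_def add_pos_pos)
  qed
  obtain C where C: "\<forall>x y A z W n. geodesic_segment ?X ?d x y A \<longrightarrow> z \<in> A \<longrightarrow> W \<subseteq> ?X \<longrightarrow> chain ?d W n x y \<longrightarrow>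
    (\<exists>w\<in>W. ?d z w \<le> C * (2 * real n + 2) powr \<theta>)"
    using orbit_coupling_detour_bound[OF coupling fg\<Gamma> fg\<Lambda> fgS hyp p assms(7) assms(9)[unfolded X], folded \<theta>_def]
    by (elim exE) (rule that)
  have "(\<lambda>n. C * (2 * real n + 2) powr \<theta> / real n) \<longlonglongrightarrow> 0"
    using \<theta> by real_asymp
  then have "\<forall>\<^sub>F n in sequentially. C * (2 * real n + 2) powr \<theta> / real n < 1 / 120"
    by (rule order_tendstoD) simp
  then have small: "\<forall>\<^sub>F n in sequentially. C * (2 * real n + 2) powr \<theta> < real n / 120"
    using eventually_gt_at_top[of 0] by eventually_elim (simp add: field_simps)
  have "hyperbolic_space ?X ?d"
    by (rule X.sublinear_detours_imp_hyperbolic[OF H.cayley.geodesic_space_realization _ small])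
      (use C in blast)
  then show ?thesis using assms(4,5) unfolding hyperbolic_group_def by blast
qed

end
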